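(* Let $P^*\succeq0$ be the stabilizing solution of the generalized algebraic Riccati equation $$PA+A^\top P+A_1^\top PA_1-PBR^{-1}B^\top P+\gamma^{-2}PEE^\top P+Q=0,$$ and for $\delta>0$ let $\mathcal B_\delta(P^* )=\{P\in\mathcal S^n_+:\|P-P^*\|_F\le\delta\}$. For every $\varepsilon_0\in(0,1)$ there exist $\delta_0=\delta_0(\varepsilon_0)>0$ and $k_0=k_0(\delta_0)>0$ such that for every $P\in\mathcal B_{\delta_0}(P^* )$ one has $\sigma(\mathscr L_{\mathscr A(P),A_1})\subset\mathbb C_-$, and the solution $P^+$ of $\mathscr L_{\mathscr A(P),A_1}(P^+)=-(Q+PBR^{-1}B^\top P-\gamma^{-2}PEE^\top P)$ satisfies $\|P^+-P^*\|_F\le k_0\|P-P^*\|_F^2$ and $\|P^+-P^*\|_F\le\varepsilon_0\|P-P^*\|_F$; and for these $\varepsilon_0,\delta_0$ there exist $\delta_1=\delta_1(\delta_0)>0$ and $k_3=k_3(\delta_0)>0$ such that, if $\hat P^0\in\mathcal B_{\delta_0}(P^* )$ and $\|\Delta M\|_{l_\infty}:=\sup_{i\in\mathbb Z_{\ge0}}\|\Delta M^i\|_F<\delta_1$, then the Robust SPU iteration started from $\hat P^0$ with errors $\{\Delta M^i\}$ satisfies: (i) $\sigma(\mathscr L_{A-B\hat L^i-E\hat F^i,A_1})\subset\mathbb C_-$, and $[\hat M^i]_{22}$ and $[\hat M^i]_{33}$ are invertible, for all $i\in\mathbb Z_{\ge0}$. (ii) (Local input-to-state stability) For all $i\in\mathbb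 Z_{\ge0}$, $$\|\hat P^i-P^*\|_F\le\alpha\big(\|\hat P^0-P^*\|_F,i\big)+\beta\big(\|\Delta M\|_{l_\infty}\big),\qquad \alpha(s,i)=\varepsilon_0^i s,\quad \beta(s)=\frac{k_3}{1-\varepsilon_0}s .$$ (iii) If $\lim_{i\to\infty}\|\Delta M^i\|_F=0$, then $\lim_{i\to\infty}\|\hat P^i-P^*\|_F=0$.
   Context: $\mathcal S^n$ ($\mathcal S^n_+$): real symmetric (positive semidefinite) $n\times n$ matrices; $\|\cdot\|_F$: Frobenius norm; $\mathbb C_-$: open left half plane. $A,A_1\in\mathbb R^{n\times n}$, $B\in\mathbb R^{n\times m}$, $E\in\mathbb R^{n\times p}$, $C$, $D$ are constant real matrices, $D$ of full column rank, $Q=C^\top C$, $R=D^\top D$ (positive definite), $\gamma>0$. $\mathscr A(P)=A-BR^{-1}B^\top P+\gamma^{-2}EE^\top P$. For $N\in\mathbb R^{n\times n}$: $\mathscr L_{N,A_1}(X)=XN+N^\top X+A_1^\top XA_1$ and $\sigma(\mathscr L_{N,A_1})=\{\lambda:\mathscr L_{N,A_1}(X)=\lambda X,\ X\ne0,\ X\in\mathcal S^n\}$. The system $dx=Nx\,dt+A_1x\,dW$ ($W$ standard one-dimensional Brownian motion) is asymptotically mean square stable ($\mathbb E\|x(t)\|^2\to0$ for every deterministic $x(0)$) iff $\sigma(\mathscr L_{N,A_1})\subset\mathbb C_-$. A solution $P\succeq0$ of the Riccati equation is stabilizing if $dx=\mathscr A(P)x\,dt+A_1x\,dW$ is asymptotically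 mean square stable. Robust SPU iteration. For $P\in\mathcal S^n$ set $$M(P)=\begin{bmatrix}Q+A^\top P+PA+A_1^\top PA_1&PB&PE\\ B^\top P&R&0\\ E^\top P&0&-\gamma^2I_p\end{bmatrix}\in\mathcal S^{n+m+p},$$ and for $Z\in\mathcal S^{n+m+p}$, $L\in\mathbb R^{m\times n}$, $F\in\mathbb R^{p\times n}$ set $\mathscr R(Z,L,F)=[I_n,-L^\top,-F^\top]\,Z\,[I_n,-L^\top,-F^\top]^\top$. Given $\hat P^0$ and errors $\Delta M^i\in\mathcal S^{n+m+p}$ ($i\ge0$) with $\Delta M^0=0$, put $\hat L^0=R^{-1}B^\top\hat P^0$, $\hat F^0=-\gamma^{-2}E^\top\hat P^0$, $\hat M^0=M(\hat P^0)$. For $i\ge0$: let $\hat P^{i+1}$ be the solution of $\mathscr R(M(\hat P^{i+1}),\hat L^i,\hat F^i)=0$; put $\overline M^{i+1}=M(\hat P^{i+1})$, $\hat M^{i+1}=\overline M^{i+1}+\Delta M^{i+1}$, and $$\hat L^{i+1}=[\hat M^{i+1}]_{22}^{-1}[\hat M^{i+1}]_{21},\qquad \hat F^{i+1}=[\hat M^{i+1}]_{33}^{-1}[\hat M^{i+1}]_{31},$$ where $[\cdot]_{jk}$ is the $(j,k)$ block in the partition $n+m+p$. Part (i) of the claim includes that the iteration is well defined. *)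

theory Defs
  imports "HOL-Probability.Probability"
begin

section \<open>Matrices\<close>

text \<open>The Euclidean norm of type \<^typ>\<open>real^'n^'m\<close> is the square root of the sum of the squares
  of all entries, i.e. the Frobenius norm; hence \<^const>\<open>norm\<close> is used for it throughout.\<close>

definition symmetric :: "'a^'n^'n \<Rightarrow> bool" where
  "symmetric X \<longleftrightarrow> transpose X = X"

definition psd :: "real^'n^'n \<Rightarrow> bool" where
  "psd X \<longleftrightarrow> symmetric X \<and> (\<forall>v. 0 \<le> v \<bullet> (X *v v))"

definition psd_ball :: "real^'n^'n \<Rightarrow> real \<Rightarrow> (real^'n^'n) set" where
  "psd_ball P \<delta> = {X. psd X \<and> norm (X - P) \<le> \<delta>}"

definition hcat :: "'a^'n^'k \<Rightarrow> 'a^'m^'k \<Rightarrow> 'a^('n::finite + 'm::finite)^'k" where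
  "hcat X Y = (\<chi> i j. case j of Inl a \<Rightarrow> X $ i $ a | Inr b \<Rightarrow> Y $ i $ b)"

definition vcat :: "'a^'k^'n \<Rightarrow> 'a^'k^'m \<Rightarrow> 'a^'k^('n::finite + 'm::finite)" where
  "vcat X Y = (\<chi> i. case i of Inl a \<Rightarrow> X $ a | Inr b \<Rightarrow> Y $ b)"

text \<open>Blocks of a matrix partitioned as $n+m+p$. The index type is \<open>'n + ('m + 'p)\<close>, whose three
  summands are reached by \<open>Inl\<close>, \<open>Inr \<circ> Inl\<close> and \<open>Inr \<circ> Inr\<close>.\<close>

definition block21 :: "'a^('n::finite + 'm::finite + 'p::finite)^('n + 'm + 'p) \<Rightarrow> 'a^'n^'m" where
  "block21 Z = (\<chi> i j. Z $ Inr (Inl i) $ Inl j)"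

definition block22 :: "'a^('n::finite + 'm::finite + 'p::finite)^('n + 'm + 'p) \<Rightarrow> 'a^'m^'m" where
  "block22 Z = (\<chi> i j. Z $ Inr (Inl i) $ Inr (Inl j))"

definition block31 :: "'a^('n::finite + 'm::finite + 'p::finite)^('n + 'm + 'p) \<Rightarrow> 'a^'n^'p" where
  "block31 Z = (\<chi> i j. Z $ Inr (Inr i) $ Inl j)"

definition block33 :: "'a^('n::finite + 'm::finite + 'p::finite)^('n + 'm + 'p) \<Rightarrow> 'a^'p^'p" where
  "block33 Z = (\<chi> i j. Z $ Inr (Inr i) $ Inr (Inr j))"


section \<open>The generalized Lyapunov operator and its spectrum\<close>

definition lyap :: "'a::semiring_1^'n^'n \<Rightarrow> 'a^'n^'n \<Rightarrow> 'a^'n^'n \<Rightarrow> 'a^'n^'n" where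
  "lyap N A1 X = X ** N + transpose N ** X + transpose A1 ** X ** A1"

text \<open>The spectrum of the real-linear operator \<^term>\<open>lyap N A1\<close> on the symmetric matrices consists
  of complex numbers; a non-real eigenvalue only has eigenvectors in the complexification of the
  space of real symmetric matrices, that is, in the space of complex matrices with \<open>X\<^sup>T = X\<close>
  (plain transpose, not Hermitian).\<close>

definition lyap_spectrum :: "real^'n^'n \<Rightarrow> real^'n^'n \<Rightarrow> complex set" where
  "lyap_spectrum N A1 =
    {l. \<exists>X :: complex^'n^'n. symmetric X \<and> X \<noteq> 0 \<and>
      lyap (map_matrix complex_of_real N) (map_matrix complex_of_real A1) X = map_matrix ((*) l) X}"

definition open_left_half_plane :: "complex set" where
  "open_left_half_plane = {z. Re z < 0}"


section \<open>Linear stochastic differential equations and mean square stability\<close>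

text \<open>\<open>W\<close> is a standard one-dimensional Brownian motion relative to the filtration \<open>F\<close>. Only times
  \<open>t \<ge> 0\<close> matter. The filtration contains the null sets, so that Ito integrals have continuous
  adapted versions.\<close>

definition brownian_motion ::
    "'w measure \<Rightarrow> (real \<Rightarrow> 'w measure) \<Rightarrow> (real \<Rightarrow> 'w \<Rightarrow> real) \<Rightarrow> bool" where
  "brownian_motion M F W \<longleftrightarrow>
    prob_space M \<and>
    filtration (space M) F \<and> (\<forall>t. subalgebra M (F t)) \<and> null_sets M \<subseteq> sets (F 0) \<and>
    (\<forall>t\<ge>0. W t \<in> borel_measurable (F t)) \<and>
    (AE \<omega> in M. W 0 \<omega> = 0) \<and>
    (AE \<omega> in M. continuous_on {0..} (\<lambda>t. W t \<omega>)) \<and>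
    (\<forall>s t. 0 \<le> s \<and> s < t \<longrightarrow>
      distributed M lborel (\<lambda>\<omega>. W t \<omega> - W s \<omega>) (normal_density 0 (sqrt (t - s))) \<and>
      prob_space.indep_set M (sets (F s))
        {(\<lambda>\<omega>. W t \<omega> - W s \<omega>) -` S \<inter> space M | S. S \<in> sets borel})"

text \<open>The integrands of the Ito integral over \<open>[0, T]\<close>: jointly measurable, adapted, and square
  integrable over \<open>[0, T] \<times> \<Omega>\<close>.\<close>

definition ito_integrand ::
    "'w measure \<Rightarrow> (real \<Rightarrow> 'w measure) \<Rightarrow> real \<Rightarrow> (real \<Rightarrow> 'w \<Rightarrow> real^'n) \<Rightarrow> bool" where
  "ito_integrand M F T H \<longleftrightarrow>
    (\<lambda>(s, \<omega>). H s \<omega>) \<in> borel_measurable (restrict_space borel {0..T} \<Otimes>\<^sub>M M) \<and>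
    (\<forall>s\<in>{0..T}. H s \<in> borel_measurable (F s)) \<and>
    (\<integral>\<^sup>+\<omega>. (\<integral>\<^sup>+s\<in>{0..T}. ennreal ((norm (H s \<omega>))\<^sup>2) \<partial>lborel) \<partial>M) < \<infinity>"

text \<open>An elementary process takes the \<open>F (\<tau> j)\<close>-measurable value \<open>\<xi> j\<close> on \<open>(\<tau> j, \<tau> (j + 1)]\<close> for
  \<open>j < k\<close>, and is zero elsewhere.\<close>

definition elementary_data ::
    "'w measure \<Rightarrow> (real \<Rightarrow> 'w measure) \<Rightarrow> real \<Rightarrow> nat \<Rightarrow> (nat \<Rightarrow> real) \<Rightarrow>
      (nat \<Rightarrow> 'w \<Rightarrow> real^'n) \<Rightarrow> bool" where
  "elementary_data M F T k \<tau> \<xi> \<longleftrightarrow>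
    0 \<le> \<tau> 0 \<and> \<tau> k \<le> T \<and>
    (\<forall>j<k. \<tau> j \<le> \<tau> (Suc j) \<and> \<xi> j \<in> borel_measurable (F (\<tau> j)) \<and>
      integrable M (\<lambda>\<omega>. (norm (\<xi> j \<omega>))\<^sup>2))"

definition elementary_process ::
    "nat \<Rightarrow> (nat \<Rightarrow> real) \<Rightarrow> (nat \<Rightarrow> 'w \<Rightarrow> real^'n) \<Rightarrow> real \<Rightarrow> 'w \<Rightarrow> real^'n" where
  "elementary_process k \<tau> \<xi> s \<omega> = (\<Sum>j<k. indicator {\<tau> j<..\<tau> (Suc j)} s *\<^sub>R \<xi> j \<omega>)"

definition elementary_integral ::
    "(real \<Rightarrow> 'w \<Rightarrow> real) \<Rightarrow> nat \<Rightarrow> (nat \<Rightarrow> real) \<Rightarrow> (nat \<Rightarrow> 'w \<Rightarrow> real^'n) \<Rightarrow> 'w \<Rightarrow> real^'n" where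
  "elementary_integral W k \<tau> \<xi> \<omega> = (\<Sum>j<k. (W (\<tau> (Suc j)) \<omega> - W (\<tau> j) \<omega>) *\<^sub>R \<xi> j \<omega>)"

text \<open>\<open>I\<close> is a version of \<open>\<integral>\<^sub>0\<^sup>T H dW\<close>: the mean square limit of the integrals of elementary processes
  approximating \<open>H\<close>.\<close>

definition has_ito_integral ::
    "'w measure \<Rightarrow> (real \<Rightarrow> 'w measure) \<Rightarrow> (real \<Rightarrow> 'w \<Rightarrow> real) \<Rightarrow> real \<Rightarrow>
      (real \<Rightarrow> 'w \<Rightarrow> real^'n) \<Rightarrow> ('w \<Rightarrow> real^'n) \<Rightarrow> bool" where
  "has_ito_integral M F W T H I \<longleftrightarrow>
    ito_integrand M F T H \<and> I \<in> borel_measurable M \<and>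
    (\<exists>k \<tau> \<xi>.
      (\<forall>r. elementary_data M F T (k r) (\<tau> r) (\<xi> r)) \<and>
      (\<lambda>r::nat. \<integral>\<^sup>+\<omega>. (\<integral>\<^sup>+s\<in>{0..T}.
          ennreal ((norm (H s \<omega> - elementary_process (k r) (\<tau> r) (\<xi> r) s \<omega>))\<^sup>2) \<partial>lborel) \<partial>M)
        \<longlonglongrightarrow> 0 \<and>
      (\<lambda>r::nat. \<integral>\<^sup>+\<omega>. ennreal ((norm (I \<omega> - elementary_integral W (k r) (\<tau> r) (\<xi> r) \<omega>))\<^sup>2) \<partial>M)
        \<longlonglongrightarrow> 0)"

text \<open>\<open>x\<close> is a (strong) solution of \<open>dx = N x dt + A1 x dW\<close> with deterministic initial value \<open>x0\<close>.\<close>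

definition linear_sde_solution ::
    "'w measure \<Rightarrow> (real \<Rightarrow> 'w measure) \<Rightarrow> (real \<Rightarrow> 'w \<Rightarrow> real) \<Rightarrow> real^'n^'n \<Rightarrow> real^'n^'n \<Rightarrow>
      real^'n \<Rightarrow> (real \<Rightarrow> 'w \<Rightarrow> real^'n) \<Rightarrow> bool" where
  "linear_sde_solution M F W N A1 x0 x \<longleftrightarrow>
    (\<forall>\<omega>\<in>space M. continuous_on {0..} (\<lambda>t. x t \<omega>)) \<and>
    (\<forall>T\<ge>0. ito_integrand M F T x \<and>
      (\<exists>I. has_ito_integral M F W T (\<lambda>s \<omega>. A1 *v x s \<omega>) I \<and>
        (AE \<omega> in M. x T \<omega> = x0 + integral {0..T} (\<lambda>s. N *v x s \<omega>) + I \<omega>)))"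

text \<open>For every \<open>x0\<close> the solution exists and is unique up to indistinguishability, so both
  quantifiers below speak about the solution. The second moment is a nonnegative extended real, so
  that non-integrability is not mistaken for convergence.\<close>

definition ams_stable ::
    "'w measure \<Rightarrow> (real \<Rightarrow> 'w measure) \<Rightarrow> (real \<Rightarrow> 'w \<Rightarrow> real) \<Rightarrow> real^'n^'n \<Rightarrow> real^'n^'n \<Rightarrow> bool" where
  "ams_stable M F W N A1 \<longleftrightarrow>
    (\<forall>x0. (\<exists>x. linear_sde_solution M F W N A1 x0 x) \<and>
      (\<forall>x. linear_sde_solution M F W N A1 x0 x \<longrightarrow>
        ((\<lambda>t. \<integral>\<^sup>+\<omega>. ennreal ((norm (x t \<omega>))\<^sup>2) \<partial>M) \<longlongrightarrow> 0) at_top))"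


section \<open>Riccati equation and robust SPU iteration\<close>

definition closed_loop ::
    "real^'n^'n \<Rightarrow> real^'m^'n \<Rightarrow> real^'p^'n \<Rightarrow> real^'m^'m \<Rightarrow> real \<Rightarrow> real^'n^'n \<Rightarrow> real^'n^'n" where
  "closed_loop A B E R \<gamma> P =
    A - B ** matrix_inv R ** transpose B ** P + (1 / \<gamma>\<^sup>2) *\<^sub>R (E ** transpose E ** P)"

definition gare ::
    "real^'n^'n \<Rightarrow> real^'n^'n \<Rightarrow> real^'m^'n \<Rightarrow> real^'p^'n \<Rightarrow> real^'n^'n \<Rightarrow> real^'m^'m \<Rightarrow> real \<Rightarrow>
      real^'n^'n \<Rightarrow> bool" where
  "gare A A1 B E Q R \<gamma> P \<longleftrightarrow>
    P ** A + transpose A ** P + transpose A1 ** P ** A1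
      - P ** B ** matrix_inv R ** transpose B ** P
      + (1 / \<gamma>\<^sup>2) *\<^sub>R (P ** E ** transpose E ** P) + Q = 0"

definition stabilizing_solution ::
    "'w measure \<Rightarrow> (real \<Rightarrow> 'w measure) \<Rightarrow> (real \<Rightarrow> 'w \<Rightarrow> real) \<Rightarrow>
      real^'n^'n \<Rightarrow> real^'n^'n \<Rightarrow> real^'m^'n \<Rightarrow> real^'p^'n \<Rightarrow> real^'n^'n \<Rightarrow> real^'m^'m \<Rightarrow> real \<Rightarrow>
      real^'n^'n \<Rightarrow> bool" where
  "stabilizing_solution M F W A A1 B E Q R \<gamma> P \<longleftrightarrow>
    psd P \<and> gare A A1 B E Q R \<gamma> P \<and> ams_stable M F W (closed_loop A B E R \<gamma> P) A1"

definition newton_step ::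
    "real^'n^'n \<Rightarrow> real^'n^'n \<Rightarrow> real^'m^'n \<Rightarrow> real^'p^'n \<Rightarrow> real^'n^'n \<Rightarrow> real^'m^'m \<Rightarrow> real \<Rightarrow>
      real^'n^'n \<Rightarrow> real^'n^'n \<Rightarrow> bool" where
  "newton_step A A1 B E Q R \<gamma> P X \<longleftrightarrow> symmetric X \<and>
    lyap (closed_loop A B E R \<gamma> P) A1 X =
      - (Q + P ** B ** matrix_inv R ** transpose B ** P
           - (1 / \<gamma>\<^sup>2) *\<^sub>R (P ** E ** transpose E ** P))"

definition spu_matrix ::
    "real^'n^'n \<Rightarrow> real^'n^'n \<Rightarrow> real^'m^'n \<Rightarrow> real^'p^'n \<Rightarrow> real^'n^'n \<Rightarrow> real^'m^'m \<Rightarrow> real \<Rightarrow>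
      real^'n^'n \<Rightarrow> real^('n::finite + 'm::finite + 'p::finite)^('n + 'm + 'p)" where
  "spu_matrix A A1 B E Q R \<gamma> P =
    vcat (hcat (Q + transpose A ** P + P ** A + transpose A1 ** P ** A1)
               (hcat (P ** B) (P ** E)))
   (vcat (hcat (transpose B ** P)
               (hcat R 0))
         (hcat (transpose E ** P)
               (hcat 0 (- (\<gamma>\<^sup>2 *\<^sub>R mat 1)))))"

definition spu_residual ::
    "real^('n::finite + 'm::finite + 'p::finite)^('n + 'm + 'p) \<Rightarrow> real^'n^'m \<Rightarrow> real^'n^'p \<Rightarrow> real^'n^'n" where
  "spu_residual Z L K =
    (let G = hcat (mat 1) (hcat (- transpose L) (- transpose K)) in G ** Z ** transpose G)"

definition spu_eval ::
    "real^'n^'n \<Rightarrow> real^'n^'n \<Rightarrow> real^'m^'n \<Rightarrow> real^'p^'n \<Rightarrow> real^'n^'n \<Rightarrow> real^'m^'m \<Rightarrow> real \<Rightarrow>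
      real^'n^'m \<Rightarrow> real^'n^'p \<Rightarrow> real^'n^'n \<Rightarrow> bool" where
  "spu_eval A A1 B E Q R \<gamma> L K X \<longleftrightarrow>
    symmetric X \<and> spu_residual (spu_matrix A A1 B E Q R \<gamma> X) L K = 0"

text \<open>Robust SPU iteration: \<open>P i\<close>, \<open>L i\<close>, \<open>K i\<close> are the value matrix and the two gains (\<open>K\<close> for the
  disturbance input \<open>E\<close>), and \<open>Mh i\<close> is the perturbed matrix, with perturbation \<open>\<Delta> i\<close>. The
  perturbation \<open>\<Delta> 0\<close> is required to vanish where the iteration is used.\<close>

definition robust_spu ::
    "real^'n^'n \<Rightarrow> real^'n^'n \<Rightarrow> real^'m^'n \<Rightarrow> real^'p^'n \<Rightarrow> real^'n^'n \<Rightarrow> real^'m^'m \<Rightarrow> real \<Rightarrow>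
      real^'n^'n \<Rightarrow> (nat \<Rightarrow> real^('n::finite + 'm::finite + 'p::finite)^('n + 'm + 'p)) \<Rightarrow>
      (nat \<Rightarrow> real^'n^'n) \<Rightarrow> (nat \<Rightarrow> real^'n^'m) \<Rightarrow> (nat \<Rightarrow> real^'n^'p) \<Rightarrow>
      (nat \<Rightarrow> real^('n::finite + 'm::finite + 'p::finite)^('n + 'm + 'p)) \<Rightarrow> bool" where
  "robust_spu A A1 B E Q R \<gamma> P0 \<Delta> P L K Mh \<longleftrightarrow>
    P 0 = P0 \<and>
    L 0 = matrix_inv R ** transpose B ** P0 \<and>
    K 0 = - ((1 / \<gamma>\<^sup>2) *\<^sub>R (transpose E ** P0)) \<and>
    Mh 0 = spu_matrix A A1 B E Q R \<gamma> P0 \<and>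
    (\<forall>i. spu_eval A A1 B E Q R \<gamma> (L i) (K i) (P (Suc i)) \<and>
      Mh (Suc i) = spu_matrix A A1 B E Q R \<gamma> (P (Suc i)) + \<Delta> (Suc i) \<and>
      L (Suc i) = matrix_inv (block22 (Mh (Suc i))) ** block21 (Mh (Suc i)) \<and>
      K (Suc i) = matrix_inv (block33 (Mh (Suc i))) ** block31 (Mh (Suc i)))"

end

theory Submission
  imports Defs
begin

text \<open>
  Why the theorem holds. Stability of the closed loop at the stabilizing solution \<open>P\<^sup>*\<close> is an open
  condition, and near \<open>P\<^sup>*\<close> one evaluation step is a Newton step for the Riccati equation, whose error
  is quadratic in the error of the two gains.

  The hypothesis on \<open>P\<^sup>*\<close> is stochastic, while the rest is matrix analysis, so mean square stability has
  to be turned into the spectral condition (\<open>ams_stable_spectrum\<close>). Let \<open>x\<close> solve \<open>dx = N x dt + A1 x dW\<close>.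
  The quadratic moments satisfy the closed linear equation
  \<open>E(x\<^sub>T \<bullet> U x\<^sub>T) = x0 \<bullet> U x0 + \<integral>\<^sub>0\<^sup>T E(x\<^sub>s \<bullet> \<L>(U) x\<^sub>s) ds\<close>, where \<open>\<L>\<close> is the Lyapunov operator of \<open>(N, A1)\<close>
  (\<open>second_moment_equation\<close>). If \<open>\<L>(X) = l X\<close> with a complex symmetric \<open>X \<noteq> 0\<close>, then the complex number
  \<open>f(T) = E(x\<^sub>T \<bullet> X x\<^sub>T)\<close> satisfies \<open>f(T) = f(0) + l \<integral>\<^sub>0\<^sup>T f\<close>, hence \<open>f(T) = exp(l T) f(0)\<close>. Some initial
  value has \<open>f(0) \<noteq> 0\<close> by polarization, and stability forces \<open>f(T) \<rightarrow> 0\<close>, so \<open>Re l < 0\<close>.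

  The moment equation is the Ito formula for a quadratic form, in expectation. Write \<open>x = y + a\<close> with the
  absolutely continuous drift \<open>a\<close> and the martingale \<open>y = x0 + \<integral> A1 x dW\<close>. For fixed \<open>\<omega>\<close> the value \<open>y\<^sub>T\<close> is a
  constant, so the ordinary fundamental theorem of calculus, applied to
  \<open>t \<mapsto> (y\<^sub>T + a\<^sub>t) \<bullet> U (y\<^sub>T + a\<^sub>t)\<close>, gives
  \<open>x\<^sub>T \<bullet> U x\<^sub>T = y\<^sub>T \<bullet> U y\<^sub>T + 2 \<integral>\<^sub>0\<^sup>T (y\<^sub>T + a\<^sub>s) \<bullet> U N x\<^sub>s ds\<close>. In expectation the first term is given by the
  Ito isometry (\<open>ito_isometry\<close>), and in the second one \<open>y\<^sub>T\<close> may be replaced by \<open>y\<^sub>s\<close>, because \<open>U N x\<^sub>s\<close> is known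
  at time \<open>s\<close> (\<open>ito_martingale\<close>); then \<open>y\<^sub>s + a\<^sub>s = x\<^sub>s\<close>.

  On the deterministic side, compactness turns the spectral condition into a quantitative bound
  \<open>c \<parallel>X\<parallel> \<le> \<parallel>\<L>(X) - l X\<parallel>\<close> for all \<open>l\<close> with \<open>Re l \<ge> 0\<close> (\<open>ex_resolvent_bound\<close>). Such a bound survives small
  changes of \<open>N\<close> with a smaller constant (\<open>resolvent_bound_perturb\<close>) and contains all that is needed:
  the spectrum stays in the left half plane, the Lyapunov equation is uniquely solvable, and solutions
  are bounded by the right hand side. Completing the square in the Riccati equation shows that the
  solution \<open>X\<close> of \<open>\<R>(M(X), L, K) = 0\<close> satisfies
  \<open>\<L>(X - P\<^sup>*) = - (L - L\<^sup>*)\<^sup>T R (L - L\<^sup>*) + \<gamma>\<^sup>2 (K - K\<^sup>*)\<^sup>T (K - K\<^sup>*)\<close>, where now \<open>\<L>\<close> belongs to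
  \<open>(A - B L - E K, A1)\<close> and \<open>L\<^sup>*\<close>, \<open>K\<^sup>*\<close> are the gains at \<open>P\<^sup>*\<close> (\<open>lyap_completed_square\<close>). The gains computed from
  \<open>M(P) + \<Delta>\<close> differ from \<open>L\<^sup>*\<close>, \<open>K\<^sup>*\<close> by at most a constant times \<open>\<parallel>P - P\<^sup>*\<parallel> + \<parallel>\<Delta>\<parallel>\<close> (\<open>perturbed_gain\<close>), so
  \<open>\<parallel>X - P\<^sup>*\<parallel> \<le> c (\<parallel>P - P\<^sup>*\<parallel> + \<parallel>\<Delta>\<parallel>)\<^sup>2\<close> (\<open>perturbed_newton_step\<close>). On a ball of small radius this
  is at most \<open>\<epsilon>0 \<parallel>P - P\<^sup>*\<parallel> + k3 \<parallel>\<Delta>\<parallel>\<close>, a linear recursion that keeps the iterates in the ball and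
  yields the asserted bounds. The exact Newton step is the case \<open>\<Delta> = 0\<close>.
\<close>

section \<open>Square integrable functions\<close>

definition sq_integrable :: "'a measure \<Rightarrow> ('a \<Rightarrow> 'b::euclidean_space) \<Rightarrow> bool" where
  "sq_integrable N f \<longleftrightarrow> f \<in> borel_measurable N \<and> integrable N (\<lambda>x. (norm (f x))\<^sup>2)"

definition l2_dist2 :: "'a measure \<Rightarrow> ('a \<Rightarrow> 'b::euclidean_space) \<Rightarrow> ('a \<Rightarrow> 'b) \<Rightarrow> real" where
  "l2_dist2 N f g = (\<integral>x. (norm (f x - g x))\<^sup>2 \<partial>N)"

lemma sq_integrable_measurable [measurable_dest]:
  "sq_integrable N f \<Longrightarrow> f \<in> borel_measurable N"
  by (simp add: sq_integrable_def)

lemma sq_integrable_bound: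
  fixes f :: "'a \<Rightarrow> 'b::euclidean_space"
  assumes "f \<in> borel_measurable N" "integrable N g" "\<And>x. x \<in> space N \<Longrightarrow> (norm (f x))\<^sup>2 \<le> g x"
  shows "sq_integrable N f"
  unfolding sq_integrable_def
proof
  show "integrable N (\<lambda>x. (norm (f x))\<^sup>2)"
    by (rule Bochner_Integration.integrable_bound[OF assms(2)])
      (use assms in \<open>auto intro!: AE_I2 intro: order_trans[OF _ abs_ge_self]\<close>)
qed fact

lemma norm_add_square_le:
  fixes x y :: "'b::real_normed_vector"
  shows "(norm (x + y))\<^sup>2 \<le> 2 * (norm x)\<^sup>2 + 2 * (norm y)\<^sup>2"
proof -
  have "(norm (x + y))\<^sup>2 \<le> (norm x + norm y)\<^sup>2"
    by (simp add: norm_triangle_ineq power_mono)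
  also have "\<dots> \<le> 2 * (norm x)\<^sup>2 + 2 * (norm y)\<^sup>2"
    using sum_squares_bound[of "norm x" "norm y"] by (simp add: power2_sum)
  finally show ?thesis .
qed

lemma sq_integrable_add:
  assumes "sq_integrable N f" "sq_integrable N g"
  shows "sq_integrable N (\<lambda>x. f x + g x)"
  by (rule sq_integrable_bound[where g = "\<lambda>x. 2 * (norm (f x))\<^sup>2 + 2 * (norm (g x))\<^sup>2"])
    (use assms norm_add_square_le in \<open>auto simp: sq_integrable_def\<close>)

lemma sq_integrable_zero: "sq_integrable N (\<lambda>x. 0)"
  by (simp add: sq_integrable_def)

lemma sq_integrable_const: "finite_measure N \<Longrightarrow> sq_integrable N (\<lambda>x. c)"
  by (simp add: sq_integrable_def finite_measure.integrable_const)

lemma sq_integrable_bounded_linear: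
  fixes f :: "'a \<Rightarrow> 'b::euclidean_space" and h :: "'b \<Rightarrow> 'c::euclidean_space"
  assumes h: "bounded_linear h" and f: "sq_integrable N f"
  shows "sq_integrable N (\<lambda>x. h (f x))"
proof (rule sq_integrable_bound)
  have "h \<in> borel_measurable borel"
    by (intro borel_measurable_continuous_onI linear_continuous_on h)
  then show "(\<lambda>x. h (f x)) \<in> borel_measurable N"
    using f by (auto simp: sq_integrable_def)
  show "integrable N (\<lambda>x. (onorm h)\<^sup>2 * (norm (f x))\<^sup>2)"
    using f by (auto simp: sq_integrable_def)
  show "(norm (h (f x)))\<^sup>2 \<le> (onorm h)\<^sup>2 * (norm (f x))\<^sup>2" for x
    using power_mono[OF onorm[OF h, of "f x"], of 2] by (simp add: power_mult_distrib)
qed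

lemma sq_integrable_scaleR: "sq_integrable N f \<Longrightarrow> sq_integrable N (\<lambda>x. c *\<^sub>R f x)"
  by (rule sq_integrable_bounded_linear[OF bounded_linear_scaleR_right])

lemma sq_integrable_diff:
  assumes "sq_integrable N f" "sq_integrable N g"
  shows "sq_integrable N (\<lambda>x. f x - g x)"
  using sq_integrable_add[OF assms(1) sq_integrable_scaleR[OF assms(2), of "-1"]] by simp

lemma sq_integrable_matrix:
  fixes A :: "real^'n^'k"
  shows "sq_integrable N f \<Longrightarrow> sq_integrable N (\<lambda>x. A *v f x)"
  by (rule sq_integrable_bounded_linear[OF matrix_vector_mul_bounded_linear])

lemma sq_integrable_cong_AE:
  assumes "AE x in N. f x = g x" "g \<in> borel_measurable N" "sq_integrable N f"
  shows "sq_integrable N g"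
  unfolding sq_integrable_def
proof
  show "integrable N (\<lambda>x. (norm (g x))\<^sup>2)"
    by (rule integrable_cong_AE_imp[of N "\<lambda>x. (norm (f x))\<^sup>2"])
      (use assms in \<open>auto simp: sq_integrable_def\<close>)
qed fact

lemma integrable_inner_sq_integrable:
  fixes f g :: "'a \<Rightarrow> 'b::euclidean_space"
  assumes f: "sq_integrable N f" and g: "sq_integrable N g"
  shows "integrable N (\<lambda>x. f x \<bullet> g x)"
proof (rule Bochner_Integration.integrable_bound)
  show "integrable N (\<lambda>x. (norm (f x))\<^sup>2 + (norm (g x))\<^sup>2)"
    using f g by (auto simp: sq_integrable_def)
  show "(\<lambda>x. f x \<bullet> g x) \<in> borel_measurable N"
    using f g by (auto simp: sq_integrable_def)
  have "norm (u \<bullet> v) \<le> norm ((norm u)\<^sup>2 + (norm v)\<^sup>2)" for u v :: 'b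
  proof -
    have "norm (u \<bullet> v) \<le> norm u * norm v" using Cauchy_Schwarz_ineq2[of u v] by simp
    also have "\<dots> \<le> (norm u)\<^sup>2 + (norm v)\<^sup>2"
      using sum_squares_bound[of "norm u" "norm v"] mult_nonneg_nonneg[OF norm_ge_zero[of u] norm_ge_zero[of v]]
      by linarith
    finally show ?thesis by simp
  qed
  then show "AE x in N. norm (f x \<bullet> g x) \<le> norm ((norm (f x))\<^sup>2 + (norm (g x))\<^sup>2)"
    by simp
qed

text \<open>The quadratic polynomial \<open>t \<mapsto> \<integral> |f + t g|\<^sup>2\<close> is nonnegative, so its discriminant is not positive.\<close>

lemma l2_Cauchy_Schwarz:
  fixes f g :: "'a \<Rightarrow> 'b::euclidean_space"
  assumes f: "sq_integrable N f" and g: "sq_integrable N g"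
  shows "\<bar>\<integral>x. f x \<bullet> g x \<partial>N\<bar> \<le> sqrt (\<integral>x. (norm (f x))\<^sup>2 \<partial>N) * sqrt (\<integral>x. (norm (g x))\<^sup>2 \<partial>N)"
proof -
  define a where "a = (\<integral>x. (norm (f x))\<^sup>2 \<partial>N)"
  define b where "b = (\<integral>x. f x \<bullet> g x \<partial>N)"
  define c where "c = (\<integral>x. (norm (g x))\<^sup>2 \<partial>N)"
  have i: "integrable N (\<lambda>x. (norm (f x))\<^sup>2)" "integrable N (\<lambda>x. (norm (g x))\<^sup>2)"
    "integrable N (\<lambda>x. f x \<bullet> g x)"
    using f g integrable_inner_sq_integrable by (auto simp: sq_integrable_def)
  have quad: "0 \<le> a + 2 * t * b + t\<^sup>2 * c" for t
  proof -
    have "0 \<le> (\<integral>x. (norm (f x + t *\<^sub>R g x))\<^sup>2 \<partial>N)" by simp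
    also have "(\<lambda>x. (norm (f x + t *\<^sub>R g x))\<^sup>2) =
        (\<lambda>x. (norm (f x))\<^sup>2 + 2 * t * (f x \<bullet> g x) + t\<^sup>2 * (norm (g x))\<^sup>2)"
      by (rule ext, simp add: power2_norm_eq_inner inner_add_left inner_add_right inner_commute)
        (simp add: power2_eq_square algebra_simps)
    also have "(\<integral>x. (norm (f x))\<^sup>2 + 2 * t * (f x \<bullet> g x) + t\<^sup>2 * (norm (g x))\<^sup>2 \<partial>N)
        = a + 2 * t * b + t\<^sup>2 * c"
      using i by (simp add: a_def b_def c_def)
    finally show ?thesis .
  qed
  have nn: "0 \<le> a" "0 \<le> c" by (auto simp: a_def c_def)
  have "b\<^sup>2 \<le> a * c"
  proof (cases "c = 0")
    case True
    have "b = 0"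
    proof (rule ccontr)
      assume "b \<noteq> 0"
      then have "2 * (- (a + 1) / (2 * b)) * b = - (a + 1)" by simp
      then show False using quad[of "- (a + 1) / (2 * b)"] True by simp
    qed
    then show ?thesis using True by simp
  next
    case False
    then have "c > 0" using nn by simp
    have "2 * (- b / c) * b + (- b / c)\<^sup>2 * c = - (b\<^sup>2 / c)"
      using \<open>c > 0\<close> by (simp add: power2_eq_square)
    then have "b\<^sup>2 / c \<le> a" using quad[of "- b / c"] by linarith
    then show ?thesis using \<open>c > 0\<close> by (simp add: pos_divide_le_eq)
  qed
  then have "sqrt (b\<^sup>2) \<le> sqrt (a * c)" by (rule real_sqrt_le_mono)
  then show ?thesis by (simp add: a_def b_def c_def real_sqrt_mult)
qed

text \<open>The inner product is jointly continuous in \<open>L\<^sup>2\<close>. This one fact carries the isometry and the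
  martingale property from simple integrands to all Ito integrals, on \<open>M\<close> and on the product of time and \<open>M\<close>.\<close>

lemma tendsto_inner_l2:
  fixes f g :: "'a \<Rightarrow> 'b::euclidean_space"
  assumes f: "sq_integrable N f" and g: "sq_integrable N g"
    and F: "\<And>r. sq_integrable N (F r)" and G: "\<And>r. sq_integrable N (G r)"
    and limF: "(\<lambda>r. l2_dist2 N (F r) f) \<longlonglongrightarrow> 0" and limG: "(\<lambda>r. l2_dist2 N (G r) g) \<longlonglongrightarrow> 0"
  shows "(\<lambda>r. \<integral>x. F r x \<bullet> G r x \<partial>N) \<longlonglongrightarrow> (\<integral>x. f x \<bullet> g x \<partial>N)"
proof -
  note sq = f g F G sq_integrable_diff[OF F f] sq_integrable_diff[OF G g]
  let ?n = "\<lambda>h. sqrt (\<integral>x. (norm (h x))\<^sup>2 \<partial>N)"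
  let ?dF = "\<lambda>r x. F r x - f x" and ?dG = "\<lambda>r x. G r x - g x"
  have eq: "(\<integral>x. F r x \<bullet> G r x \<partial>N) - (\<integral>x. f x \<bullet> g x \<partial>N) =
     (\<integral>x. ?dF r x \<bullet> ?dG r x \<partial>N) + (\<integral>x. ?dF r x \<bullet> g x \<partial>N) + (\<integral>x. f x \<bullet> ?dG r x \<partial>N)" for r
  proof -
    have "(\<integral>x. F r x \<bullet> G r x \<partial>N) =
      (\<integral>x. (?dF r x \<bullet> ?dG r x + ?dF r x \<bullet> g x + f x \<bullet> ?dG r x) + f x \<bullet> g x \<partial>N)"
      by (intro Bochner_Integration.integral_cong) (auto simp: inner_diff_left inner_diff_right)
    also have "\<dots> = (\<integral>x. ?dF r x \<bullet> ?dG r x \<partial>N) + (\<integral>x. ?dF r x \<bullet> g x \<partial>N) + (\<integral>x. f x \<bullet> ?dG r x \<partial>N)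
        + (\<integral>x. f x \<bullet> g x \<partial>N)"
      by (simp add: integrable_inner_sq_integrable sq)
    finally show ?thesis by simp
  qed
  have "(\<lambda>r. ?n (?dF r) * ?n (?dG r) + ?n (?dF r) * ?n g + ?n f * ?n (?dG r)) \<longlonglongrightarrow> 
      sqrt 0 * sqrt 0 + sqrt 0 * ?n g + ?n f * sqrt 0"
    by (intro tendsto_intros limF[unfolded l2_dist2_def] limG[unfolded l2_dist2_def])
  then have lim: "(\<lambda>r. ?n (?dF r) * ?n (?dG r) + ?n (?dF r) * ?n g + ?n f * ?n (?dG r)) \<longlonglongrightarrow> 0"
    by simp
  have "(\<lambda>r. (\<integral>x. F r x \<bullet> G r x \<partial>N) - (\<integral>x. f x \<bullet> g x \<partial>N)) \<longlonglongrightarrow> 0"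
  proof (rule Lim_null_comparison[OF _ lim], rule always_eventually, rule allI)
    fix r
    show "norm ((\<integral>x. F r x \<bullet> G r x \<partial>N) - (\<integral>x. f x \<bullet> g x \<partial>N)) \<le>
      ?n (?dF r) * ?n (?dG r) + ?n (?dF r) * ?n g + ?n f * ?n (?dG r)"
      unfolding eq real_norm_def
      using l2_Cauchy_Schwarz[OF sq(5) sq(6), of r r] l2_Cauchy_Schwarz[OF sq(5) sq(2), of r]
        l2_Cauchy_Schwarz[OF sq(1) sq(6), of r] by linarith
  qed
  then show ?thesis by (simp add: LIM_zero_iff)
qed

lemma l2_dist2_commute: "l2_dist2 N f g = l2_dist2 N g f"
  by (simp add: l2_dist2_def norm_minus_commute)

lemma l2_dist2_self [simp]: "l2_dist2 N f f = 0"
  by (simp add: l2_dist2_def)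

lemma l2_dist2_triangle:
  assumes "sq_integrable N f" "sq_integrable N g" "sq_integrable N h"
  shows "l2_dist2 N f h \<le> 2 * l2_dist2 N f g + 2 * l2_dist2 N g h"
proof -
  have i: "integrable N (\<lambda>x. (norm (f x - h x))\<^sup>2)" "integrable N (\<lambda>x. (norm (f x - g x))\<^sup>2)"
     "integrable N (\<lambda>x. (norm (g x - h x))\<^sup>2)"
    using assms sq_integrable_diff[of N f h] sq_integrable_diff[of N f g] sq_integrable_diff[of N g h]
    by (auto simp: sq_integrable_def)
  have "(\<integral>x. (norm (f x - h x))\<^sup>2 \<partial>N) \<le> (\<integral>x. 2 * (norm (f x - g x))\<^sup>2 + 2 * (norm (g x - h x))\<^sup>2 \<partial>N)"
    using norm_add_square_le[of "f x - g x" "g x - h x" for x] i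
    by (intro integral_mono) auto
  also have "\<dots> = 2 * l2_dist2 N f g + 2 * l2_dist2 N g h"
    using i by (simp add: l2_dist2_def)
  finally show ?thesis by (simp add: l2_dist2_def)
qed

lemma l2_dist2_nonneg [simp]: "0 \<le> l2_dist2 N f g"
  by (simp add: l2_dist2_def)

text \<open>A single approximation at finite distance already makes the limit square integrable; afterwards the
  extended real integrals are finite and can be treated as real numbers.\<close>

lemma l2_limit_from_nn_integral:
  fixes f :: "'a \<Rightarrow> 'b::euclidean_space"
  assumes f: "f \<in> borel_measurable N" and F: "\<And>r. sq_integrable N (F r)"
    and lim: "(\<lambda>r. \<integral>\<^sup>+x. ennreal ((norm (f x - F r x))\<^sup>2) \<partial>N) \<longlonglongrightarrow> 0"
  shows "sq_integrable N f" "(\<lambda>r. l2_dist2 N (F r) f) \<longlonglongrightarrow> 0"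
proof -
  have "\<forall>\<^sub>F r in sequentially. (\<integral>\<^sup>+x. ennreal ((norm (f x - F r x))\<^sup>2) \<partial>N) < 1"
    using lim by (rule order_tendstoD) simp
  then obtain r where r: "(\<integral>\<^sup>+x. ennreal ((norm (f x - F r x))\<^sup>2) \<partial>N) < 1"
    unfolding eventually_sequentially by blast
  then have "(\<integral>\<^sup>+x. ennreal ((norm (f x - F r x))\<^sup>2) \<partial>N) < \<infinity>"
    by (rule order.strict_trans) simp
  moreover have m: "(\<lambda>x. f x - F r x) \<in> borel_measurable N" for r
    using f sq_integrable_measurable[OF F, of r] by simp
  ultimately have "sq_integrable N (\<lambda>x. f x - F r x)"
    unfolding sq_integrable_def integrable_iff_bounded by simp
  from sq_integrable_add[OF this F, of r] show sqf: "sq_integrable N f" by simp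
  have "(\<integral>\<^sup>+x. ennreal ((norm (f x - F r x))\<^sup>2) \<partial>N) = ennreal (l2_dist2 N (F r) f)" for r
    unfolding l2_dist2_commute[of _ "F r"] unfolding l2_dist2_def
    using sq_integrable_diff[OF sqf F] by (intro nn_integral_eq_integral) (auto simp: sq_integrable_def)
  then have "(\<lambda>r. ennreal (l2_dist2 N (F r) f)) \<longlonglongrightarrow> ennreal 0"
    using lim by simp
  then show "(\<lambda>r. l2_dist2 N (F r) f) \<longlonglongrightarrow> 0"
    by (subst (asm) tendsto_ennreal_iff) auto
qed

lemma tendsto_l2_bounded_linear:
  fixes f :: "'a \<Rightarrow> 'b::euclidean_space" and h :: "'b \<Rightarrow> 'c::euclidean_space"
  assumes h: "bounded_linear h" and f: "sq_integrable N f" and F: "\<And>r. sq_integrable N (F r)"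
    and lim: "(\<lambda>r. l2_dist2 N (F r) f) \<longlonglongrightarrow> 0"
  shows "(\<lambda>r. l2_dist2 N (\<lambda>x. h (F r x)) (\<lambda>x. h (f x))) \<longlonglongrightarrow> 0"
proof -
  interpret h: bounded_linear h by (rule h)
  have "(\<lambda>r. (onorm h)\<^sup>2 * l2_dist2 N (F r) f) \<longlonglongrightarrow> (onorm h)\<^sup>2 * 0"
    by (intro tendsto_intros lim)
  then have lim': "(\<lambda>r. (onorm h)\<^sup>2 * l2_dist2 N (F r) f) \<longlonglongrightarrow> 0" by simp
  show ?thesis
  proof (rule Lim_null_comparison[OF _ lim'], rule always_eventually, rule allI)
    fix r
    have sq: "sq_integrable N (\<lambda>x. F r x - f x)" by (rule sq_integrable_diff[OF F f])
    have "(\<integral>x. (norm (h (F r x) - h (f x)))\<^sup>2 \<partial>N) \<le> (\<integral>x. (onorm h)\<^sup>2 * (norm (F r x - f x))\<^sup>2 \<partial>N)"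
    proof (rule integral_mono)
      show "integrable N (\<lambda>x. (norm (h (F r x) - h (f x)))\<^sup>2)"
        using sq_integrable_bounded_linear[OF h sq] by (simp add: sq_integrable_def h.diff)
      show "integrable N (\<lambda>x. (onorm h)\<^sup>2 * (norm (F r x - f x))\<^sup>2)"
        using sq by (simp add: sq_integrable_def)
      show "(norm (h (F r x) - h (f x)))\<^sup>2 \<le> (onorm h)\<^sup>2 * (norm (F r x - f x))\<^sup>2" for x
        using power_mono[OF onorm[OF h, of "F r x - f x"], of 2]
        by (simp add: power_mult_distrib h.diff)
    qed
    then show "norm (l2_dist2 N (\<lambda>x. h (F r x)) (\<lambda>x. h (f x))) \<le> (onorm h)\<^sup>2 * l2_dist2 N (F r) f"
      by (simp add: l2_dist2_def)
  qed
qed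

section \<open>Increments of a Brownian motion\<close>

locale brownian_filtration =
  fixes M :: "'w measure" and \<F> :: "real \<Rightarrow> 'w measure" and W :: "real \<Rightarrow> 'w \<Rightarrow> real"
  assumes BM: "brownian_motion M \<F> W"

sublocale brownian_filtration \<subseteq> prob_space M
  using BM by (simp add: brownian_motion_def)

context brownian_filtration
begin

lemma sets_filtration_le: "sets (\<F> s) \<subseteq> sets M"
  using BM by (auto simp: brownian_motion_def subalgebra_def)

lemma space_filtration: "space (\<F> s) = space M"
  using BM by (auto simp: brownian_motion_def subalgebra_def)

lemma filtration_mono: "s \<le> t \<Longrightarrow> sets (\<F> s) \<subseteq> sets (\<F> t)"
  using BM by (auto simp: brownian_motion_def filtration_def)

lemma measurable_filtration_mono:
  assumes "f \<in> measurable (\<F> s) L" "s \<le> t" shows "f \<in> measurable (\<F> t) L"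
  using measurable_mono[of L L "\<F> s" "\<F> t"] assms filtration_mono space_filtration by auto

lemma measurable_filtration:
  assumes "f \<in> measurable (\<F> s) L" shows "f \<in> measurable M L"
  using measurable_mono[of L L "\<F> s" M] assms sets_filtration_le space_filtration by auto

lemma W_adapted: "0 \<le> s \<Longrightarrow> s \<le> t \<Longrightarrow> W s \<in> borel_measurable (\<F> t)"
  using BM measurable_filtration_mono[of "W s" s borel t] by (simp add: brownian_motion_def)

lemma W_measurable: "0 \<le> s \<Longrightarrow> W s \<in> borel_measurable M"
  using W_adapted[of s s] measurable_filtration by blast

lemma increment_distributed:
  assumes "0 \<le> s" "s < t"
  shows "distributed M lborel (\<lambda>\<omega>. W t \<omega> - W s \<omega>) (normal_density 0 (sqrt (t - s)))"
  using BM assms by (auto simp: brownian_motion_def)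

lemma increment_moments:
  assumes "0 \<le> s" "s \<le> t"
  shows "integrable M (\<lambda>\<omega>. W t \<omega> - W s \<omega>)" "(\<integral>\<omega>. W t \<omega> - W s \<omega> \<partial>M) = 0"
    "integrable M (\<lambda>\<omega>. (W t \<omega> - W s \<omega>)\<^sup>2)" "(\<integral>\<omega>. (W t \<omega> - W s \<omega>)\<^sup>2 \<partial>M) = t - s"
proof -
  have "integrable M (\<lambda>\<omega>. W t \<omega> - W s \<omega>) \<and> (\<integral>\<omega>. W t \<omega> - W s \<omega> \<partial>M) = 0 \<and>
    integrable M (\<lambda>\<omega>. (W t \<omega> - W s \<omega>)\<^sup>2) \<and> (\<integral>\<omega>. (W t \<omega> - W s \<omega>)\<^sup>2 \<partial>M) = t - s"
  proof (cases "s = t")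
    case False
    then have st: "s < t" and pos: "0 < sqrt (t - s)" using assms by auto
    note D = increment_distributed[OF assms(1) st]
    have i1: "integrable M (\<lambda>\<omega>. W t \<omega> - W s \<omega>)"
      using distributed_integrable[OF D, of "\<lambda>x. x"] integrable_normal_moment_nz_1[OF pos, of 0] by simp
    have i2: "integrable M (\<lambda>\<omega>. (W t \<omega> - W s \<omega>)\<^sup>2)"
      using distributed_integrable[OF D, of "\<lambda>x. x\<^sup>2"] integrable_normal_moment[OF pos, of 0 2] by simp
    have m: "(\<integral>\<omega>. W t \<omega> - W s \<omega> \<partial>M) = 0"
      using normal_distributed_expectation[OF pos D] by simp
    have "variance (\<lambda>\<omega>. W t \<omega> - W s \<omega>) = (sqrt (t - s))\<^sup>2"
      by (rule normal_distributed_variance[OF pos D])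
    then show ?thesis using i1 i2 m st by simp
  qed simp
  then show "integrable M (\<lambda>\<omega>. W t \<omega> - W s \<omega>)" "(\<integral>\<omega>. W t \<omega> - W s \<omega> \<partial>M) = 0"
    "integrable M (\<lambda>\<omega>. (W t \<omega> - W s \<omega>)\<^sup>2)" "(\<integral>\<omega>. (W t \<omega> - W s \<omega>)\<^sup>2 \<partial>M) = t - s"
    by auto
qed

text \<open>The case \<open>s = t\<close> is included, so that partitions may have empty intervals; there the increment is
  the constant \<open>0\<close>, which is independent of everything.\<close>

lemma increment_independent:
  assumes st: "0 \<le> s" "s \<le> t" and Z: "Z \<in> borel_measurable (\<F> s)"
  shows "indep_var borel Z borel (\<lambda>\<omega>. W t \<omega> - W s \<omega>)"
proof (cases "s = t")
  case True
  let ?A = "{Z -` A \<inter> space M |A. A \<in> sets borel}" and ?N = "{(\<lambda>_. 0::real) -` A \<inter> space M |A. A \<in> sets borel}"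
  have "indep_var borel Z borel (\<lambda>_. 0::real)"
    unfolding indep_var_eq
  proof (intro conjI)
    show "random_variable borel Z" using Z by (rule measurable_filtration)
    show "indep_set (sigma_sets (space M) ?A)
        (sigma_sets (space M) ?N)"
    proof (rule indep_setI)
      have "?A \<subseteq> events"
        using measurable_filtration[OF Z] by (auto dest: measurable_sets)
      then show "sigma_sets (space M) ?A \<subseteq> events"
        by (rule sets.sigma_sets_subset)
      have sub: "sigma_sets (space M) ?N \<subseteq> {{}, space M}"
      proof (rule sigma_algebra.sigma_sets_subset[OF sigma_algebra_trivial])
        have "(\<lambda>_. 0::real) -` A \<inter> space M \<in> {{}, space M}" for A
          by (cases "0 \<in> A") auto
        then show "?N \<subseteq> {{}, space M}"
          by blast
      qed
      then show "sigma_sets (space M) ?N \<subseteq> events"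
        by (rule order_trans) simp
      fix a b
      assume a: "a \<in> sigma_sets (space M) ?A"
        and b: "b \<in> sigma_sets (space M) ?N"
      have "a \<inter> space M = a"
        using \<open>sigma_sets (space M) ?A \<subseteq> events\<close> a
        by (meson sets.Int_space_eq2 subsetD)
      then show "prob (a \<inter> b) = prob a * prob b"
        using sub b prob_space by auto
    qed
  qed simp
  then show ?thesis using True by simp
next
  case False
  then have "s < t" using st by simp
  let ?A = "{Z -` A \<inter> space M |A. A \<in> sets borel}"
  let ?X = "\<lambda>\<omega>. W t \<omega> - W s \<omega>"
  let ?B = "{?X -` S \<inter> space M | S. S \<in> sets borel}"
  have ind: "indep_set (sets (\<F> s)) ?B"
    using BM st \<open>s < t\<close> by (auto simp: brownian_motion_def)
  have X: "?X \<in> borel_measurable M"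
    using W_measurable st by (intro borel_measurable_diff) auto
  have sB: "sigma_sets (space M) ?B = ?B"
    using sets_vimage_algebra[of "space M" ?X borel] sets_vimage_algebra2[of ?X "space M" borel] by simp
  have sA: "sigma_sets (space M) ?A \<subseteq> sets (\<F> s)"
    unfolding space_filtration[of s, symmetric]
    by (rule sets.sigma_sets_subset) (use Z in \<open>auto dest: measurable_sets\<close>)
  show ?thesis unfolding indep_var_eq
  proof (intro conjI)
    show "indep_set (sigma_sets (space M) ?A) (sigma_sets (space M) ?B)"
      unfolding sB
    proof (rule indep_setI)
      show "sigma_sets (space M) ?A \<subseteq> events"
        using sA sets_filtration_le by blast
      show "?B \<subseteq> events" using X by (auto dest: measurable_sets)
      fix a b assume "a \<in> sigma_sets (space M) ?A" "b \<in> ?B"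
      then show "prob (a \<inter> b) = prob a * prob b"
        using indep_setD[OF ind] sA by blast
    qed
  qed (use measurable_filtration[OF Z] X in auto)
qed

text \<open>The first two moments of an increment factor out of an expectation with anything known at its start.
  All stochastic computations below reduce to this lemma.\<close>

lemma expectation_mult_increment:
  assumes st: "0 \<le> s" "s \<le> t" and Z: "Z \<in> borel_measurable (\<F> s)" "integrable M Z"
  shows "integrable M (\<lambda>\<omega>. (W t \<omega> - W s \<omega>) * Z \<omega>)" "(\<integral>\<omega>. (W t \<omega> - W s \<omega>) * Z \<omega> \<partial>M) = 0"
    "integrable M (\<lambda>\<omega>. (W t \<omega> - W s \<omega>)\<^sup>2 * Z \<omega>)"
    "(\<integral>\<omega>. (W t \<omega> - W s \<omega>)\<^sup>2 * Z \<omega> \<partial>M) = (t - s) * (\<integral>\<omega>. Z \<omega> \<partial>M)"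
proof -
  note ind = increment_independent[OF st Z(1)]
  note mom = increment_moments[OF st]
  show "integrable M (\<lambda>\<omega>. (W t \<omega> - W s \<omega>) * Z \<omega>)" "(\<integral>\<omega>. (W t \<omega> - W s \<omega>) * Z \<omega> \<partial>M) = 0"
    using indep_var_integrable[OF ind Z(2) mom(1)] indep_var_lebesgue_integral[OF ind Z(2) mom(1)] mom(2)
    by (simp_all add: mult.commute)
  have ind2: "indep_var borel ((\<lambda>x. x) \<circ> Z) borel ((\<lambda>x. x\<^sup>2) \<circ> (\<lambda>\<omega>. W t \<omega> - W s \<omega>))"
    by (rule indep_var_compose[OF ind]) auto
  then have ind2: "indep_var borel Z borel (\<lambda>\<omega>. (W t \<omega> - W s \<omega>)\<^sup>2)" by (simp add: comp_def)
  show "integrable M (\<lambda>\<omega>. (W t \<omega> - W s \<omega>)\<^sup>2 * Z \<omega>)"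
    "(\<integral>\<omega>. (W t \<omega> - W s \<omega>)\<^sup>2 * Z \<omega> \<partial>M) = (t - s) * (\<integral>\<omega>. Z \<omega> \<partial>M)"
    using indep_var_integrable[OF ind2 Z(2) mom(3)] indep_var_lebesgue_integral[OF ind2 Z(2) mom(3)] mom(4)
    by (simp_all add: mult.commute)
qed

lemma increment_scaleR_sq_integrable:
  fixes \<xi> :: "'w \<Rightarrow> real^'n"
  assumes st: "0 \<le> s" "s \<le> t" and \<xi>: "\<xi> \<in> borel_measurable (\<F> s)" "sq_integrable M \<xi>"
  shows "sq_integrable M (\<lambda>\<omega>. (W t \<omega> - W s \<omega>) *\<^sub>R \<xi> \<omega>)"
  unfolding sq_integrable_def
proof
  show "(\<lambda>\<omega>. (W t \<omega> - W s \<omega>) *\<^sub>R \<xi> \<omega>) \<in> borel_measurable M"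
    using W_measurable[of s] W_measurable[of t] st \<xi>(2)
    by (intro borel_measurable_scaleR borel_measurable_diff) (auto simp: sq_integrable_def)
  show "integrable M (\<lambda>\<omega>. (norm ((W t \<omega> - W s \<omega>) *\<^sub>R \<xi> \<omega>))\<^sup>2)"
    using expectation_mult_increment(3)[OF st, of "\<lambda>\<omega>. (norm (\<xi> \<omega>))\<^sup>2"] \<xi>
    by (simp add: power_mult_distrib sq_integrable_def)
qed

text \<open>Only the common part of the two intervals contributes: increments over disjoint intervals are orthogonal
  even after multiplication by coefficients, because the later increment is independent of all the rest.\<close>

lemma one_step_isometry_ordered:
  fixes \<xi> \<eta> :: "'w \<Rightarrow> real^'n"
  assumes ab: "0 \<le> a" "a \<le> b" and cd: "c \<le> d" and ac: "a \<le> c"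
    and \<xi>: "\<xi> \<in> borel_measurable (\<F> a)" "sq_integrable M \<xi>"
    and \<eta>: "\<eta> \<in> borel_measurable (\<F> c)" "sq_integrable M \<eta>"
  shows "(\<integral>\<omega>. ((W b \<omega> - W a \<omega>) *\<^sub>R \<xi> \<omega>) \<bullet> ((W d \<omega> - W c \<omega>) *\<^sub>R \<eta> \<omega>) \<partial>M)
    = max 0 (min b d - max a c) * (\<integral>\<omega>. \<xi> \<omega> \<bullet> \<eta> \<omega> \<partial>M)"
proof -
  have c0: "0 \<le> c" using ab ac by simp
  \<comment> \<open>An increment over an earlier interval, together with its coefficient, is orthogonal to a later one.\<close>
  have orth: "(\<integral>\<omega>. ((W b' \<omega> - W a' \<omega>) *\<^sub>R u \<omega>) \<bullet> ((W d' \<omega> - W c' \<omega>) *\<^sub>R v \<omega>) \<partial>M) = 0"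
    if "0 \<le> a'" "a' \<le> b'" "b' \<le> c'" "c' \<le> d'" "u \<in> borel_measurable (\<F> a')" "sq_integrable M u"
      "v \<in> borel_measurable (\<F> c')" "sq_integrable M v" for a' b' c' d' and u v :: "'w \<Rightarrow> real^'n"
  proof -
    let ?Z = "\<lambda>\<omega>. ((W b' \<omega> - W a' \<omega>) *\<^sub>R u \<omega>) \<bullet> v \<omega>"
    have "integrable M ?Z"
      using that by (intro integrable_inner_sq_integrable increment_scaleR_sq_integrable) auto
    moreover have "?Z \<in> borel_measurable (\<F> c')"
    proof -
      have "u \<in> borel_measurable (\<F> c')" by (rule measurable_filtration_mono[of _ a']) (use that in auto)
      moreover have "W b' \<in> borel_measurable (\<F> c')" "W a' \<in> borel_measurable (\<F> c')"
        using that by (auto intro!: W_adapted)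
      ultimately show ?thesis using that(7)
        by (intro borel_measurable_inner borel_measurable_scaleR borel_measurable_diff) auto
    qed
    ultimately have "(\<integral>\<omega>. (W d' \<omega> - W c' \<omega>) * ?Z \<omega> \<partial>M) = 0"
      using that by (intro expectation_mult_increment(2)) auto
    then show ?thesis by (simp add: mult_ac)
  qed
  show ?thesis
  proof (cases "b \<le> c")
    case True
    then have "max 0 (min b d - max a c) = 0" by auto
    then show ?thesis using orth[of a b c d \<xi> \<eta>] True assms by simp
  next
    case False
    define e where "e = min b d"
    have e: "c \<le> e" "e \<le> b" "e \<le> d" using False cd by (auto simp: e_def)
    have \<xi>c: "\<xi> \<in> borel_measurable (\<F> c)"
      using \<xi>(1) ac by (rule measurable_filtration_mono)
    have \<xi>e: "\<xi> \<in> borel_measurable (\<F> e)" and \<eta>e: "\<eta> \<in> borel_measurable (\<F> e)"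
      using measurable_filtration_mono[OF \<xi>c e(1)] measurable_filtration_mono[OF \<eta>(1) e(1)] by auto
    let ?D = "\<lambda>s t (u :: 'w \<Rightarrow> real^'n) \<omega>. (W t \<omega> - W s \<omega>) *\<^sub>R u \<omega>"
    have sq: "sq_integrable M (?D a c \<xi>)" "sq_integrable M (?D c e \<xi>)" "sq_integrable M (?D e b \<xi>)"
      "sq_integrable M (?D c d \<eta>)" "sq_integrable M (?D c e \<eta>)" "sq_integrable M (?D e d \<eta>)"
      using assms e c0 \<xi>c \<xi>e \<eta>e by (auto intro!: increment_scaleR_sq_integrable)
    \<comment> \<open>Split both increments at the common part \<open>(c, e]\<close>; since \<open>e = min b d\<close>, one of the two remainders is empty.\<close>
    have split: "?D a b \<xi> \<omega> \<bullet> ?D c d \<eta> \<omega> = ?D a c \<xi> \<omega> \<bullet> ?D c d \<eta> \<omega> + ?D c e \<xi> \<omega> \<bullet> ?D c e \<eta> \<omega>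
        + ?D c e \<xi> \<omega> \<bullet> ?D e d \<eta> \<omega> + ?D c e \<eta> \<omega> \<bullet> ?D e b \<xi> \<omega>" for \<omega>
    proof -
      have "?D a b \<xi> \<omega> = ?D a c \<xi> \<omega> + ?D c e \<xi> \<omega> + ?D e b \<xi> \<omega>"
        by (simp add: scaleR_left_diff_distrib)
      moreover have "?D c d \<eta> \<omega> = ?D c e \<eta> \<omega> + ?D e d \<eta> \<omega>"
        by (simp add: scaleR_left_diff_distrib)
      moreover have "?D e b \<xi> \<omega> = 0 \<or> ?D e d \<eta> \<omega> = 0"
        by (auto simp: e_def min_def)
      ultimately show ?thesis
        by (auto simp: inner_add_left inner_add_right inner_commute)
    qed
    have "(\<integral>\<omega>. ?D a b \<xi> \<omega> \<bullet> ?D c d \<eta> \<omega> \<partial>M) =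
       (\<integral>\<omega>. ?D a c \<xi> \<omega> \<bullet> ?D c d \<eta> \<omega> \<partial>M) + (\<integral>\<omega>. ?D c e \<xi> \<omega> \<bullet> ?D c e \<eta> \<omega> \<partial>M)
        + (\<integral>\<omega>. ?D c e \<xi> \<omega> \<bullet> ?D e d \<eta> \<omega> \<partial>M) + (\<integral>\<omega>. ?D c e \<eta> \<omega> \<bullet> ?D e b \<xi> \<omega> \<partial>M)"
      unfolding split
      by (simp add: integrable_inner_sq_integrable[OF sq(1) sq(4)] integrable_inner_sq_integrable[OF sq(2) sq(5)]
         integrable_inner_sq_integrable[OF sq(2) sq(6)] integrable_inner_sq_integrable[OF sq(5) sq(3)]
         del: inner_scaleR_left inner_scaleR_right)
    also have "(\<integral>\<omega>. ?D a c \<xi> \<omega> \<bullet> ?D c d \<eta> \<omega> \<partial>M) = 0"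
      using assms by (intro orth) auto
    also have "(\<integral>\<omega>. ?D c e \<xi> \<omega> \<bullet> ?D e d \<eta> \<omega> \<partial>M) = 0"
      using assms e c0 \<xi>c \<eta>e by (intro orth) auto
    also have "(\<integral>\<omega>. ?D c e \<eta> \<omega> \<bullet> ?D e b \<xi> \<omega> \<partial>M) = 0"
      using assms e c0 \<xi>e by (intro orth) auto
    also have "(\<integral>\<omega>. ?D c e \<xi> \<omega> \<bullet> ?D c e \<eta> \<omega> \<partial>M) = (\<integral>\<omega>. (W e \<omega> - W c \<omega>)\<^sup>2 * (\<xi> \<omega> \<bullet> \<eta> \<omega>) \<partial>M)"
      by (simp add: power2_eq_square mult_ac)
    also have "\<dots> = (e - c) * (\<integral>\<omega>. \<xi> \<omega> \<bullet> \<eta> \<omega> \<partial>M)"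
      using c0 e \<xi>c \<eta>(1) integrable_inner_sq_integrable[OF \<xi>(2) \<eta>(2)]
      by (intro expectation_mult_increment(4)) auto
    finally show ?thesis using e ac by (simp add: e_def max_def)
  qed
qed

text \<open>Both sides are symmetric in the two steps, so the case \<open>c < a\<close> follows by exchanging them.\<close>

lemma one_step_isometry:
  fixes \<xi> \<eta> :: "'w \<Rightarrow> real^'n"
  assumes ab: "0 \<le> a" "a \<le> b" and cd: "0 \<le> c" "c \<le> d"
    and \<xi>: "\<xi> \<in> borel_measurable (\<F> a)" "sq_integrable M \<xi>"
    and \<eta>: "\<eta> \<in> borel_measurable (\<F> c)" "sq_integrable M \<eta>"
  shows "(\<integral>\<omega>. ((W b \<omega> - W a \<omega>) *\<^sub>R \<xi> \<omega>) \<bullet> ((W d \<omega> - W c \<omega>) *\<^sub>R \<eta> \<omega>) \<partial>M)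
    = max 0 (min b d - max a c) * (\<integral>\<omega>. \<xi> \<omega> \<bullet> \<eta> \<omega> \<partial>M)"
proof (cases "a \<le> c")
  case True
  then show ?thesis using one_step_isometry_ordered[OF ab cd(2) True \<xi> \<eta>] by simp
next
  case False
  then show ?thesis using one_step_isometry_ordered[OF cd ab(2) _ \<eta> \<xi>]
    by (simp add: inner_commute min.commute max.commute mult_ac)
qed

end

section \<open>The Ito integral as a mean square limit\<close>

definition time_measure :: "real \<Rightarrow> real measure" where
  "time_measure T = restrict_space lborel {0..T}"

lemma space_time_measure [simp]: "space (time_measure T) = {0..T}"
  by (simp add: time_measure_def space_restrict_space)

lemma sets_time_measure: "sets (time_measure T) = sets (restrict_space borel {0..T})"
  unfolding time_measure_def by (rule sets_restrict_space_cong) simp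

lemma finite_measure_time_measure: "finite_measure (time_measure T)"
  by (rule finite_measureI) (simp add: time_measure_def space_restrict_space emeasure_restrict_space
      emeasure_lborel_Icc_eq)

lemma measurable_time_measure: "f \<in> borel_measurable borel \<Longrightarrow> f \<in> borel_measurable (time_measure T)"
  by (simp add: time_measure_def measurable_restrict_space1)

lemma Ioc_sets_time_measure: "0 \<le> a \<Longrightarrow> b \<le> T \<Longrightarrow> {a<..b} \<in> sets (time_measure T)"
  by (auto simp: time_measure_def sets_restrict_space_iff)

lemma measure_time_measure_Ioc:
  assumes "0 \<le> a" "b \<le> T" shows "measure (time_measure T) {a<..b} = max 0 (b - a)"
proof -
  have "measure (time_measure T) {a<..b} = measure lborel {a<..b}"
    unfolding time_measure_def by (rule measure_restrict_space) (use assms in auto)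
  also have "\<dots> = max 0 (b - a)"
    by (cases "a \<le> b") auto
  finally show ?thesis .
qed

context brownian_filtration
begin

abbreviation time_space :: "real \<Rightarrow> (real \<times> 'w) measure" where
  "time_space T \<equiv> time_measure T \<Otimes>\<^sub>M M"

lemma pair_sigma_finite_time_space: "pair_sigma_finite (time_measure T) M"
  unfolding pair_sigma_finite_def
  by (simp add: finite_measure.sigma_finite_measure finite_measure_time_measure sigma_finite_measure_axioms)

lemma space_time_space: "z \<in> space (time_space T) \<longleftrightarrow> 0 \<le> fst z \<and> fst z \<le> T \<and> snd z \<in> space M"
  by (cases z) (auto simp: space_pair_measure)

text \<open>Tonelli's theorem puts the iterated integrals of the definition of the Ito integral into the form of
  an \<open>L\<^sup>2\<close> norm on one product space, to which the lemmas on square integrable functions apply.\<close>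

lemma nn_integral_time_space:
  assumes "h \<in> borel_measurable (time_space T)"
  shows "(\<integral>\<^sup>+\<omega>. (\<integral>\<^sup>+s\<in>{0..T}. h (s, \<omega>) \<partial>lborel) \<partial>M) = (\<integral>\<^sup>+z. h z \<partial>time_space T)"
proof -
  interpret pair_sigma_finite "time_measure T" M by (rule pair_sigma_finite_time_space)
  have "(\<integral>\<^sup>+s\<in>{0..T}. h (s, \<omega>) \<partial>lborel) = (\<integral>\<^sup>+s. h (s, \<omega>) \<partial>time_measure T)" for \<omega>
    by (simp add: time_measure_def nn_integral_restrict_space)
  then show ?thesis using nn_integral_snd[OF assms] by simp
qed

lemma measurable_time_space_mono:
  assumes "s \<le> T" "h \<in> measurable (time_space T) L"
  shows "h \<in> measurable (time_space s) L"
proof -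
  have "(\<lambda>u. u) \<in> measurable (time_measure s) (time_measure T)"
    unfolding time_measure_def by (rule measurable_restrict_space3) (use assms in auto)
  then have "(\<lambda>z. (fst z, snd z)) \<in> measurable (time_space s) (time_space T)"
    by (intro measurable_Pair) (auto intro: measurable_compose[OF measurable_fst])
  from measurable_compose[OF this assms(2)] show ?thesis by simp
qed

lemma integral_time_space_mono:
  fixes h :: "real \<times> 'w \<Rightarrow> real"
  assumes "s \<le> T" "integrable (time_space T) h" "\<And>z. 0 \<le> h z"
  shows "integrable (time_space s) h" "integral\<^sup>L (time_space s) h \<le> integral\<^sup>L (time_space T) h"
proof -
  have m: "h \<in> borel_measurable (time_space T)" "h \<in> borel_measurable (time_space s)"
    using measurable_time_space_mono[OF assms(1)] borel_measurable_integrable[OF assms(2)] by blast+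
  have "(\<integral>\<^sup>+z. ennreal (h z) \<partial>time_space s) \<le> (\<integral>\<^sup>+z. ennreal (h z) \<partial>time_space T)"
  proof -
    have eq: "(\<integral>\<^sup>+z. ennreal (h z) \<partial>time_space r) =
        (\<integral>\<^sup>+\<omega>. (\<integral>\<^sup>+u\<in>{0..r}. ennreal (h (u, \<omega>)) \<partial>lborel) \<partial>M)" if "r \<in> {s, T}" for r
      using nn_integral_time_space[of "\<lambda>z. ennreal (h z)" r] m that by auto
    have "ennreal (h (u, \<omega>)) * indicator {0..s} u \<le> ennreal (h (u, \<omega>)) * indicator {0..T} u" for u \<omega>
      using assms(1) by (intro mult_left_mono) (auto simp: indicator_def)
    then show ?thesis
      unfolding eq[of s, simplified] eq[of T, simplified] by (intro nn_integral_mono)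
  qed
  also have fin: "\<dots> = ennreal (integral\<^sup>L (time_space T) h)"
    using assms by (intro nn_integral_eq_integral) auto
  finally have le: "(\<integral>\<^sup>+z. ennreal (h z) \<partial>time_space s) \<le> ennreal (integral\<^sup>L (time_space T) h)" .
  then show i: "integrable (time_space s) h"
    unfolding integrable_iff_bounded using m assms(3) le_less_trans[OF le ennreal_less_top] by simp
  have "ennreal (integral\<^sup>L (time_space s) h) = (\<integral>\<^sup>+z. ennreal (h z) \<partial>time_space s)"
    using assms i by (intro nn_integral_eq_integral[symmetric]) auto
  also note le
  finally show "integral\<^sup>L (time_space s) h \<le> integral\<^sup>L (time_space T) h"
    using assms(3) by (simp add: integral_nonneg_AE)
qed

lemma l2_dist2_time_space_mono:
  assumes "s \<le> T" "sq_integrable (time_space T) H" "sq_integrable (time_space T) K"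
  shows "l2_dist2 (time_space s) H K \<le> l2_dist2 (time_space T) H K"
  using assms sq_integrable_diff[OF assms(2,3)] unfolding l2_dist2_def
  by (intro integral_time_space_mono(2)) (auto simp: sq_integrable_def)

lemma integrable_snd_time_space:
  fixes g :: "'w \<Rightarrow> real"
  assumes "integrable M g"
  shows "integrable (time_space T) (\<lambda>z. g (snd z))"
proof -
  have m: "(\<lambda>z. g (snd z)) \<in> borel_measurable (time_space T)" using assms by measurable
  have "(\<integral>\<^sup>+z. ennreal (norm (g (snd z))) \<partial>time_space T) =
     (\<integral>\<^sup>+s. (\<integral>\<^sup>+\<omega>. ennreal (norm (g \<omega>)) \<partial>M) \<partial>time_measure T)"
    using m nn_integral_fst[of "\<lambda>z. ennreal (norm (g (snd z)))" "time_measure T"] by simp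
  also have "\<dots> = (\<integral>\<^sup>+\<omega>. ennreal (norm (g \<omega>)) \<partial>M) * emeasure (time_measure T) (space (time_measure T))"
    by simp
  also have "\<dots> < \<infinity>"
    using assms finite_measure.emeasure_finite[OF finite_measure_time_measure, of T "space (time_measure T)"]
    by (auto simp: integrable_iff_bounded ennreal_mult_less_top top.not_eq_extremum)
  finally show ?thesis using m by (simp add: integrable_iff_bounded)
qed

lemma sq_integrable_snd_time_space:
  assumes "sq_integrable M \<xi>" shows "sq_integrable (time_space T) (\<lambda>z. \<xi> (snd z))"
  using assms integrable_snd_time_space[of "\<lambda>\<omega>. (norm (\<xi> \<omega>))\<^sup>2"]
  by (auto simp: sq_integrable_def)

definition step_process :: "real \<Rightarrow> real \<Rightarrow> ('w \<Rightarrow> real^'n) \<Rightarrow> real \<times> 'w \<Rightarrow> real^'n" where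
  "step_process a b \<xi> z = indicator {a<..b} (fst z) *\<^sub>R \<xi> (snd z)"

definition step_integral :: "real \<Rightarrow> real \<Rightarrow> ('w \<Rightarrow> real^'n) \<Rightarrow> 'w \<Rightarrow> real^'n" where
  "step_integral a b \<xi> \<omega> = (W b \<omega> - W a \<omega>) *\<^sub>R \<xi> \<omega>"

text \<open>Pairs of a simple integrand and its integral, built one step at a time. The steps may overlap and come
  in any order, which makes these pairs a vector space in an obvious way, and reduces every bilinear
  identity to the case of two single steps.\<close>

inductive simple_ito :: "real \<Rightarrow> (real \<times> 'w \<Rightarrow> real^'n) \<Rightarrow> ('w \<Rightarrow> real^'n) \<Rightarrow> bool" for T where
  zero: "simple_ito T (\<lambda>z. 0) (\<lambda>\<omega>. 0)"
| step: "simple_ito T G J \<Longrightarrow> 0 \<le> a \<Longrightarrow> a \<le> b \<Longrightarrow> b \<le> T \<Longrightarrow> \<xi> \<in> borel_measurable (\<F> a) \<Longrightarrow>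
    sq_integrable M \<xi> \<Longrightarrow>
    simple_ito T (\<lambda>z. G z + step_process a b \<xi> z) (\<lambda>\<omega>. J \<omega> + step_integral a b \<xi> \<omega>)"

lemma sq_integrable_step_process:
  assumes "0 \<le> a" "b \<le> T" "sq_integrable M \<xi>"
  shows "sq_integrable (time_space T) (step_process a b \<xi>)"
proof (rule sq_integrable_bound)
  note [measurable] = sq_integrable_measurable[OF assms(3)] Ioc_sets_time_measure[OF assms(1,2)]
  show "step_process a b \<xi> \<in> borel_measurable (time_space T)"
    unfolding step_process_def by measurable
  show "integrable (time_space T) (\<lambda>z. (norm (\<xi> (snd z)))\<^sup>2)"
    using sq_integrable_snd_time_space[OF assms(3)] by (simp add: sq_integrable_def)
  show "(norm (step_process a b \<xi> z))\<^sup>2 \<le> (norm (\<xi> (snd z)))\<^sup>2" for z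
    by (simp add: step_process_def indicator_def)
qed

lemma sq_integrable_step_integral:
  assumes "0 \<le> a" "a \<le> b" "\<xi> \<in> borel_measurable (\<F> a)" "sq_integrable M \<xi>"
  shows "sq_integrable M (step_integral a b \<xi>)"
  unfolding step_integral_def using assms by (rule increment_scaleR_sq_integrable)

lemma simple_ito_sq_integrable:
  assumes "simple_ito T G J"
  shows "sq_integrable (time_space T) G" "sq_integrable M J"
  using assms
  by (induction) (auto intro!: sq_integrable_zero sq_integrable_add sq_integrable_step_process
      sq_integrable_step_integral)

lemma step_isometry:
  assumes ab: "0 \<le> a" "a \<le> b" "b \<le> T" and cd: "0 \<le> c" "c \<le> d" "d \<le> T"
    and \<xi>: "\<xi> \<in> borel_measurable (\<F> a)" "sq_integrable M \<xi>"
    and \<eta>: "\<eta> \<in> borel_measurable (\<F> c)" "sq_integrable M \<eta>"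
  shows "(\<integral>\<omega>. step_integral a b \<xi> \<omega> \<bullet> step_integral c d \<eta> \<omega> \<partial>M)
    = (\<integral>z. step_process a b \<xi> z \<bullet> step_process c d \<eta> z \<partial>time_space T)"
proof -
  interpret pair_sigma_finite "time_measure T" M by (rule pair_sigma_finite_time_space)
  have "integrable (time_space T) (\<lambda>z. step_process a b \<xi> z \<bullet> step_process c d \<eta> z)"
    using assms by (intro integrable_inner_sq_integrable sq_integrable_step_process)
  then have "(\<integral>z. step_process a b \<xi> z \<bullet> step_process c d \<eta> z \<partial>time_space T) =
    (\<integral>s. (\<integral>\<omega>. step_process a b \<xi> (s, \<omega>) \<bullet> step_process c d \<eta> (s, \<omega>) \<partial>M) \<partial>time_measure T)"
    by (rule integral_fst'[symmetric])
  also have "\<dots> = (\<integral>s. indicator {max a c<..min b d} s * (\<integral>\<omega>. \<xi> \<omega> \<bullet> \<eta> \<omega> \<partial>M) \<partial>time_measure T)"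
    by (intro Bochner_Integration.integral_cong) (auto simp: step_process_def indicator_def)
  also have "\<dots> = measure (time_measure T) {max a c<..min b d} * (\<integral>\<omega>. \<xi> \<omega> \<bullet> \<eta> \<omega> \<partial>M)"
    using ab cd by (simp add: Int_absorb2 subset_eq)
  also have "\<dots> = max 0 (min b d - max a c) * (\<integral>\<omega>. \<xi> \<omega> \<bullet> \<eta> \<omega> \<partial>M)"
    using ab cd by (subst measure_time_measure_Ioc) auto
  also have "\<dots> = (\<integral>\<omega>. step_integral a b \<xi> \<omega> \<bullet> step_integral c d \<eta> \<omega> \<partial>M)"
    unfolding step_integral_def using assms by (intro one_step_isometry[symmetric])
  finally show ?thesis by simp
qed

text \<open>Both sides are linear in the simple integrand.\<close>

lemma simple_ito_step_isometry:
  assumes "simple_ito T G J" and cd: "0 \<le> c" "c \<le> d" "d \<le> T"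
    and \<eta>: "\<eta> \<in> borel_measurable (\<F> c)" "sq_integrable M \<eta>"
  shows "(\<integral>\<omega>. J \<omega> \<bullet> step_integral c d \<eta> \<omega> \<partial>M) = (\<integral>z. G z \<bullet> step_process c d \<eta> z \<partial>time_space T)"
  using assms(1)
proof induction
  case (step G J a b \<xi>)
  note sq = simple_ito_sq_integrable[OF step(1)] sq_integrable_step_process[OF step(2,4,6)]
    sq_integrable_step_integral[OF step(2,3,5,6)]
    sq_integrable_step_process[OF cd(1,3) \<eta>(2)] sq_integrable_step_integral[OF cd(1,2) \<eta>]
  show ?case
    using step.IH step_isometry[OF step(2-4) cd step(5,6) \<eta>] sq
    by (simp add: inner_add_left integrable_inner_sq_integrable)
qed simp

lemma simple_ito_isometry:
  assumes "simple_ito T G J" "simple_ito T G' J'"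
  shows "(\<integral>\<omega>. J \<omega> \<bullet> J' \<omega> \<partial>M) = (\<integral>z. G z \<bullet> G' z \<partial>time_space T)"
  using assms(2)
proof induction
  case (step G' J' a b \<xi>)
  note sq = simple_ito_sq_integrable[OF step(1)] sq_integrable_step_process[OF step(2,4,6)]
    sq_integrable_step_integral[OF step(2,3,5,6)] simple_ito_sq_integrable[OF assms(1)]
  show ?case
    using step.IH simple_ito_step_isometry[OF assms(1) step(2-6)] sq
    by (simp add: inner_add_right integrable_inner_sq_integrable)
qed simp

lemma simple_ito_diff:
  assumes "simple_ito T G J" "simple_ito T G' J'"
  shows "simple_ito T (\<lambda>z. G z - G' z) (\<lambda>\<omega>. J \<omega> - J' \<omega>)"
  using assms(2)
proof induction
  case zero
  then show ?case using assms(1) by simp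
next
  case (step G' J' a b \<xi>)
  have "simple_ito T (\<lambda>z. (G z - G' z) + step_process a b (\<lambda>\<omega>. - \<xi> \<omega>) z)
     (\<lambda>\<omega>. (J \<omega> - J' \<omega>) + step_integral a b (\<lambda>\<omega>. - \<xi> \<omega>) \<omega>)"
    using step sq_integrable_scaleR[OF step(6), of "-1"]
    by (intro simple_ito.step) auto
  then show ?case by (simp add: step_process_def step_integral_def diff_diff_eq)
qed

lemma simple_ito_matrix:
  assumes "simple_ito T G J"
  shows "simple_ito T (\<lambda>z. U *v G z) (\<lambda>\<omega>. U *v J \<omega>)"
  using assms
proof induction
  case zero
  then show ?case by (simp add: simple_ito.zero)
next
  case (step G J a b \<xi>)
  have U: "(\<lambda>v. U *v v) \<in> borel_measurable borel"
    by (intro borel_measurable_continuous_onI linear_continuous_on matrix_vector_mul_bounded_linear)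
  have "simple_ito T (\<lambda>z. U *v G z + step_process a b (\<lambda>\<omega>. U *v \<xi> \<omega>) z)
     (\<lambda>\<omega>. U *v J \<omega> + step_integral a b (\<lambda>\<omega>. U *v \<xi> \<omega>) \<omega>)"
    using step sq_integrable_matrix[OF step(6)] measurable_compose[OF step(5) U]
    by (intro simple_ito.step) auto
  then show ?case
    by (simp add: step_process_def step_integral_def matrix_vector_right_distrib
        matrix_vector_mult_scaleR)
qed

text \<open>Cut a simple integrand at time \<open>s\<close>: it is unchanged on \<open>[0, s]\<close>, and the removed steps, which lie
  after \<open>s\<close>, are orthogonal to everything known at time \<open>s\<close>.\<close>

lemma simple_ito_restrict:
  fixes J :: "'w \<Rightarrow> real^'n"
  assumes "simple_ito T G J" "0 \<le> s" "s \<le> T"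
  shows "\<exists>G' J'. simple_ito s G' J' \<and> (\<forall>z\<in>space (time_space s). G' z = G z) \<and>
    (\<forall>\<zeta>. \<zeta> \<in> borel_measurable (\<F> s) \<longrightarrow> sq_integrable M \<zeta> \<longrightarrow>
      (\<integral>\<omega>. \<zeta> \<omega> \<bullet> J \<omega> \<partial>M) = (\<integral>\<omega>. \<zeta> \<omega> \<bullet> J' \<omega> \<partial>M))"
  using assms(1)
proof induction
  case zero
  show ?case by (rule exI[of _ "\<lambda>_. 0"], rule exI[of _ "\<lambda>_. 0"]) (simp add: simple_ito.zero)
next
  case (step G J a b \<xi>)
  from step.IH obtain G' J' where IH: "simple_ito s G' J' \<and> (\<forall>z\<in>space (time_space s). G' z = G z) \<and>
    (\<forall>\<zeta>. \<zeta> \<in> borel_measurable (\<F> s) \<longrightarrow> sq_integrable M \<zeta> \<longrightarrow>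
      (\<integral>\<omega>. \<zeta> \<omega> \<bullet> J \<omega> \<partial>M) = (\<integral>\<omega>. \<zeta> \<omega> \<bullet> J' \<omega> \<partial>M))" by (elim exE) (rule that)
  note IH1 = conjunct1[OF IH]
  note IH2 = bspec[OF conjunct1[OF conjunct2[OF IH]]]
  note IH3 = conjunct2[OF conjunct2[OF IH], rule_format]
  \<comment> \<open>The part of the step after time \<open>s\<close> is orthogonal to everything known at time \<open>s\<close>.\<close>
  have tail: "(\<integral>\<omega>. \<zeta> \<omega> \<bullet> step_integral e b \<xi> \<omega> \<partial>M) = 0"
    if z: "\<zeta> \<in> borel_measurable (\<F> s)" "sq_integrable M \<zeta>" and e: "s \<le> e" "e \<le> b"
      and \<xi>e: "\<xi> \<in> borel_measurable (\<F> e)" for \<zeta> e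
  proof -
    have "\<zeta> \<in> borel_measurable (\<F> e)" using z(1) e(1) by (rule measurable_filtration_mono)
    then have "(\<lambda>\<omega>. \<zeta> \<omega> \<bullet> \<xi> \<omega>) \<in> borel_measurable (\<F> e)" using \<xi>e by (rule borel_measurable_inner)
    then have "(\<integral>\<omega>. (W b \<omega> - W e \<omega>) * (\<zeta> \<omega> \<bullet> \<xi> \<omega>) \<partial>M) = 0"
      by (rule expectation_mult_increment(2)[OF order_trans[OF assms(2) e(1)] e(2) _
            integrable_inner_sq_integrable[OF z(2) step(6)]])
    then show ?thesis by (simp add: step_integral_def)
  qed
  note sqJ = simple_ito_sq_integrable(2)[OF step(1)] simple_ito_sq_integrable(2)[OF IH1]
    sq_integrable_step_integral[OF step(2,3,5,6)]
  show ?case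
  proof (cases "s \<le> a")
    case True
    show ?thesis
    proof (intro exI conjI ballI allI impI)
      show "simple_ito s G' J'" by (rule IH1)
      fix z assume "z \<in> space (time_space s)"
      then show "G' z = G z + step_process a b \<xi> z"
        using IH2[of z] True by (simp add: step_process_def space_time_space)
    next
      fix \<zeta> :: "'w \<Rightarrow> real^'n" assume z: "\<zeta> \<in> borel_measurable (\<F> s)" "sq_integrable M \<zeta>"
      show "(\<integral>\<omega>. \<zeta> \<omega> \<bullet> (J \<omega> + step_integral a b \<xi> \<omega>) \<partial>M) = (\<integral>\<omega>. \<zeta> \<omega> \<bullet> J' \<omega> \<partial>M)"
        using IH3[OF z] tail[OF z True step(3,5)] sqJ z(2)
        by (simp add: inner_add_right integrable_inner_sq_integrable)
    qed
  next
    case False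
    define e where "e = min b s"
    have e: "a \<le> e" "e \<le> s" "e \<le> b" using False step(2-4) by (auto simp: e_def)
    have \<xi>e: "\<xi> \<in> borel_measurable (\<F> e)" using step(5) e(1) by (rule measurable_filtration_mono)
    have split: "step_integral a b \<xi> \<omega> = step_integral a e \<xi> \<omega> + step_integral e b \<xi> \<omega>" for \<omega>
      by (simp add: step_integral_def scaleR_left_diff_distrib)
    note sq' = sq_integrable_step_integral[OF step(2) e(1) step(5,6)]
      sq_integrable_step_integral[OF order_trans[OF step(2) e(1)] e(3) \<xi>e step(6)]
    show ?thesis
    proof (intro exI conjI ballI allI impI)
      show "simple_ito s (\<lambda>z. G' z + step_process a e \<xi> z) (\<lambda>\<omega>. J' \<omega> + step_integral a e \<xi> \<omega>)"
        by (rule simple_ito.step[OF IH1 step(2) e(1,2) step(5,6)])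
      fix z assume "z \<in> space (time_space s)"
      then show "G' z + step_process a e \<xi> z = G z + step_process a b \<xi> z"
        using IH2[of z] by (simp add: step_process_def space_time_space e_def indicator_def)
    next
      fix \<zeta> :: "'w \<Rightarrow> real^'n" assume z: "\<zeta> \<in> borel_measurable (\<F> s)" "sq_integrable M \<zeta>"
      have "(\<integral>\<omega>. \<zeta> \<omega> \<bullet> step_integral e b \<xi> \<omega> \<partial>M) = 0"
      proof (cases "b \<le> s")
        case True
        then show ?thesis by (simp add: e_def step_integral_def)
      next
        case False
        then show ?thesis using e by (intro tail[OF z _ e(3) \<xi>e]) (simp add: e_def)
      qed
      then show "(\<integral>\<omega>. \<zeta> \<omega> \<bullet> (J \<omega> + step_integral a b \<xi> \<omega>) \<partial>M) =
          (\<integral>\<omega>. \<zeta> \<omega> \<bullet> (J' \<omega> + step_integral a e \<xi> \<omega>) \<partial>M)"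
        using IH3[OF z] sqJ sq' z(2) unfolding split
        by (simp add: inner_add_right integrable_inner_sq_integrable)
    qed
  qed
qed

lemma elementary_simple_ito:
  assumes "elementary_data M \<F> T k \<tau> \<xi>"
  shows "simple_ito T (\<lambda>z. elementary_process k \<tau> \<xi> (fst z) (snd z)) (elementary_integral W k \<tau> \<xi>)"
proof -
  have mono: "\<tau> i \<le> \<tau> j" if "i \<le> j" "j \<le> k" for i j
    using that(1) that(2)
  proof (induction rule: dec_induct)
    case (step n)
    then show ?case using assms by (auto simp: elementary_data_def intro: order_trans)
  qed simp
  have "simple_ito T (\<lambda>z. elementary_process j \<tau> \<xi> (fst z) (snd z)) (elementary_integral W j \<tau> \<xi>)"
    if "j \<le> k" for j
    using that
  proof (induction j)
    case 0
    have "elementary_integral W 0 \<tau> \<xi> = (\<lambda>\<omega>. 0)" by (simp add: elementary_integral_def fun_eq_iff)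
    then show ?case by (simp add: elementary_process_def simple_ito.zero)
  next
    case (Suc j)
    have "0 \<le> \<tau> j" "\<tau> (Suc j) \<le> T"
      using mono[of 0 j] mono[of "Suc j" k] Suc(2) assms by (auto simp: elementary_data_def)
    moreover have "\<tau> j \<le> \<tau> (Suc j)" "\<xi> j \<in> borel_measurable (\<F> (\<tau> j))" "sq_integrable M (\<xi> j)"
      using assms Suc(2) measurable_filtration[of "\<xi> j" "\<tau> j" borel]
      by (auto simp: elementary_data_def sq_integrable_def)
    ultimately have "simple_ito T
        (\<lambda>z. elementary_process j \<tau> \<xi> (fst z) (snd z) + step_process (\<tau> j) (\<tau> (Suc j)) (\<xi> j) z)
        (\<lambda>\<omega>. elementary_integral W j \<tau> \<xi> \<omega> + step_integral (\<tau> j) (\<tau> (Suc j)) (\<xi> j) \<omega>)"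
      using Suc by (intro simple_ito.step) auto
    moreover have "elementary_integral W (Suc j) \<tau> \<xi> =
        (\<lambda>\<omega>. elementary_integral W j \<tau> \<xi> \<omega> + step_integral (\<tau> j) (\<tau> (Suc j)) (\<xi> j) \<omega>)"
      by (simp add: elementary_integral_def step_integral_def fun_eq_iff)
    ultimately show ?case by (simp add: elementary_process_def step_process_def)
  qed
  then show ?thesis by simp
qed

text \<open>Being an Ito integral, with the approximating integrands and the limits expressed in \<open>L\<^sup>2\<close>.\<close>

definition ito_limit :: "real \<Rightarrow> (real \<times> 'w \<Rightarrow> real^'n) \<Rightarrow> ('w \<Rightarrow> real^'n) \<Rightarrow> bool" where
  "ito_limit T H I \<longleftrightarrow> sq_integrable (time_space T) H \<and> sq_integrable M I \<and>
    (\<exists>G J. (\<forall>r. simple_ito T (G r) (J r)) \<and>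
      (\<lambda>r. l2_dist2 (time_space T) (G r) H) \<longlonglongrightarrow> 0 \<and> (\<lambda>r::nat. l2_dist2 M (J r) I) \<longlonglongrightarrow> 0)"

lemma ito_integrand_sq_integrable:
  assumes "ito_integrand M \<F> T H"
  shows "sq_integrable (time_space T) (\<lambda>z. H (fst z) (snd z))"
proof -
  have "sets (restrict_space borel {0..T} \<Otimes>\<^sub>M M) = sets (time_space T)"
    by (intro sets_pair_measure_cong) (simp_all add: sets_time_measure)
  note eq = measurable_cong_sets[OF this refl, of borel]
  have "(\<lambda>z. H (fst z) (snd z)) \<in> borel_measurable (restrict_space borel {0..T} \<Otimes>\<^sub>M M)"
    using assms by (simp add: ito_integrand_def split_beta')
  then have m: "(\<lambda>z. H (fst z) (snd z)) \<in> borel_measurable (time_space T)"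
    unfolding eq .
  then have "(\<integral>\<^sup>+z. ennreal ((norm (H (fst z) (snd z)))\<^sup>2) \<partial>time_space T) < \<infinity>"
    using assms by (subst nn_integral_time_space[symmetric]) (simp_all add: ito_integrand_def)
  then show ?thesis using m by (simp add: sq_integrable_def integrable_iff_bounded)
qed

lemma has_ito_integral_ito_limit:
  assumes "has_ito_integral M \<F> W T H I"
  shows "ito_limit T (\<lambda>z. H (fst z) (snd z)) I"
proof -
  obtain k \<tau> \<xi> where el: "\<And>r. elementary_data M \<F> T (k r) (\<tau> r) (\<xi> r)"
    and lim1: "(\<lambda>r::nat. \<integral>\<^sup>+\<omega>. (\<integral>\<^sup>+s\<in>{0..T}.
          ennreal ((norm (H s \<omega> - elementary_process (k r) (\<tau> r) (\<xi> r) s \<omega>))\<^sup>2) \<partial>lborel) \<partial>M) \<longlonglongrightarrow> 0"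
    and lim2: "(\<lambda>r::nat. \<integral>\<^sup>+\<omega>. ennreal ((norm (I \<omega> - elementary_integral W (k r) (\<tau> r) (\<xi> r) \<omega>))\<^sup>2) \<partial>M)
        \<longlonglongrightarrow> 0"
    using assms unfolding has_ito_integral_def by blast
  have H: "sq_integrable (time_space T) (\<lambda>z. H (fst z) (snd z))" and I: "I \<in> borel_measurable M"
    using assms ito_integrand_sq_integrable by (auto simp: has_ito_integral_def)
  note simple = elementary_simple_ito[OF el]
  note sq = simple_ito_sq_integrable[OF simple]
  have "(\<lambda>r::nat. \<integral>\<^sup>+z. ennreal ((norm (H (fst z) (snd z) - elementary_process (k r) (\<tau> r) (\<xi> r) (fst z) (snd z)))\<^sup>2)
      \<partial>time_space T) \<longlonglongrightarrow> 0"
    using lim1 sq_integrable_measurable[OF sq_integrable_diff[OF H sq(1)]]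
    by (subst nn_integral_time_space[symmetric]) simp_all
  note lim1' = l2_limit_from_nn_integral(2)[OF sq_integrable_measurable[OF H] sq(1) this]
  note lim2' = l2_limit_from_nn_integral[OF I sq(2) lim2]
  show ?thesis unfolding ito_limit_def
    by (intro conjI exI allI, rule H, rule lim2'(1), rule simple, rule lim1', rule lim2'(2))
qed

lemma ito_isometry:
  assumes "ito_limit T H I" "ito_limit T H' I'"
  shows "(\<integral>\<omega>. I \<omega> \<bullet> I' \<omega> \<partial>M) = (\<integral>z. H z \<bullet> H' z \<partial>time_space T)"
proof -
  obtain G J where GJ: "\<And>r. simple_ito T (G r) (J r)"
    "(\<lambda>r. l2_dist2 (time_space T) (G r) H) \<longlonglongrightarrow> 0" "(\<lambda>r::nat. l2_dist2 M (J r) I) \<longlonglongrightarrow> 0"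
    using assms(1) unfolding ito_limit_def by blast
  obtain G' J' where GJ': "\<And>r. simple_ito T (G' r) (J' r)"
    "(\<lambda>r. l2_dist2 (time_space T) (G' r) H') \<longlonglongrightarrow> 0" "(\<lambda>r::nat. l2_dist2 M (J' r) I') \<longlonglongrightarrow> 0"
    using assms(2) unfolding ito_limit_def by blast
  have sq: "sq_integrable (time_space T) H" "sq_integrable M I"
    "sq_integrable (time_space T) H'" "sq_integrable M I'" using assms by (auto simp: ito_limit_def)
  note sqG = simple_ito_sq_integrable[OF GJ(1)] simple_ito_sq_integrable[OF GJ'(1)]
  have "(\<lambda>r. \<integral>\<omega>. J r \<omega> \<bullet> J' r \<omega> \<partial>M) \<longlonglongrightarrow> (\<integral>\<omega>. I \<omega> \<bullet> I' \<omega> \<partial>M)"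
    by (rule tendsto_inner_l2[OF sq(2,4) sqG(2,4) GJ(3) GJ'(3)])
  moreover have "(\<lambda>r. \<integral>z. G r z \<bullet> G' r z \<partial>time_space T) \<longlonglongrightarrow> (\<integral>z. H z \<bullet> H' z \<partial>time_space T)"
    by (rule tendsto_inner_l2[OF sq(1,3) sqG(1,3) GJ(2) GJ'(2)])
  ultimately show ?thesis
    using LIMSEQ_unique unfolding simple_ito_isometry[OF GJ(1) GJ'(1)] by blast
qed

lemma ito_limit_matrix:
  assumes "ito_limit T H I"
  shows "ito_limit T (\<lambda>z. U *v H z) (\<lambda>\<omega>. U *v I \<omega>)"
proof -
  obtain G J where GJ: "\<And>r. simple_ito T (G r) (J r)"
    "(\<lambda>r. l2_dist2 (time_space T) (G r) H) \<longlonglongrightarrow> 0" "(\<lambda>r::nat. l2_dist2 M (J r) I) \<longlonglongrightarrow> 0"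
    using assms(1) unfolding ito_limit_def by blast
  have sq: "sq_integrable (time_space T) H" "sq_integrable M I" using assms by (auto simp: ito_limit_def)
  note sqG = simple_ito_sq_integrable[OF GJ(1)]
  note lim = tendsto_l2_bounded_linear[OF matrix_vector_mul_bounded_linear[of U] sq(1) sqG(1) GJ(2)]
    tendsto_l2_bounded_linear[OF matrix_vector_mul_bounded_linear[of U] sq(2) sqG(2) GJ(3)]
  show ?thesis unfolding ito_limit_def
    using simple_ito_matrix[OF GJ(1), of U] lim sq_integrable_matrix[OF sq(1), of U]
      sq_integrable_matrix[OF sq(2), of U] by (intro conjI exI allI) auto
qed

text \<open>The integral over \<open>[0, T]\<close>, tested against information at time \<open>s\<close>, is the integral over \<open>[0, s]\<close>. The two
  integrals come with unrelated approximations; the isometry shows that both approximations, cut at \<open>s\<close>,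
  have the same limit.\<close>

lemma ito_martingale:
  assumes IT: "ito_limit T H I" and Is: "ito_limit s H I'" and s: "0 \<le> s" "s \<le> T"
    and \<zeta>: "\<zeta> \<in> borel_measurable (\<F> s)" "sq_integrable M \<zeta>"
  shows "(\<integral>\<omega>. \<zeta> \<omega> \<bullet> I \<omega> \<partial>M) = (\<integral>\<omega>. \<zeta> \<omega> \<bullet> I' \<omega> \<partial>M)"
proof -
  obtain G J where GJ: "\<And>r. simple_ito T (G r) (J r)"
    "(\<lambda>r. l2_dist2 (time_space T) (G r) H) \<longlonglongrightarrow> 0" "(\<lambda>r::nat. l2_dist2 M (J r) I) \<longlonglongrightarrow> 0"
    using IT unfolding ito_limit_def by blast
  obtain G' J' where GJ': "\<And>r. simple_ito s (G' r) (J' r)"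
    "(\<lambda>r. l2_dist2 (time_space s) (G' r) H) \<longlonglongrightarrow> 0" "(\<lambda>r::nat. l2_dist2 M (J' r) I') \<longlonglongrightarrow> 0"
    using Is unfolding ito_limit_def by blast
  have sq: "sq_integrable (time_space T) H" "sq_integrable M I" "sq_integrable (time_space s) H"
    "sq_integrable M I'" using IT Is by (auto simp: ito_limit_def)
  have "\<forall>r. \<exists>G'' J''. simple_ito s G'' J'' \<and> (\<forall>z\<in>space (time_space s). G'' z = G r z) \<and>
    (\<forall>\<zeta>. \<zeta> \<in> borel_measurable (\<F> s) \<longrightarrow> sq_integrable M \<zeta> \<longrightarrow>
      (\<integral>\<omega>. \<zeta> \<omega> \<bullet> J r \<omega> \<partial>M) = (\<integral>\<omega>. \<zeta> \<omega> \<bullet> J'' \<omega> \<partial>M))"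
    using simple_ito_restrict[OF GJ(1) s] by blast
  then obtain G'' J'' where R: "\<And>r. simple_ito s (G'' r) (J'' r)"
    "\<And>r z. z\<in>space (time_space s) \<Longrightarrow> G'' r z = G r z"
    "\<And>r. (\<integral>\<omega>. \<zeta> \<omega> \<bullet> J r \<omega> \<partial>M) = (\<integral>\<omega>. \<zeta> \<omega> \<bullet> J'' r \<omega> \<partial>M)"
    using \<zeta> by metis
  note sqG = simple_ito_sq_integrable[OF GJ(1)] simple_ito_sq_integrable[OF GJ'(1)]
    simple_ito_sq_integrable[OF R(1)]
  \<comment> \<open>Both sequences of simple integrands approximate \<open>H\<close> on \<open>[0, s]\<close>, so by the isometry their integrals have the same limit.\<close>
  have dist: "l2_dist2 M (J'' r) I' \<le> 4 * l2_dist2 (time_space T) (G r) H +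
      4 * l2_dist2 (time_space s) (G' r) H + 2 * l2_dist2 M (J' r) I'" for r
  proof -
    have "l2_dist2 M (J'' r) (J' r) = (\<integral>\<omega>. (J'' r \<omega> - J' r \<omega>) \<bullet> (J'' r \<omega> - J' r \<omega>) \<partial>M)"
      by (simp add: l2_dist2_def power2_norm_eq_inner)
    also have "\<dots> = (\<integral>z. (G'' r z - G' r z) \<bullet> (G'' r z - G' r z) \<partial>time_space s)"
      by (rule simple_ito_isometry[OF simple_ito_diff[OF R(1) GJ'(1)] simple_ito_diff[OF R(1) GJ'(1)]])
    also have "\<dots> = l2_dist2 (time_space s) (G'' r) (G' r)"
      by (simp add: l2_dist2_def power2_norm_eq_inner)
    also have "\<dots> \<le> 2 * l2_dist2 (time_space s) (G'' r) H + 2 * l2_dist2 (time_space s) H (G' r)"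
      by (rule l2_dist2_triangle[OF sqG(5) sq(3) sqG(3)])
    also have "l2_dist2 (time_space s) (G'' r) H = l2_dist2 (time_space s) (G r) H"
      unfolding l2_dist2_def by (intro Bochner_Integration.integral_cong) (simp_all add: R(2))
    also have "\<dots> \<le> l2_dist2 (time_space T) (G r) H"
      by (rule l2_dist2_time_space_mono[OF s(2) sqG(1) sq(1)])
    finally have "l2_dist2 M (J'' r) (J' r) \<le>
        2 * l2_dist2 (time_space T) (G r) H + 2 * l2_dist2 (time_space s) (G' r) H"
      by (simp add: l2_dist2_commute)
    then show ?thesis using l2_dist2_triangle[OF sqG(6)[of r] sqG(4)[of r] sq(4)] by linarith
  qed
  have "(\<lambda>r. 4 * l2_dist2 (time_space T) (G r) H +
      4 * l2_dist2 (time_space s) (G' r) H + 2 * l2_dist2 M (J' r) I') \<longlonglongrightarrow> 4 * 0 + 4 * 0 + 2 * 0"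
    by (intro tendsto_intros GJ GJ')
  then have "(\<lambda>r. 4 * l2_dist2 (time_space T) (G r) H +
      4 * l2_dist2 (time_space s) (G' r) H + 2 * l2_dist2 M (J' r) I') \<longlonglongrightarrow> 0" by simp
  then have J'': "(\<lambda>r. l2_dist2 M (J'' r) I') \<longlonglongrightarrow> 0"
    by (rule Lim_null_comparison[rotated]) (use dist in \<open>auto intro!: always_eventually\<close>)
  have "(\<lambda>r. l2_dist2 M \<zeta> \<zeta>) \<longlonglongrightarrow> 0" by simp
  from tendsto_inner_l2[OF \<zeta>(2) sq(2) \<zeta>(2) sqG(2) this GJ(3)]
    tendsto_inner_l2[OF \<zeta>(2) sq(4) \<zeta>(2) sqG(6) this J'']
  show ?thesis using LIMSEQ_unique unfolding R(3) by blast
qed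

end

section \<open>Second moments and mean square stability\<close>

lemma integral_time_measure:
  fixes f :: "real \<Rightarrow> 'b::euclidean_space"
  assumes "integrable (time_measure T) f"
  shows "f integrable_on {0..T}" "integral\<^sup>L (time_measure T) f = integral {0..T} f"
proof -
  have s: "set_integrable lborel {0..T} f"
    using assms by (simp add: time_measure_def integrable_restrict_space set_integrable_def)
  show "f integrable_on {0..T}" by (rule set_borel_integral_eq_integral(1)[OF s])
  show "integral\<^sup>L (time_measure T) f = integral {0..T} f"
    using set_borel_integral_eq_integral(2)[OF s]
    by (simp add: time_measure_def integral_restrict_space set_lebesgue_integral_def)
qed

lemma integral_time_measure_continuous:
  fixes f :: "real \<Rightarrow> 'b::euclidean_space"
  assumes "continuous_on {0..T} f"
  shows "integrable (time_measure T) f" "integral\<^sup>L (time_measure T) f = integral {0..T} f"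
proof -
  show i: "integrable (time_measure T) f"
    using borel_integrable_atLeastAtMost'[OF assms]
    by (simp add: time_measure_def integrable_restrict_space set_integrable_def)
  show "integral\<^sup>L (time_measure T) f = integral {0..T} f" by (rule integral_time_measure(2)[OF i])
qed

text \<open>The right hand side is continuous, hence so is \<open>f\<close>, hence the right hand side is differentiable, and
  \<open>exp(- l t) f(t)\<close> has derivative \<open>0\<close>.\<close>

lemma integral_equation_exp:
  fixes f :: "real \<Rightarrow> complex"
  assumes int: "\<And>T. 0 \<le> T \<Longrightarrow> f integrable_on {0..T}"
    and eq: "\<And>T. 0 \<le> T \<Longrightarrow> f T = f0 + l * integral {0..T} f"
    and "0 \<le> T"
  shows "f T = exp (l * of_real T) * f0"
proof -
  have c0: "continuous_on {0..T} (\<lambda>t. f0 + l * integral {0..t} f)"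
    using int[OF \<open>0 \<le> T\<close>] by (intro continuous_intros indefinite_integral_continuous_1)
  have "continuous_on {0..T} f \<longleftrightarrow> continuous_on {0..T} (\<lambda>t. f0 + l * integral {0..t} f)"
    by (rule continuous_on_cong[OF refl]) (use eq in simp)
  then have cont: "continuous_on {0..T} f" using c0 by simp
  define g where "g t = exp (- l * of_real t) * (f0 + l * integral {0..t} f)" for t
  have "(g has_vector_derivative 0) (at t within {0..T})" if t: "t \<in> {0..T}" for t
  proof -
    have e: "((\<lambda>t. exp (- l * of_real t)) has_vector_derivative exp (- l * of_real t) * - l) (at t within {0..T})"
      by (rule has_vector_derivative_at_within, rule has_vector_derivative_real_field)
        (auto intro!: derivative_eq_intros)
    have F: "((\<lambda>t. integral {0..t} f) has_vector_derivative f t) (at t within {0..T})"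
      by (rule integral_has_vector_derivative[OF cont t])
    have "(g has_vector_derivative
        exp (- l * of_real t) * (0 + l * f t) + exp (- l * of_real t) * - l * (f0 + l * integral {0..t} f))
      (at t within {0..T})"
      unfolding g_def
      by (rule has_vector_derivative_mult[OF e]) (intro derivative_intros has_vector_derivative_mult_right F)
    moreover have "f0 + l * integral {0..t} f = f t" using eq[of t] t by simp
    ultimately show ?thesis by (simp add: algebra_simps)
  qed
  then obtain c where c: "\<And>t. t \<in> {0..T} \<Longrightarrow> g t = c"
    using has_vector_derivative_zero_constant[of "{0..T}" g] by (auto simp: convex_closed_interval)
  have "g 0 = g T" using c \<open>0 \<le> T\<close> by simp
  moreover have "g 0 = f0" by (simp add: g_def)
  moreover have "g T = exp (- l * of_real T) * f T" using eq[OF \<open>0 \<le> T\<close>] by (simp add: g_def)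
  ultimately have "exp (l * of_real T) * f0 = exp (l * of_real T) * (exp (- l * of_real T) * f T)" by simp
  also have "\<dots> = (exp (l * of_real T) * exp (- l * of_real T)) * f T" by (simp only: mult.assoc)
  also have "exp (l * of_real T) * exp (- l * of_real T) = 1" by (simp add: exp_minus)
  finally show ?thesis by simp
qed

lemma quadratic_form_bound: "\<bar>v \<bullet> (U *v v)\<bar> \<le> onorm ((*v) U) * (norm v)\<^sup>2" for U :: "real^'n^'n"
proof -
  have "\<bar>v \<bullet> (U *v v)\<bar> \<le> norm v * norm (U *v v)" by (rule Cauchy_Schwarz_ineq2)
  also have "\<dots> \<le> norm v * (onorm ((*v) U) * norm v)"
    by (rule mult_left_mono[OF onorm[OF matrix_vector_mul_bounded_linear] norm_ge_zero])
  finally show ?thesis by (simp add: power2_eq_square mult_ac)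
qed

lemma inner_symmetric:
  fixes U :: "real^'n^'n"
  assumes "symmetric U" shows "u \<bullet> (U *v v) = v \<bullet> (U *v u)"
  using assms dot_lmul_matrix[of v U u] transpose_matrix_vector[of U v]
  by (simp add: symmetric_def inner_commute)

text \<open>By polarization.\<close>

lemma symmetric_eq_0_if_quadratic_form_0:
  fixes U :: "real^'n^'n"
  assumes U: "symmetric U" and 0: "\<And>v. v \<bullet> (U *v v) = 0"
  shows "U = 0"
proof -
  have "u \<bullet> (U *v v) = 0" for u v
  proof -
    have "(u + v) \<bullet> (U *v (u + v)) = u \<bullet> (U *v u) + 2 * (u \<bullet> (U *v v)) + v \<bullet> (U *v v)"
      by (simp add: inner_add_left inner_add_right matrix_vector_right_distrib inner_symmetric[OF U, of v u])
    then show ?thesis by (simp add: 0)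
  qed
  from this[of "U *v v" v for v] have "U *v v = 0" for v by simp
  then show ?thesis by (simp add: matrix_eq)
qed

context brownian_filtration
begin

lemma ito_limit_cong_AE:
  assumes "ito_limit T H I" "AE \<omega> in M. I \<omega> = I' \<omega>" "I' \<in> borel_measurable M"
  shows "ito_limit T H I'"
proof -
  obtain G J where GJ: "\<And>r. simple_ito T (G r) (J r)"
    "(\<lambda>r. l2_dist2 (time_space T) (G r) H) \<longlonglongrightarrow> 0" "(\<lambda>r::nat. l2_dist2 M (J r) I) \<longlonglongrightarrow> 0"
    using assms(1) unfolding ito_limit_def by blast
  have sq: "sq_integrable (time_space T) H" "sq_integrable M I" using assms by (auto simp: ito_limit_def)
  note sqG = simple_ito_sq_integrable(2)[OF GJ(1)]
  have "l2_dist2 M (J r) I' = l2_dist2 M (J r) I" for r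
    unfolding l2_dist2_def
  proof (rule integral_cong_AE)
    show "(\<lambda>\<omega>. (norm (J r \<omega> - I' \<omega>))\<^sup>2) \<in> borel_measurable M"
      using sq_integrable_measurable[OF sqG, of r] assms(3) by measurable
    show "(\<lambda>\<omega>. (norm (J r \<omega> - I \<omega>))\<^sup>2) \<in> borel_measurable M"
      using sq_integrable_measurable[OF sqG, of r] sq_integrable_measurable[OF sq(2)] by measurable
    show "AE \<omega> in M. (norm (J r \<omega> - I' \<omega>))\<^sup>2 = (norm (J r \<omega> - I \<omega>))\<^sup>2"
      using assms(2) by eventually_elim simp
  qed
  then have lim: "(\<lambda>r. l2_dist2 M (J r) I') \<longlonglongrightarrow> 0" using GJ(3) by simp
  show ?thesis unfolding ito_limit_def
    by (intro conjI exI allI, rule sq(1), rule sq_integrable_cong_AE[OF assms(2,3) sq(2)],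
        rule GJ(1), rule GJ(2), rule lim)
qed

lemma simple_ito_mean_zero:
  assumes "simple_ito T G J"
  shows "(\<integral>\<omega>. c \<bullet> J \<omega> \<partial>M) = 0"
  using assms
proof induction
  case (step G J a b \<xi>)
  have c: "sq_integrable M (\<lambda>\<omega>. c)" by (rule sq_integrable_const) (rule finite_measure_axioms)
  have "(\<integral>\<omega>. (W b \<omega> - W a \<omega>) * (c \<bullet> \<xi> \<omega>) \<partial>M) = 0"
    using step(5) by (intro expectation_mult_increment(2)[OF step(2,3)]
        integrable_inner_sq_integrable[OF c step(6)]) auto
  then have z: "(\<integral>\<omega>. c \<bullet> step_integral a b \<xi> \<omega> \<partial>M) = 0"
    by (simp add: step_integral_def)
  show ?case
    using step.IH z integrable_inner_sq_integrable[OF c simple_ito_sq_integrable(2)[OF step(1)]]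
      integrable_inner_sq_integrable[OF c sq_integrable_step_integral[OF step(2,3,5,6)]]
    by (simp add: inner_add_right)
qed simp

lemma ito_mean_zero:
  fixes I :: "'w \<Rightarrow> real^'n"
  assumes "ito_limit T H I"
  shows "(\<integral>\<omega>. c \<bullet> I \<omega> \<partial>M) = 0"
proof -
  obtain G J where GJ: "\<And>r. simple_ito T (G r) (J r)" "(\<lambda>r::nat. l2_dist2 M (J r) I) \<longlonglongrightarrow> 0"
    using assms(1) unfolding ito_limit_def by blast
  have sq: "sq_integrable M I" using assms by (auto simp: ito_limit_def)
  have c: "sq_integrable M (\<lambda>\<omega>. c)" by (rule sq_integrable_const) (rule finite_measure_axioms)
  have "(\<lambda>r::nat. l2_dist2 M (\<lambda>\<omega>. c) (\<lambda>\<omega>. c)) \<longlonglongrightarrow> 0" by simp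
  from tendsto_inner_l2[OF c sq c simple_ito_sq_integrable(2)[OF GJ(1)] this GJ(2)]
  show ?thesis unfolding simple_ito_mean_zero[OF GJ(1)] by (simp add: LIMSEQ_const_iff)
qed

text \<open>What the moment equation needs about a solution: its drift \<open>a\<close> and its values are square integrable,
  and \<open>x - x0 - a\<close> is an Ito integral at each time. The Ito integrals in the definition of a solution are
  chosen separately for each time, so they need not be jointly measurable in time and \<open>\<omega>\<close>; the difference
  \<open>x - x0 - a\<close> is a jointly measurable version of them.\<close>

lemma linear_sde_regular:
  fixes N A1 :: "real^'n^'n"
  assumes sol: "linear_sde_solution M \<F> W N A1 x0 x"
  defines "a \<equiv> \<lambda>t \<omega>. integral {0..t} (\<lambda>s. N *v x s \<omega>)"
  assumes T: "0 \<le> T"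
  shows "\<And>\<omega>. \<omega> \<in> space M \<Longrightarrow> continuous_on {0..T} (\<lambda>s. N *v x s \<omega>)"
    and "sq_integrable (time_space T) (\<lambda>z. x (fst z) (snd z))"
    and "sq_integrable (time_space T) (\<lambda>z. a (fst z) (snd z))"
    and "sq_integrable M (a T)" "x T \<in> borel_measurable (\<F> T)"
    and "ito_limit T (\<lambda>z. A1 *v x (fst z) (snd z)) (\<lambda>\<omega>. x T \<omega> - x0 - a T \<omega>)"
    and "sq_integrable M (x T)"
proof -
  let ?N = "\<lambda>s \<omega>. N *v x s \<omega>"
  have ii: "ito_integrand M \<F> T x" using sol T by (auto simp: linear_sde_solution_def)
  show cont: "continuous_on {0..T} (\<lambda>s. ?N s \<omega>)" if "\<omega> \<in> space M" for \<omega>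
  proof -
    have "continuous_on {0..} (\<lambda>t. x t \<omega>)" using sol that by (auto simp: linear_sde_solution_def)
    then have "continuous_on {0..T} (\<lambda>t. x t \<omega>)" by (rule continuous_on_subset) auto
    then show ?thesis
      by (rule bounded_linear.continuous_on[OF matrix_vector_mul_bounded_linear])
  qed
  show sqx: "sq_integrable (time_space T) (\<lambda>z. x (fst z) (snd z))"
    by (rule ito_integrand_sq_integrable[OF ii])
  then have sqN: "sq_integrable (time_space T) (\<lambda>z. ?N (fst z) (snd z))"
    by (rule sq_integrable_matrix)
  note [measurable] = sq_integrable_measurable[OF sqx] sq_integrable_measurable[OF sqN]
  \<comment> \<open>The drift is a parameter integral, hence jointly measurable.\<close>
  have a_eq: "a t \<omega> = (\<integral>s. (if s \<le> t then ?N s \<omega> else 0) \<partial>time_measure T)"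
    if "\<omega> \<in> space M" "t \<in> {0..T}" for t \<omega>
  proof -
    have c: "continuous_on {0..t} (\<lambda>s. ?N s \<omega>)"
      using cont[OF that(1)] by (rule continuous_on_subset) (use that in auto)
    have "a t \<omega> = (\<integral>s. ?N s \<omega> \<partial>time_measure t)"
      using integral_time_measure_continuous(2)[OF c] by (simp add: a_def)
    also have "\<dots> = (\<integral>s. indicator {0..t} s *\<^sub>R ?N s \<omega> \<partial>lborel)"
      by (simp add: time_measure_def integral_restrict_space)
    also have "\<dots> = (\<integral>s. indicator {0..T} s *\<^sub>R (if s \<le> t then ?N s \<omega> else 0) \<partial>lborel)"
      by (intro Bochner_Integration.integral_cong) (use that in \<open>auto simp: indicator_def\<close>)
    also have "\<dots> = (\<integral>s. (if s \<le> t then ?N s \<omega> else 0) \<partial>time_measure T)"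
      by (simp add: time_measure_def integral_restrict_space)
    finally show ?thesis .
  qed
  have sf: "sigma_finite_measure (time_measure T)"
    by (simp add: finite_measure.sigma_finite_measure finite_measure_time_measure)
  have fst_m: "(\<lambda>s. s) \<in> borel_measurable (time_measure T)"
    by (rule measurable_time_measure) simp
  have meas: "(\<lambda>z. a (fst z) (snd z)) \<in> borel_measurable (time_space T)"
  proof -
    have "(\<lambda>p. (snd p, snd (fst p))) \<in> measurable (time_space T \<Otimes>\<^sub>M time_measure T) (time_space T)"
      by measurable
    from measurable_compose[OF this sq_integrable_measurable[OF sqN]]
    have 1: "(\<lambda>p. ?N (snd p) (snd (fst p))) \<in> borel_measurable (time_space T \<Otimes>\<^sub>M time_measure T)" by simp
    have 2: "(\<lambda>p. snd p) \<in> borel_measurable (time_space T \<Otimes>\<^sub>M time_measure T)"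
      by (rule measurable_compose[OF measurable_snd fst_m])
    have 3: "(\<lambda>p. fst (fst p)) \<in> borel_measurable (time_space T \<Otimes>\<^sub>M time_measure T)"
      by (rule measurable_compose[OF measurable_fst measurable_compose[OF measurable_fst fst_m]])
    have "(\<lambda>p. if snd p \<le> fst (fst p) then ?N (snd p) (snd (fst p)) else 0)
      \<in> borel_measurable (time_space T \<Otimes>\<^sub>M time_measure T)"
      using 1 2 3 by (intro measurable_If borel_measurable_const) simp_all
    then have "(\<lambda>z. \<integral>s. (if s \<le> fst z then ?N s (snd z) else 0) \<partial>time_measure T) \<in> borel_measurable (time_space T)"
      by (intro sigma_finite_measure.borel_measurable_lebesgue_integral[OF sf]) (simp add: split_beta')
    then show ?thesis
      by (rule measurable_cong[THEN iffD1, rotated]) (auto simp: a_eq space_time_space)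
  qed
  define h where "h \<omega> = (\<integral>s. (norm (?N s \<omega>))\<^sup>2 \<partial>time_measure T)" for \<omega>
  have int2: "integrable (time_space T) (\<lambda>(s, \<omega>). (norm (?N s \<omega>))\<^sup>2)"
    using sqN by (simp add: sq_integrable_def split_beta')
  have h: "integrable M h"
    unfolding h_def by (rule pair_sigma_finite.integrable_snd[OF pair_sigma_finite_time_space int2])
  have bound: "(norm (a t \<omega>))\<^sup>2 \<le> T * h \<omega>" if w: "\<omega> \<in> space M" and t: "t \<in> {0..T}" for t \<omega>
  proof -
    have s2: "sq_integrable (time_measure T) (\<lambda>s. ?N s \<omega>)"
      using integral_time_measure_continuous(1)[OF cont[OF w]]
        integral_time_measure_continuous(1)[OF continuous_on_power[OF continuous_on_norm[OF cont[OF w]], of 2]]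
      by (simp add: sq_integrable_def)
    have "{s. 0 \<le> s \<and> s \<le> T \<and> s \<le> t} = {0..t}" using t by auto
    then have lt: "{s. 0 \<le> s \<and> s \<le> T \<and> s \<le> t} \<in> sets (time_measure T)"
      using t by (simp add: sets_time_measure sets_restrict_space_iff)
    define v where "v = a t \<omega>"
    let ?f = "\<lambda>s. if s \<le> t then v else 0"
    have s1: "sq_integrable (time_measure T) ?f"
    proof (rule sq_integrable_bound)
      show "?f \<in> borel_measurable (time_measure T)"
        by (rule measurable_time_measure) measurable
      show "integrable (time_measure T) (\<lambda>s. (norm v)\<^sup>2)"
        by (rule finite_measure.integrable_const[OF finite_measure_time_measure])
    qed simp
    have i: "integrable (time_measure T) (\<lambda>s. if s \<le> t then ?N s \<omega> else 0)"
    proof (rule Bochner_Integration.integrable_bound[OF integral_time_measure_continuous(1)[OF cont[OF w]]])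
      have "(\<lambda>s. s) \<in> borel_measurable (time_measure T)" by (rule fst_m)
      then show "(\<lambda>s. if s \<le> t then ?N s \<omega> else 0) \<in> borel_measurable (time_measure T)"
        using sq_integrable_measurable[OF s2] lt by (intro measurable_If borel_measurable_const) simp_all
    qed simp
    have "(norm v)\<^sup>2 = v \<bullet> (\<integral>s. (if s \<le> t then ?N s \<omega> else 0) \<partial>time_measure T)"
      using a_eq[OF w t] by (simp add: v_def power2_norm_eq_inner)
    also have "\<dots> = (\<integral>s. v \<bullet> (if s \<le> t then ?N s \<omega> else 0) \<partial>time_measure T)"
      by (rule integral_inner_right[symmetric]) (use i in auto)
    also have "\<dots> = (\<integral>s. ?f s \<bullet> ?N s \<omega> \<partial>time_measure T)"
      by (intro Bochner_Integration.integral_cong) auto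
    also have "\<dots> \<le> sqrt (\<integral>s. (norm (?f s))\<^sup>2 \<partial>time_measure T) * sqrt (h \<omega>)"
      using l2_Cauchy_Schwarz[OF s1 s2] by (simp add: h_def)
    also have "\<dots> \<le> sqrt (T * (norm v)\<^sup>2) * sqrt (h \<omega>)"
    proof (intro mult_right_mono real_sqrt_le_mono)
      have "(\<integral>s. (norm (?f s))\<^sup>2 \<partial>time_measure T) \<le> (\<integral>s. (norm v)\<^sup>2 \<partial>time_measure T)"
        using s1 finite_measure.integrable_const[OF finite_measure_time_measure]
        by (intro integral_mono) (auto simp: sq_integrable_def)
      also have "\<dots> = T * (norm v)\<^sup>2"
        using T by (simp add: time_measure_def measure_restrict_space space_restrict_space)
      finally show "(\<integral>s. (norm (?f s))\<^sup>2 \<partial>time_measure T) \<le> T * (norm v)\<^sup>2" .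
    qed (simp add: h_def)
    also have "\<dots> = norm v * sqrt (T * h \<omega>)"
      by (simp add: real_sqrt_mult mult_ac)
    finally have "norm v * norm v \<le> norm v * sqrt (T * h \<omega>)" by (simp add: power2_eq_square)
    then have "norm v \<le> sqrt (T * h \<omega>)"
      by (cases "norm v = 0") (use T in \<open>auto simp: h_def mult_le_cancel_left\<close>)
    then have "(norm v)\<^sup>2 \<le> (sqrt (T * h \<omega>))\<^sup>2" by (intro power_mono) auto
    then show ?thesis using T by (simp add: v_def h_def)
  qed
  show "sq_integrable (time_space T) (\<lambda>z. a (fst z) (snd z))"
  proof (rule sq_integrable_bound[OF meas])
    show "integrable (time_space T) (\<lambda>z. T * h (snd z))"
      using integrable_snd_time_space[OF h] by simp
  qed (use bound in \<open>auto simp: space_time_space\<close>)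
  show sqa: "sq_integrable M (a T)"
  proof (rule sq_integrable_bound)
    have "(\<lambda>\<omega>. (T, \<omega>)) \<in> measurable M (time_space T)" using T by simp
    from measurable_compose[OF this meas] show "a T \<in> borel_measurable M" by simp
    show "integrable M (\<lambda>\<omega>. T * h \<omega>)" using h by simp
  qed (use bound T in auto)
  show xF: "x T \<in> borel_measurable (\<F> T)" using ii T by (auto simp: ito_integrand_def)
  then have xM: "x T \<in> borel_measurable M" by (rule measurable_filtration)
  obtain I where I: "has_ito_integral M \<F> W T (\<lambda>s \<omega>. A1 *v x s \<omega>) I"
    "AE \<omega> in M. x T \<omega> = x0 + integral {0..T} (\<lambda>s. N *v x s \<omega>) + I \<omega>"
    using sol T unfolding linear_sde_solution_def by blast
  show il: "ito_limit T (\<lambda>z. A1 *v x (fst z) (snd z)) (\<lambda>\<omega>. x T \<omega> - x0 - a T \<omega>)"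
  proof (rule ito_limit_cong_AE[OF has_ito_integral_ito_limit[OF I(1)]])
    show "AE \<omega> in M. I \<omega> = x T \<omega> - x0 - a T \<omega>"
      using I(2) by eventually_elim (simp add: a_def)
    show "(\<lambda>\<omega>. x T \<omega> - x0 - a T \<omega>) \<in> borel_measurable M"
      using xM sq_integrable_measurable[OF sqa] by simp
  qed
  have "sq_integrable M (\<lambda>\<omega>. (x T \<omega> - x0 - a T \<omega>) + x0 + a T \<omega>)"
    using il sqa by (intro sq_integrable_add sq_integrable_const finite_measure_axioms)
      (auto simp: ito_limit_def)
  then show "sq_integrable M (x T)" by simp
qed

text \<open>The Ito formula for quadratic forms, in expectation. It follows from the isometry, the
  martingale property and the fundamental theorem of calculus for the drift.\<close>

lemma second_moment_equation:
  fixes N A1 U :: "real^'n^'n"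
  assumes sol: "linear_sde_solution M \<F> W N A1 x0 x" and U: "symmetric U" and T: "0 \<le> T"
  shows "(\<integral>\<omega>. x T \<omega> \<bullet> (U *v x T \<omega>) \<partial>M) = x0 \<bullet> (U *v x0) +
    (\<integral>z. x (fst z) (snd z) \<bullet> ((U ** N + transpose N ** U + transpose A1 ** U ** A1) *v x (fst z) (snd z))
      \<partial>time_space T)"
proof -
  define a where "a t \<omega> = integral {0..t} (\<lambda>s. N *v x s \<omega>)" for t \<omega>
  define m where "m t \<omega> = x t \<omega> - x0 - a t \<omega>" for t \<omega>
  note reg = linear_sde_regular[OF sol, folded a_def]
  have il: "ito_limit t (\<lambda>z. A1 *v x (fst z) (snd z)) (m t)" if "0 \<le> t" for t
    using reg(6)[OF that] by (simp add: m_def[abs_def])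
  have sqm: "sq_integrable M (m t)" if "0 \<le> t" for t using il[OF that] by (simp add: ito_limit_def)
  have c0: "sq_integrable M (\<lambda>\<omega>. x0)" by (rule sq_integrable_const) (rule finite_measure_axioms)
  define y where "y \<omega> = x0 + m T \<omega>" for \<omega>
  have sqy: "sq_integrable M y" unfolding y_def[abs_def] using c0 sqm[OF T] by (rule sq_integrable_add)
  let ?x = "\<lambda>z. x (fst z) (snd z)" and ?a = "\<lambda>z. a (fst z) (snd z)"
  define g where "g z = (y (snd z) + ?a z) \<bullet> (U *v (N *v ?x z))" for z
  have sqUN: "sq_integrable (time_space T) (\<lambda>z. U *v (N *v ?x z))"
    by (intro sq_integrable_matrix reg(2)[OF T])
  have gi: "integrable (time_space T) g"
    unfolding g_def by (intro integrable_inner_sq_integrable sqUN sq_integrable_add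
        sq_integrable_snd_time_space sqy reg(3)[OF T])
  have path: "x T \<omega> \<bullet> (U *v x T \<omega>) = y \<omega> \<bullet> (U *v y \<omega>) + 2 * (\<integral>s. g (s, \<omega>) \<partial>time_measure T)"
    if w: "\<omega> \<in> space M" for \<omega>
  proof -
    define F where "F t = (y \<omega> + a t \<omega>) \<bullet> (U *v (y \<omega> + a t \<omega>))" for t
    have da: "((\<lambda>t. a t \<omega>) has_vector_derivative N *v x t \<omega>) (at t within {0..T})" if "t \<in> {0..T}" for t
      unfolding a_def by (rule integral_has_vector_derivative[OF reg(1)[OF T w] that])
    have ca: "continuous_on {0..T} (\<lambda>t. a t \<omega>)"
      by (rule continuous_on_vector_derivative[OF da])
    have dF: "(F has_vector_derivative 2 * g (t, \<omega>)) (at t within {0..T})" if "t \<in> {0..T}" for t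
    proof -
      have d1: "((\<lambda>t. y \<omega> + a t \<omega>) has_vector_derivative N *v x t \<omega>) (at t within {0..T})"
        using has_vector_derivative_add[OF has_vector_derivative_const da[OF that]] by simp
      have d2: "((\<lambda>t. U *v (y \<omega> + a t \<omega>)) has_vector_derivative U *v (N *v x t \<omega>)) (at t within {0..T})"
        by (rule bounded_linear.has_vector_derivative[OF matrix_vector_mul_bounded_linear d1])
      have "(F has_vector_derivative
          (y \<omega> + a t \<omega>) \<bullet> (U *v (N *v x t \<omega>)) + (N *v x t \<omega>) \<bullet> (U *v (y \<omega> + a t \<omega>))) (at t within {0..T})"
        unfolding F_def by (rule bounded_bilinear.has_vector_derivative[OF bounded_bilinear_inner d1 d2])
      moreover have "(N *v x t \<omega>) \<bullet> (U *v (y \<omega> + a t \<omega>)) = (y \<omega> + a t \<omega>) \<bullet> (U *v (N *v x t \<omega>))"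
        by (rule inner_symmetric[OF U])
      ultimately show ?thesis by (simp add: g_def)
    qed
    have "((\<lambda>t. 2 * g (t, \<omega>)) has_integral (F T - F 0)) {0..T}"
      by (rule fundamental_theorem_of_calculus[OF T dF])
    then have "integral {0..T} (\<lambda>t. 2 * g (t, \<omega>)) = F T - F 0" by (rule integral_unique)
    moreover have "continuous_on {0..T} (\<lambda>t. g (t, \<omega>))"
    proof -
      have "continuous_on {0..T} (\<lambda>t. U *v (N *v x t \<omega>))"
        by (rule bounded_linear.continuous_on[OF matrix_vector_mul_bounded_linear reg(1)[OF T w]])
      then show ?thesis unfolding g_def using ca by (auto intro!: continuous_intros)
    qed
    from integral_time_measure_continuous(2)[OF this]
    have "integral {0..T} (\<lambda>t. 2 * g (t, \<omega>)) = 2 * (\<integral>s. g (s, \<omega>) \<partial>time_measure T)" by simp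
    moreover have "F 0 = y \<omega> \<bullet> (U *v y \<omega>)" by (simp add: F_def a_def)
    moreover have "F T = x T \<omega> \<bullet> (U *v x T \<omega>)" by (simp add: F_def y_def m_def)
    ultimately show ?thesis by simp
  qed
  have gi': "integrable (time_space T) (\<lambda>(s, \<omega>). g (s, \<omega>))" using gi by simp
  have gM: "integrable M (\<lambda>\<omega>. \<integral>s. g (s, \<omega>) \<partial>time_measure T)"
    by (rule pair_sigma_finite.integrable_snd[OF pair_sigma_finite_time_space gi'])
  have "(\<integral>\<omega>. x T \<omega> \<bullet> (U *v x T \<omega>) \<partial>M) =
      (\<integral>\<omega>. y \<omega> \<bullet> (U *v y \<omega>) + 2 * (\<integral>s. g (s, \<omega>) \<partial>time_measure T) \<partial>M)"
    by (rule Bochner_Integration.integral_cong[OF refl path])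
  also have "\<dots> = (\<integral>\<omega>. y \<omega> \<bullet> (U *v y \<omega>) \<partial>M) + 2 * (\<integral>\<omega>. (\<integral>s. g (s, \<omega>) \<partial>time_measure T) \<partial>M)"
    using gM integrable_inner_sq_integrable[OF sqy sq_integrable_matrix[OF sqy, of U]] by simp
  also have "(\<integral>\<omega>. (\<integral>s. g (s, \<omega>) \<partial>time_measure T) \<partial>M) = (\<integral>z. g z \<partial>time_space T)"
    using pair_sigma_finite.integral_snd[OF pair_sigma_finite_time_space gi'] by simp
  \<comment> \<open>At time \<open>s\<close> only the part of the martingale up to \<open>s\<close> correlates with the state, which turns \<open>y + a\<close> into \<open>x\<close>.\<close>
  also have "(\<integral>z. g z \<partial>time_space T) = (\<integral>z. ?x z \<bullet> (U *v (N *v ?x z)) \<partial>time_space T)"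
  proof -
    have ix: "integrable (time_space T) (\<lambda>z. ?x z \<bullet> (U *v (N *v ?x z)))"
      by (rule integrable_inner_sq_integrable[OF reg(2)[OF T] sqUN])
    have "(\<integral>\<omega>. g (s, \<omega>) \<partial>M) = (\<integral>\<omega>. x s \<omega> \<bullet> (U *v (N *v x s \<omega>)) \<partial>M)" if s: "s \<in> space (time_measure T)" for s
    proof -
      have s0: "0 \<le> s" "s \<le> T" using s by auto
      let ?z = "\<lambda>\<omega>. U *v (N *v x s \<omega>)"
      have sqz: "sq_integrable M ?z" by (intro sq_integrable_matrix reg(7)[OF s0(1)])
      have "(\<lambda>v. U *v (N *v v)) \<in> borel_measurable borel"
        unfolding matrix_vector_mul_assoc
        by (intro borel_measurable_continuous_onI linear_continuous_on matrix_vector_mul_bounded_linear)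
      from measurable_compose[OF reg(5)[OF s0(1)] this] have zF: "?z \<in> borel_measurable (\<F> s)" .
      have mart: "(\<integral>\<omega>. ?z \<omega> \<bullet> m T \<omega> \<partial>M) = (\<integral>\<omega>. ?z \<omega> \<bullet> m s \<omega> \<partial>M)"
        by (rule ito_martingale[OF il[OF T] il[OF s0(1)] s0 zF sqz])
      have i: "integrable M (\<lambda>\<omega>. ?z \<omega> \<bullet> (x0 + a s \<omega>))"
        by (intro integrable_inner_sq_integrable sqz sq_integrable_add c0 reg(4)[OF s0(1)])
      have "(\<integral>\<omega>. g (s, \<omega>) \<partial>M) = (\<integral>\<omega>. ?z \<omega> \<bullet> (x0 + a s \<omega>) + ?z \<omega> \<bullet> m T \<omega> \<partial>M)"
        by (intro Bochner_Integration.integral_cong)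
          (simp_all add: g_def y_def inner_add_left inner_add_right inner_commute)
      also have "\<dots> = (\<integral>\<omega>. ?z \<omega> \<bullet> (x0 + a s \<omega>) \<partial>M) + (\<integral>\<omega>. ?z \<omega> \<bullet> m s \<omega> \<partial>M)"
        using i integrable_inner_sq_integrable[OF sqz sqm[OF T]] mart by simp
      also have "\<dots> = (\<integral>\<omega>. ?z \<omega> \<bullet> (x0 + a s \<omega>) + ?z \<omega> \<bullet> m s \<omega> \<partial>M)"
        using i integrable_inner_sq_integrable[OF sqz sqm[OF s0(1)]] by simp
      also have "\<dots> = (\<integral>\<omega>. x s \<omega> \<bullet> ?z \<omega> \<partial>M)"
      proof (intro Bochner_Integration.integral_cong refl)
        fix \<omega>
        have "?z \<omega> \<bullet> (x0 + a s \<omega>) + ?z \<omega> \<bullet> m s \<omega> = ?z \<omega> \<bullet> (x0 + a s \<omega> + m s \<omega>)"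
          by (simp add: inner_add_right)
        then show "?z \<omega> \<bullet> (x0 + a s \<omega>) + ?z \<omega> \<bullet> m s \<omega> = x s \<omega> \<bullet> ?z \<omega>"
          by (simp add: m_def inner_commute)
      qed
      finally show ?thesis .
    qed
    then have "(\<integral>s. (\<integral>\<omega>. g (s, \<omega>) \<partial>M) \<partial>time_measure T) =
        (\<integral>s. (\<integral>\<omega>. x s \<omega> \<bullet> (U *v (N *v x s \<omega>)) \<partial>M) \<partial>time_measure T)"
      by (rule Bochner_Integration.integral_cong[OF refl])
    then show ?thesis
      using pair_sigma_finite.integral_fst'[OF pair_sigma_finite_time_space gi]
        pair_sigma_finite.integral_fst'[OF pair_sigma_finite_time_space ix] by simp
  qed
  also have "(\<integral>\<omega>. y \<omega> \<bullet> (U *v y \<omega>) \<partial>M) = x0 \<bullet> (U *v x0) +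
      (\<integral>z. (A1 *v ?x z) \<bullet> (U *v (A1 *v ?x z)) \<partial>time_space T)"
  proof -
    have "(\<integral>\<omega>. y \<omega> \<bullet> (U *v y \<omega>) \<partial>M) =
        (\<integral>\<omega>. x0 \<bullet> (U *v x0) + 2 * ((U *v x0) \<bullet> m T \<omega>) + m T \<omega> \<bullet> (U *v m T \<omega>) \<partial>M)"
    proof (intro Bochner_Integration.integral_cong refl)
      fix \<omega>
      have "x0 \<bullet> (U *v m T \<omega>) = m T \<omega> \<bullet> (U *v x0)" by (rule inner_symmetric[OF U])
      then show "y \<omega> \<bullet> (U *v y \<omega>) =
          x0 \<bullet> (U *v x0) + 2 * ((U *v x0) \<bullet> m T \<omega>) + m T \<omega> \<bullet> (U *v m T \<omega>)"
        by (simp add: y_def inner_add_left inner_add_right matrix_vector_right_distrib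
            inner_commute[of "U *v x0" "m T \<omega>"])
    qed
    also have "\<dots> = x0 \<bullet> (U *v x0) + 2 * (\<integral>\<omega>. (U *v x0) \<bullet> m T \<omega> \<partial>M) + (\<integral>\<omega>. m T \<omega> \<bullet> (U *v m T \<omega>) \<partial>M)"
      using integrable_inner_sq_integrable[OF sq_integrable_matrix[OF c0, of U] sqm[OF T]]
        integrable_inner_sq_integrable[OF sqm[OF T] sq_integrable_matrix[OF sqm[OF T], of U]]
      by (simp add: prob_space)
    also have "(\<integral>\<omega>. (U *v x0) \<bullet> m T \<omega> \<partial>M) = 0" by (rule ito_mean_zero[OF il[OF T]])
    also have "(\<integral>\<omega>. m T \<omega> \<bullet> (U *v m T \<omega>) \<partial>M) = (\<integral>z. (A1 *v ?x z) \<bullet> (U *v (A1 *v ?x z)) \<partial>time_space T)"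
      by (rule ito_isometry[OF il[OF T] ito_limit_matrix[OF il[OF T]]])
    finally show ?thesis by simp
  qed
  finally have *: "(\<integral>\<omega>. x T \<omega> \<bullet> (U *v x T \<omega>) \<partial>M) = x0 \<bullet> (U *v x0) +
      (\<integral>z. (A1 *v ?x z) \<bullet> (U *v (A1 *v ?x z)) \<partial>time_space T) +
      2 * (\<integral>z. ?x z \<bullet> (U *v (N *v ?x z)) \<partial>time_space T)" .
  have i: "integrable (time_space T) (\<lambda>z. (A1 *v ?x z) \<bullet> (U *v (A1 *v ?x z)))"
    "integrable (time_space T) (\<lambda>z. ?x z \<bullet> (U *v (N *v ?x z)))"
    by (intro integrable_inner_sq_integrable sq_integrable_matrix reg(2)[OF T])+
  have move: "u \<bullet> (transpose Y *v v) = (Y *v u) \<bullet> v" for u v :: "real^'n" and Y :: "real^'n^'n"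
    using dot_lmul_matrix[of v Y u] by (simp add: inner_commute[of u] inner_commute[of v])
  have quad: "v \<bullet> ((U ** N + transpose N ** U + transpose A1 ** U ** A1) *v v) =
      (A1 *v v) \<bullet> (U *v (A1 *v v)) + 2 * (v \<bullet> (U *v (N *v v)))" for v
  proof -
    have "v \<bullet> ((transpose N ** U) *v v) = v \<bullet> (U *v (N *v v))"
      unfolding matrix_vector_mul_assoc[symmetric] move by (rule inner_symmetric[OF U])
    moreover have "v \<bullet> ((transpose A1 ** U ** A1) *v v) = (A1 *v v) \<bullet> (U *v (A1 *v v))"
      unfolding matrix_vector_mul_assoc[symmetric] move ..
    ultimately show ?thesis
      by (simp add: matrix_vector_mult_add_rdistrib inner_add_right matrix_vector_mul_assoc)
  qed
  show ?thesis unfolding quad using * i by simp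
qed

text \<open>Along a solution, the quadratic form of an eigenvector for \<open>l\<close> is \<open>exp(l t)\<close> times its initial
  value in expectation, which tends to \<open>0\<close> only if \<open>Re l < 0\<close>. The eigenvector is complex, so its real and
  imaginary part are followed separately.\<close>

lemma ams_stable_spectrum:
  fixes N A1 :: "real^'n^'n"
  assumes stable: "ams_stable M \<F> W N A1"
  shows "lyap_spectrum N A1 \<subseteq> open_left_half_plane"
proof
  fix l assume "l \<in> lyap_spectrum N A1"
  then obtain X :: "complex^'n^'n" where X: "symmetric X" "X \<noteq> 0"
    and eig: "lyap (map_matrix complex_of_real N) (map_matrix complex_of_real A1) X = map_matrix ((*) l) X"
    by (auto simp: lyap_spectrum_def)
  define U :: "real^'n^'n" where "U = map_matrix Re X"
  define V :: "real^'n^'n" where "V = map_matrix Im X"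
  have sym: "symmetric U" "symmetric V"
    using X(1) by (simp_all add: symmetric_def U_def V_def transpose_def vec_eq_iff)
  define L where "L Y = Y ** N + transpose N ** Y + transpose A1 ** Y ** A1" for Y
  have entry: "(X ** map_matrix complex_of_real N + transpose (map_matrix complex_of_real N) ** X +
      transpose (map_matrix complex_of_real A1) ** X ** map_matrix complex_of_real A1) $ i $ j = l * X $ i $ j" for i j
    using eig by (simp add: lyap_def vec_eq_iff)
  have LU: "L U = Re l *\<^sub>R U - Im l *\<^sub>R V"
    using arg_cong[OF entry, of Re]
    by (simp add: L_def U_def V_def vec_eq_iff matrix_matrix_mult_def transpose_def)
  have LV: "L V = Im l *\<^sub>R U + Re l *\<^sub>R V"
    using arg_cong[OF entry, of Im]
    by (simp add: L_def U_def V_def vec_eq_iff matrix_matrix_mult_def transpose_def algebra_simps)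
  have "U \<noteq> 0 \<or> V \<noteq> 0"
    using X(2) by (auto simp: U_def V_def vec_eq_iff complex_eq_iff)
  then obtain x0 where x0: "x0 \<bullet> (U *v x0) \<noteq> 0 \<or> x0 \<bullet> (V *v x0) \<noteq> 0"
    using symmetric_eq_0_if_quadratic_form_0[OF sym(1)] symmetric_eq_0_if_quadratic_form_0[OF sym(2)] by blast
  obtain x where sol: "linear_sde_solution M \<F> W N A1 x0 x"
    and lim: "((\<lambda>t. \<integral>\<^sup>+\<omega>. ennreal ((norm (x t \<omega>))\<^sup>2) \<partial>M) \<longlongrightarrow> 0) at_top"
    using stable unfolding ams_stable_def by blast
  note reg = linear_sde_regular[OF sol]
  let ?x = "\<lambda>z. x (fst z) (snd z)"
  define q where "q Y t = (\<integral>\<omega>. x t \<omega> \<bullet> (Y *v x t \<omega>) \<partial>M)" for Y t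
  have iq: "integrable (time_space T) (\<lambda>z. ?x z \<bullet> (Y *v ?x z))" if "0 \<le> T" for Y T
    by (intro integrable_inner_sq_integrable sq_integrable_matrix reg(2)[OF that])
  have q_int: "integrable (time_measure T) (q Y)"
    and q_fub: "(\<integral>z. ?x z \<bullet> (Y *v ?x z) \<partial>time_space T) = integral {0..T} (q Y)"
    and q_HK: "q Y integrable_on {0..T}" if "0 \<le> T" for Y T
  proof -
    show i: "integrable (time_measure T) (q Y)"
      using pair_sigma_finite.integrable_fst'[OF pair_sigma_finite_time_space iq[OF that]]
      by (simp add: q_def[abs_def])
    show "(\<integral>z. ?x z \<bullet> (Y *v ?x z) \<partial>time_space T) = integral {0..T} (q Y)"
      using pair_sigma_finite.integral_fst'[OF pair_sigma_finite_time_space iq[OF that], of Y]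
      unfolding integral_time_measure(2)[OF i, symmetric] by (simp add: q_def[abs_def])
    show "q Y integrable_on {0..T}" by (rule integral_time_measure(1)[OF i])
  qed
  have q_eq: "q Y T = x0 \<bullet> (Y *v x0) + integral {0..T} (q (L Y))" if "0 \<le> T" "symmetric Y" for Y T
    using second_moment_equation[OF sol that(2,1)] q_fub[OF that(1), of "L Y"]
    by (simp add: q_def L_def)
  have iM: "integrable M (\<lambda>\<omega>. x t \<omega> \<bullet> (Y *v x t \<omega>))" if "0 \<le> t" for t Y
    by (intro integrable_inner_sq_integrable sq_integrable_matrix reg(7)[OF that])
  have q_lin: "q (a *\<^sub>R U + b *\<^sub>R V) t = a * q U t + b * q V t" if "0 \<le> t" for a b t
    using iM[OF that] by (simp add: q_def matrix_vector_mult_add_rdistrib inner_add_right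
        scaleR_matrix_vector_assoc[symmetric])
  have HK_lin: "integral {0..T} (q (a *\<^sub>R U + b *\<^sub>R V)) = a * integral {0..T} (q U) + b * integral {0..T} (q V)"
    if "0 \<le> T" for a b T
  proof -
    have "integral {0..T} (q (a *\<^sub>R U + b *\<^sub>R V)) = integral {0..T} (\<lambda>t. a * q U t + b * q V t)"
      by (rule Henstock_Kurzweil_Integration.integral_cong) (simp add: q_lin)
    then show ?thesis
      using q_HK[OF that] by (simp add: Henstock_Kurzweil_Integration.integral_add integrable_on_mult_right)
  qed
  define f where "f t = complex_of_real (q U t) + \<i> * complex_of_real (q V t)" for t
  define f0 where "f0 = complex_of_real (x0 \<bullet> (U *v x0)) + \<i> * complex_of_real (x0 \<bullet> (V *v x0))"
  have f_HK: "(f has_integral (complex_of_real (integral {0..T} (q U)) + \<i> * complex_of_real (integral {0..T} (q V)))) {0..T}"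
    if "0 \<le> T" for T
    unfolding f_def
    by (intro has_integral_add has_integral_mult_right has_integral_of_real integrable_integral q_HK that)
  have "f T = exp (l * of_real T) * f0" if "0 \<le> T" for T
  proof (rule integral_equation_exp[OF _ _ that])
    fix T :: real assume T: "0 \<le> T"
    show "f integrable_on {0..T}" using f_HK[OF T] by blast
    have "q U T = x0 \<bullet> (U *v x0) + (Re l * integral {0..T} (q U) - Im l * integral {0..T} (q V))"
      using q_eq[OF T sym(1)] HK_lin[OF T, of "Re l" "- Im l"] by (simp add: LU)
    moreover have "q V T = x0 \<bullet> (V *v x0) + (Im l * integral {0..T} (q U) + Re l * integral {0..T} (q V))"
      using q_eq[OF T sym(2)] HK_lin[OF T, of "Im l" "Re l"] by (simp add: LV)
    ultimately show "f T = f0 + l * integral {0..T} f"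
      by (simp add: integral_unique[OF f_HK[OF T]] f_def f0_def complex_eq_iff)
  qed
  then have norm_f: "norm (f T) = exp (Re l * T) * norm f0" if "0 \<le> T" for T
    using that by (simp add: norm_mult)
  have "f0 \<noteq> 0" using x0 by (simp add: f0_def complex_eq_iff)
  define c where "c = onorm ((*v) U) + onorm ((*v) V)"
  have f_le: "norm (f t) \<le> c * (\<integral>\<omega>. (norm (x t \<omega>))\<^sup>2 \<partial>M)" if t: "0 \<le> t" for t
  proof -
    have sq: "integrable M (\<lambda>\<omega>. (norm (x t \<omega>))\<^sup>2)" using reg(7)[OF t] by (simp add: sq_integrable_def)
    have "\<bar>q Y t\<bar> \<le> onorm ((*v) Y) * (\<integral>\<omega>. (norm (x t \<omega>))\<^sup>2 \<partial>M)" for Y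
    proof -
      have "\<bar>q Y t\<bar> \<le> (\<integral>\<omega>. \<bar>x t \<omega> \<bullet> (Y *v x t \<omega>)\<bar> \<partial>M)" unfolding q_def by (rule integral_abs_bound)
      also have "\<dots> \<le> (\<integral>\<omega>. onorm ((*v) Y) * (norm (x t \<omega>))\<^sup>2 \<partial>M)"
        using iM[OF t] sq by (intro integral_mono quadratic_form_bound) auto
      finally show ?thesis by simp
    qed
    from this[of U] this[of V] have "\<bar>q U t\<bar> + \<bar>q V t\<bar> \<le> c * (\<integral>\<omega>. (norm (x t \<omega>))\<^sup>2 \<partial>M)"
      by (simp add: c_def distrib_right)
    moreover have "norm (f t) \<le> \<bar>q U t\<bar> + \<bar>q V t\<bar>"
      unfolding f_def by (rule order_trans[OF norm_triangle_ineq]) (simp add: norm_mult)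
    ultimately show ?thesis by linarith
  qed
  have "((\<lambda>t. ennreal (\<integral>\<omega>. (norm (x t \<omega>))\<^sup>2 \<partial>M)) \<longlongrightarrow> ennreal 0) at_top"
  proof (rule Lim_transform_eventually)
    show "((\<lambda>t. \<integral>\<^sup>+\<omega>. ennreal ((norm (x t \<omega>))\<^sup>2) \<partial>M) \<longlongrightarrow> ennreal 0) at_top" using lim by simp
    show "\<forall>\<^sub>F t in at_top. (\<integral>\<^sup>+\<omega>. ennreal ((norm (x t \<omega>))\<^sup>2) \<partial>M) = ennreal (\<integral>\<omega>. (norm (x t \<omega>))\<^sup>2 \<partial>M)"
      using eventually_ge_at_top[of 0]
    proof eventually_elim
      case (elim t)
      then show ?case using reg(7)[OF elim] by (intro nn_integral_eq_integral) (auto simp: sq_integrable_def)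
    qed
  qed
  then have "((\<lambda>t. \<integral>\<omega>. (norm (x t \<omega>))\<^sup>2 \<partial>M) \<longlongrightarrow> 0) at_top"
    by (subst (asm) tendsto_ennreal_iff) auto
  then have "((\<lambda>t. c * (\<integral>\<omega>. (norm (x t \<omega>))\<^sup>2 \<partial>M)) \<longlongrightarrow> c * 0) at_top" by (intro tendsto_intros)
  then have "\<forall>\<^sub>F t in at_top. c * (\<integral>\<omega>. (norm (x t \<omega>))\<^sup>2 \<partial>M) < norm f0"
    using \<open>f0 \<noteq> 0\<close> by (intro order_tendstoD(2)) auto
  then have "\<forall>\<^sub>F t in at_top. exp (Re l * t) < 1"
    using eventually_ge_at_top[of 0]
  proof eventually_elim
    case (elim t)
    then have "exp (Re l * t) * norm f0 < 1 * norm f0" using f_le[of t] norm_f[of t] by simp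
    then show ?case using \<open>f0 \<noteq> 0\<close> by (simp only: mult_less_cancel_right) auto
  qed
  from eventually_conj[OF this eventually_gt_at_top[of 0]]
  obtain t where t: "exp (Re l * t) < 1" "0 < t"
    using eventually_happens'[OF trivial_limit_at_top_linorder] by blast
  then have "Re l < 0" by (simp add: mult_less_0_iff)
  then show "l \<in> open_left_half_plane" by (simp add: open_left_half_plane_def)
qed

end

section \<open>Matrix arithmetic\<close>

lemma matrix_minus_left: "(- X) ** Y = - (X ** Y)" for X :: "'a::ring_1^'n^'m"
  by (simp add: matrix_matrix_mult_def vec_eq_iff sum_negf)

lemma matrix_minus_right: "X ** (- Y) = - (X ** Y)" for X :: "'a::ring_1^'n^'m"
  by (simp add: matrix_matrix_mult_def vec_eq_iff sum_negf)

lemma matrix_add_right_distrib: "(X + Y) ** Z = X ** Z + Y ** Z" for X :: "'a::ring_1^'n^'m"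
  by (simp add: matrix_matrix_mult_def vec_eq_iff sum.distrib distrib_right)

lemma matrix_diff_left: "(X - Y) ** Z = X ** Z - Y ** Z" for X :: "'a::ring_1^'n^'m"
  by (simp add: matrix_matrix_mult_def vec_eq_iff sum_subtractf left_diff_distrib)

lemma matrix_diff_right: "X ** (Y - Z) = X ** Y - X ** Z" for X :: "'a::ring_1^'n^'m"
  by (simp add: matrix_matrix_mult_def vec_eq_iff sum_subtractf right_diff_distrib)

lemma matrix_scaleR_left: "(r *\<^sub>R X) ** Y = r *\<^sub>R (X ** Y)" for X :: "'a::real_algebra_1^'n^'m"
  by (simp add: matrix_matrix_mult_def vec_eq_iff scaleR_sum_right)

lemma matrix_scaleR_right: "X ** (r *\<^sub>R Y) = r *\<^sub>R (X ** Y)" for X :: "'a::real_algebra_1^'n^'m"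
  by (simp add: matrix_matrix_mult_def vec_eq_iff scaleR_sum_right)

lemma transpose_add: "transpose (X + Y) = transpose X + transpose Y"
  by (simp add: transpose_def vec_eq_iff)

lemma transpose_diff: "transpose (X - Y) = transpose X - transpose Y"
  by (simp add: transpose_def vec_eq_iff)

lemma transpose_minus: "transpose (- X) = - transpose X"
  by (simp add: transpose_def vec_eq_iff)

lemma transpose_scaleR: "transpose (r *\<^sub>R X) = r *\<^sub>R transpose X"
  by (simp add: transpose_def vec_eq_iff)

lemmas matrix_distribs = matrix_add_ldistrib matrix_add_right_distrib matrix_diff_left matrix_diff_right
  matrix_minus_left matrix_minus_right matrix_scaleR_left matrix_scaleR_right
  transpose_add transpose_diff transpose_minus transpose_scaleR

lemma matrix_inv_left: "invertible A \<Longrightarrow> matrix_inv A ** A = mat 1"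
  and matrix_inv_right: "invertible A \<Longrightarrow> A ** matrix_inv A = mat 1"
  unfolding invertible_def matrix_inv_def
  by (metis (mono_tags, lifting) someI_ex)+

lemma symmetric_diff: "symmetric X \<Longrightarrow> symmetric Y \<Longrightarrow> symmetric (X - Y)"
  by (simp add: symmetric_def transpose_diff)

section \<open>The Frobenius norm\<close>

lemma norm_matrix_square:
  fixes X :: "'a::real_normed_vector^'n^'m"
  shows "(norm X)\<^sup>2 = (\<Sum>i\<in>UNIV. \<Sum>j\<in>UNIV. (norm (X $ i $ j))\<^sup>2)"
  by (simp add: norm_vec_def L2_set_def sum_nonneg)

text \<open>Cauchy-Schwarz for every entry of the product.\<close>

lemma norm_matrix_mult_le:
  fixes X :: "'a::real_normed_algebra_1^'n^'m" and Y :: "'a^'k^'n"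
  shows "norm (X ** Y) \<le> norm X * norm Y"
proof -
  define c where "c j = L2_set (\<lambda>k. norm (Y $ k $ j)) UNIV" for j
  have entry: "(norm ((X ** Y) $ i $ j))\<^sup>2 \<le> (norm (X $ i))\<^sup>2 * (c j)\<^sup>2" for i j
  proof -
    have "norm ((X ** Y) $ i $ j) \<le> (\<Sum>k\<in>UNIV. norm (X $ i $ k) * norm (Y $ k $ j))"
      unfolding matrix_matrix_mult_def by (simp add: sum_norm_le norm_mult_ineq)
    also have "\<dots> \<le> norm (X $ i) * c j"
      using L2_set_mult_ineq[of "\<lambda>k. norm (X $ i $ k)" "\<lambda>k. norm (Y $ k $ j)" UNIV]
      by (simp add: norm_vec_def[of "X $ i"] c_def)
    finally have "(norm ((X ** Y) $ i $ j))\<^sup>2 \<le> (norm (X $ i) * c j)\<^sup>2"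
      by (intro power_mono) auto
    then show ?thesis by (simp add: power_mult_distrib)
  qed
  have c: "(\<Sum>j\<in>UNIV. (c j)\<^sup>2) = (norm Y)\<^sup>2"
    unfolding norm_matrix_square c_def L2_set_def by (simp add: sum_nonneg) (rule sum.swap)
  have X: "(\<Sum>i\<in>UNIV. (norm (X $ i))\<^sup>2) = (norm X)\<^sup>2"
    by (simp add: norm_vec_def[of X] L2_set_def sum_nonneg)
  have "(norm (X ** Y))\<^sup>2 \<le> (\<Sum>i\<in>UNIV. \<Sum>j\<in>UNIV. (norm (X $ i))\<^sup>2 * (c j)\<^sup>2)"
    unfolding norm_matrix_square by (intro sum_mono entry)
  also have "\<dots> = (norm X * norm Y)\<^sup>2"
    by (simp add: sum_product[symmetric] X c power_mult_distrib)
  finally show ?thesis by (rule power2_le_imp_le) simp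
qed

lemma norm_transpose: "norm (transpose X) = norm X" for X :: "'a::real_normed_vector^'n^'m"
proof -
  have "(norm (transpose X))\<^sup>2 = (norm X)\<^sup>2"
    unfolding norm_matrix_square by (simp add: transpose_def) (rule sum.swap)
  then show ?thesis by simp
qed

lemma norm_matrix_vector_mult_le: "norm (A *v x) \<le> norm A * norm x" for A :: "real^'n^'m"
proof -
  have "norm (A *v x) \<le> L2_set (\<lambda>i. norm x * norm (A $ i)) UNIV"
    unfolding norm_vec_def[of "A *v x"]
  proof (rule L2_set_mono)
    fix i
    have "\<bar>(A $ i) \<bullet> x\<bar> \<le> norm (A $ i) * norm x" by (rule Cauchy_Schwarz_ineq2)
    then show "norm ((A *v x) $ i) \<le> norm x * norm (A $ i)"
      by (simp add: matrix_vector_mul_component mult.commute)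
  qed simp
  also have "\<dots> = norm A * norm x"
    by (simp add: L2_set_right_distrib[symmetric] norm_vec_def[of A] mult.commute)
  finally show ?thesis .
qed

lemma norm_reindex_le:
  fixes x :: "'a::real_normed_vector^'n" and g :: "'m::finite \<Rightarrow> 'n"
  assumes "inj g"
  shows "norm (\<chi> j. x $ g j) \<le> norm x"
proof -
  have "(\<Sum>j\<in>UNIV. (norm (x $ g j))\<^sup>2) = (\<Sum>j\<in>range g. (norm (x $ j))\<^sup>2)"
    using assms by (simp add: sum.reindex)
  also have "\<dots> \<le> (\<Sum>j\<in>UNIV. (norm (x $ j))\<^sup>2)" by (intro sum_mono2) auto
  finally show ?thesis by (simp add: norm_vec_def L2_set_def)
qed

lemma norm_submatrix_le:
  fixes Z :: "'a::real_normed_vector^'n^'m" and f :: "'k::finite \<Rightarrow> 'm" and g :: "'l::finite \<Rightarrow> 'n"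
  assumes "inj f" "inj g"
  shows "norm (\<chi> i j. Z $ f i $ g j) \<le> norm Z"
proof -
  have "norm (\<chi> i j. Z $ f i $ g j) \<le> norm (\<chi> i. Z $ f i)"
    unfolding norm_vec_def[of "\<chi> i. (\<chi> j. Z $ f i $ g j)"] norm_vec_def[of "\<chi> i. Z $ f i"]
    by (intro L2_set_mono) (simp_all add: norm_reindex_le[OF assms(2)])
  also have "\<dots> \<le> norm Z" by (rule norm_reindex_le[OF assms(1)])
  finally show ?thesis .
qed

lemma norm_block_le:
  fixes Z :: "real^('n::finite + 'm::finite + 'p::finite)^('n + 'm + 'p)"
  shows "norm (block21 Z) \<le> norm Z" "norm (block22 Z) \<le> norm Z"
    "norm (block31 Z) \<le> norm Z" "norm (block33 Z) \<le> norm Z"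
  unfolding block21_def block22_def block31_def block33_def
  by (rule norm_submatrix_le; simp add: inj_def)+

section \<open>Block matrices\<close>

lemma hcat_vcat_mult:
  fixes X :: "'a::comm_ring_1^'n::finite^'k" and Y :: "'a^'m::finite^'k"
  shows "hcat X Y ** vcat U V = X ** U + Y ** V"
  unfolding matrix_matrix_mult_def hcat_def vcat_def vec_eq_iff
  by (simp add: UNIV_Plus_UNIV[symmetric] sum.Plus del: UNIV_Plus_UNIV)

lemma vcat_mult:
  fixes U :: "'a::comm_ring_1^'k^'n::finite" and V :: "'a^'k^'m::finite"
  shows "vcat U V ** X = vcat (U ** X) (V ** X)"
  unfolding matrix_matrix_mult_def vcat_def vec_eq_iff
  by (auto split: sum.split)

lemma transpose_hcat: "transpose (hcat X Y) = vcat (transpose X) (transpose Y)"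
  unfolding transpose_def hcat_def vcat_def vec_eq_iff by (auto split: sum.split)

text \<open>Multiplying out the blocks gives a Lyapunov operator in \<open>X\<close> plus terms that do not contain \<open>X\<close>.\<close>

lemma spu_residual_eq:
  fixes A A1 Q X :: "real^'n^'n" and B :: "real^'m^'n" and E :: "real^'p^'n" and R :: "real^'m^'m"
  shows "spu_residual (spu_matrix A A1 B E Q R \<gamma> X) L K =
    lyap (A - B ** L - E ** K) A1 X + (Q + transpose L ** R ** L - \<gamma>\<^sup>2 *\<^sub>R (transpose K ** K))"
  unfolding spu_residual_def Let_def spu_matrix_def
  by (simp add: matrix_mul_assoc[symmetric] transpose_hcat hcat_vcat_mult vcat_mult lyap_def
      matrix_distribs matrix_transpose_mul algebra_simps)

lemma spu_eval_iff:
  "spu_eval A A1 B E Q R \<gamma> L K X \<longleftrightarrow> symmetric X \<and>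
    lyap (A - B ** L - E ** K) A1 X = - (Q + transpose L ** R ** L - \<gamma>\<^sup>2 *\<^sub>R (transpose K ** K))"
  unfolding spu_eval_def spu_residual_eq by (simp only: eq_neg_iff_add_eq_0)

lemma blocks_perturbed_spu_matrix:
  "block21 (spu_matrix A A1 B E Q R \<gamma> P + \<Delta>) = transpose B ** P + block21 \<Delta>"
  "block22 (spu_matrix A A1 B E Q R \<gamma> P + \<Delta>) = R + block22 \<Delta>"
  "block31 (spu_matrix A A1 B E Q R \<gamma> P + \<Delta>) = transpose E ** P + block31 \<Delta>"
  "block33 (spu_matrix A A1 B E Q R \<gamma> P + \<Delta>) = - (\<gamma>\<^sup>2 *\<^sub>R mat 1) + block33 \<Delta>"
  by (simp_all add: block21_def block22_def block31_def block33_def spu_matrix_def hcat_def vcat_def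
      vec_eq_iff)

section \<open>The Lyapunov operator\<close>

lemma lyap_diff: "lyap N A1 (X - Y) = lyap N A1 X - lyap N A1 Y" for N :: "'a::comm_ring_1^'n^'n"
  by (simp add: lyap_def matrix_distribs)

lemma lyap_add: "lyap N A1 (X + Y) = lyap N A1 X + lyap N A1 Y" for N :: "'a::comm_ring_1^'n^'n"
  by (simp add: lyap_def matrix_distribs)

lemma lyap_scaleR: "lyap N A1 (r *\<^sub>R X) = r *\<^sub>R lyap N A1 X" for N :: "'a::real_algebra_1^'n^'n"
  by (simp add: lyap_def matrix_distribs scaleR_add_right)

lemma symmetric_lyap: "symmetric X \<Longrightarrow> symmetric (lyap N A1 X)" for N :: "'a::comm_ring_1^'n^'n"
  by (simp add: lyap_def symmetric_def matrix_distribs matrix_transpose_mul matrix_mul_assoc add_ac)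

lemma linear_lyap: "linear (lyap N A1)" for N :: "'a::real_normed_field^'n^'n"
  by (rule linearI) (simp_all add: lyap_add lyap_scaleR)

lemma norm_lyap_diff_le:
  fixes N N' :: "'a::real_normed_field^'n^'n"
  shows "norm (lyap N' A1 X - lyap N A1 X) \<le> 2 * norm (N' - N) * norm X"
proof -
  have "lyap N' A1 X - lyap N A1 X = X ** (N' - N) + transpose (N' - N) ** X"
    by (simp add: lyap_def matrix_distribs)
  also have "norm \<dots> \<le> norm X * norm (N' - N) + norm (transpose (N' - N)) * norm X"
    by (intro norm_triangle_mono norm_matrix_mult_le)
  finally show ?thesis by (simp add: norm_transpose algebra_simps)
qed

lemma norm_lyap_le:
  fixes N :: "'a::real_normed_field^'n^'n"
  shows "norm (lyap N A1 X) \<le> (2 * norm N + (norm A1)\<^sup>2) * norm X"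
proof -
  have "norm (X ** N) \<le> norm X * norm N" "norm (transpose N ** X) \<le> norm N * norm X"
    using norm_matrix_mult_le[of X N] norm_matrix_mult_le[of "transpose N" X] by (auto simp: norm_transpose)
  moreover have "norm (transpose A1 ** X ** A1) \<le> norm A1 * norm X * norm A1"
  proof -
    have "norm (transpose A1 ** X ** A1) \<le> norm (transpose A1 ** X) * norm A1"
      by (rule norm_matrix_mult_le)
    also have "\<dots> \<le> norm A1 * norm X * norm A1"
      using norm_matrix_mult_le[of "transpose A1" X] by (intro mult_right_mono) (auto simp: norm_transpose)
    finally show ?thesis .
  qed
  moreover have "norm (lyap N A1 X) \<le> norm (X ** N) + norm (transpose N ** X) + norm (transpose A1 ** X ** A1)"
    unfolding lyap_def by (intro norm_triangle_le add_right_mono) simp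
  ultimately show ?thesis by (simp add: algebra_simps power2_eq_square)
qed

abbreviation complexify :: "real^'n^'m \<Rightarrow> complex^'n^'m" where
  "complexify \<equiv> map_matrix complex_of_real"

lemma norm_complexify: "norm (complexify X) = norm X"
proof -
  have "(norm (complexify X))\<^sup>2 = (norm X)\<^sup>2"
    unfolding norm_matrix_square by (simp add: map_matrix_def)
  then show ?thesis by simp
qed

lemma complexify_diff: "complexify (X - Y) = complexify X - complexify Y"
  by (simp add: vec_eq_iff)

lemma complexify_mult: "complexify (X ** Y) = complexify X ** complexify Y"
  by (simp add: vec_eq_iff matrix_matrix_mult_def)

lemma complexify_lyap:
  fixes N A1 X :: "real^'n^'n"
  shows "complexify (lyap N A1 X) = lyap (complexify N) (complexify A1) (complexify X)"
proof -
  have "complexify (X + Y) = complexify X + complexify Y" for X Y :: "real^'n^'n"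
    by (simp add: vec_eq_iff)
  moreover have "transpose (complexify X) = complexify (transpose X)" for X :: "real^'n^'n"
    by (simp add: vec_eq_iff transpose_def)
  ultimately show ?thesis by (simp add: lyap_def complexify_mult)
qed

lemma symmetric_complexify: "symmetric X \<Longrightarrow> symmetric (complexify X)"
  by (simp add: vec_eq_iff transpose_def symmetric_def)

lemma norm_map_matrix_mult: "norm (map_matrix ((*) l) X) = cmod l * norm X"
proof -
  have "(norm (map_matrix ((*) l) X))\<^sup>2 = (cmod l * norm X)\<^sup>2"
    unfolding power_mult_distrib norm_matrix_square
    by (simp add: map_matrix_def norm_mult power_mult_distrib sum_distrib_left)
  then show ?thesis by simp
qed

text \<open>A quantitative form of the statement that no \<open>l\<close> with \<open>Re l \<ge> 0\<close> is an eigenvalue.\<close>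

definition resolvent_bound :: "real \<Rightarrow> real^'n^'n \<Rightarrow> real^'n^'n \<Rightarrow> bool" where
  "resolvent_bound c N A1 \<longleftrightarrow> (\<forall>l X. 0 \<le> Re l \<longrightarrow> symmetric X \<longrightarrow>
    c * norm X \<le> norm (lyap (complexify N) (complexify A1) X - map_matrix ((*) l) X))"

text \<open>For large \<open>|l|\<close> the term \<open>l X\<close> dominates. The remaining \<open>l\<close> and the symmetric \<open>X\<close> of norm \<open>1\<close> form a
  compact set, on which the continuous function \<open>\<parallel>\<L>(X) - l X\<parallel>\<close> has a positive minimum.\<close>

lemma ex_resolvent_bound:
  fixes N A1 :: "real^'n^'n"
  assumes "lyap_spectrum N A1 \<subseteq> open_left_half_plane"
  shows "\<exists>c>0. resolvent_bound c N A1"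
proof -
  let ?L = "lyap (complexify N) (complexify A1)"
  define b where "b = 2 * norm N + (norm A1)\<^sup>2"
  have b: "norm (?L X) \<le> b * norm X" "0 \<le> b" for X
    using norm_lyap_le[of "complexify N" "complexify A1" X] by (auto simp: b_def norm_complexify)
  define S where "S = {X :: complex^'n^'n. symmetric X \<and> norm X = 1}"
  define T where "T = {l :: complex. 0 \<le> Re l \<and> norm l \<le> b + 1}"
  define f where "f = (\<lambda>(l, X). norm (?L X - map_matrix ((*) l) X))"
  have "closed S"
    unfolding S_def symmetric_def vec_eq_iff transpose_def
    by (intro closed_Collect_conj closed_Collect_all closed_Collect_eq continuous_intros)
  moreover have "bounded S" unfolding bounded_iff S_def by (intro exI[of _ 1]) auto
  ultimately have "compact S" by (simp add: compact_eq_bounded_closed)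
  have "closed T"
    unfolding T_def by (intro closed_Collect_conj closed_Collect_le continuous_intros)
  moreover have "bounded T" unfolding bounded_iff T_def by (intro exI[of _ "b + 1"]) auto
  ultimately have "compact T" by (simp add: compact_eq_bounded_closed)
  have cont: "continuous_on (T \<times> S) f"
  proof -
    have "continuous_on UNIV ?L" by (rule linear_continuous_on) (simp add: linear_lyap linear_conv_bounded_linear[symmetric])
    then have "continuous_on (T \<times> S) (\<lambda>p. ?L (snd p))"
      by (rule continuous_on_compose2) (auto intro: continuous_intros)
    moreover have "continuous_on (T \<times> S) (\<lambda>p. map_matrix ((*) (fst p)) (snd p))"
      unfolding map_matrix_def by (intro continuous_intros)
    ultimately show ?thesis unfolding f_def split_beta' by (intro continuous_intros)
  qed
  obtain c where c: "0 < c" "\<And>l X. l \<in> T \<Longrightarrow> X \<in> S \<Longrightarrow> c \<le> f (l, X)"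
  proof (cases "S = {}")
    case True
    then show ?thesis using that[of 1] by auto
  next
    case False
    have "0 \<in> T" using b(2) by (simp add: T_def)
    then have "T \<times> S \<noteq> {}" using False by auto
    from continuous_attains_inf[OF compact_Times[OF \<open>compact T\<close> \<open>compact S\<close>] this cont]
    obtain l0 X0 where 0: "l0 \<in> T" "X0 \<in> S" "\<And>p. p \<in> T \<times> S \<Longrightarrow> f (l0, X0) \<le> f p" by auto
    have "f (l0, X0) \<noteq> 0"
    proof
      assume "f (l0, X0) = 0"
      then have "?L X0 = map_matrix ((*) l0) X0" by (simp add: f_def)
      moreover have "symmetric X0" "X0 \<noteq> 0" using 0 by (auto simp: S_def)
      ultimately have "l0 \<in> lyap_spectrum N A1" unfolding lyap_spectrum_def by blast
      then show False using assms 0 by (auto simp: T_def open_left_half_plane_def)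
    qed
    then have "0 < f (l0, X0)" by (simp add: f_def)
    then show ?thesis using that[of "f (l0, X0)"] 0 by auto
  qed
  have "resolvent_bound (min 1 c) N A1"
    unfolding resolvent_bound_def
  proof (intro allI impI)
    fix l :: complex and X :: "complex^'n^'n" assume l: "0 \<le> Re l" and X: "symmetric X"
    show "min 1 c * norm X \<le> norm (?L X - map_matrix ((*) l) X)"
    proof (cases "X = 0")
      case False
      then have n: "0 < norm X" by simp
      show ?thesis
      proof (cases "norm l \<le> b + 1")
        case True
        define Y where "Y = (1 / norm X) *\<^sub>R X"
        have "Y \<in> S" using X False by (simp add: S_def Y_def symmetric_def transpose_scaleR)
        moreover have "l \<in> T" using l True by (simp add: T_def)
        ultimately have "c \<le> norm (?L Y - map_matrix ((*) l) Y)" using c(2) by (simp add: f_def)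
        also have "?L Y - map_matrix ((*) l) Y = (1 / norm X) *\<^sub>R (?L X - map_matrix ((*) l) X)"
          unfolding Y_def lyap_scaleR by (simp add: vec_eq_iff scaleR_diff_right)
        also have "norm \<dots> = norm (?L X - map_matrix ((*) l) X) / norm X"
          unfolding norm_scaleR by simp
        finally have "c * norm X \<le> norm (?L X - map_matrix ((*) l) X)"
          using n by (simp add: field_simps)
        moreover have "min 1 c * norm X \<le> c * norm X" by (simp add: mult_right_mono)
        ultimately show ?thesis by linarith
      next
        case False
        have "norm X * 1 \<le> norm X * (norm l - b)" using False by (intro mult_left_mono) auto
        also have "\<dots> = norm (map_matrix ((*) l) X) - b * norm X"
          by (simp add: norm_map_matrix_mult algebra_simps)
        also have "\<dots> \<le> norm (map_matrix ((*) l) X) - norm (?L X)" using b(1)[of X] by simp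
        also have "\<dots> \<le> norm (?L X - map_matrix ((*) l) X)"
          by (metis norm_minus_commute norm_triangle_ineq2)
        finally have "norm X \<le> norm (?L X - map_matrix ((*) l) X)" by simp
        moreover have "min 1 c * norm X \<le> 1 * norm X" by (intro mult_right_mono) auto
        ultimately show ?thesis by linarith
      qed
    qed (simp add: lyap_def)
  qed
  then show ?thesis using c(1) by (intro exI[of _ "min 1 c"]) auto
qed

text \<open>A change of \<open>N\<close> by \<open>D\<close> changes the Lyapunov operator by \<open>X \<mapsto> X D + D\<^sup>T X\<close>, of norm at most \<open>2 \<parallel>D\<parallel>\<close>.\<close>

lemma resolvent_bound_perturb:
  fixes N N' A1 :: "real^'n^'n"
  assumes "resolvent_bound c N A1"
  shows "resolvent_bound (c - 2 * norm (N' - N)) N' A1"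
  unfolding resolvent_bound_def
proof (intro allI impI)
  fix l :: complex and X :: "complex^'n^'n" assume l: "0 \<le> Re l" and X: "symmetric X"
  let ?L = "lyap (complexify N) (complexify A1) X" and ?L' = "lyap (complexify N') (complexify A1) X"
  have "c * norm X \<le> norm (?L - map_matrix ((*) l) X)"
    using assms l X by (simp add: resolvent_bound_def)
  also have "\<dots> \<le> norm (?L' - map_matrix ((*) l) X) + norm (?L' - ?L)"
    using norm_triangle_ineq4[of "?L' - map_matrix ((*) l) X" "?L' - ?L"] by simp
  also have "norm (?L' - ?L) \<le> 2 * norm (N' - N) * norm X"
    using norm_lyap_diff_le[of "complexify N'" "complexify A1" X "complexify N"]
    by (simp add: complexify_diff[symmetric] norm_complexify)
  finally show "(c - 2 * norm (N' - N)) * norm X \<le> norm (?L' - map_matrix ((*) l) X)"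
    unfolding left_diff_distrib by linarith
qed

lemma resolvent_bound_spectrum:
  assumes "resolvent_bound c N A1" "0 < c"
  shows "lyap_spectrum N A1 \<subseteq> open_left_half_plane"
proof
  fix l assume "l \<in> lyap_spectrum N A1"
  then obtain X where X: "symmetric X" "X \<noteq> 0"
    "lyap (complexify N) (complexify A1) X = map_matrix ((*) l) X" by (auto simp: lyap_spectrum_def)
  have "0 < c * norm X" using assms X by simp
  then show "l \<in> open_left_half_plane"
    using assms(1) X unfolding resolvent_bound_def open_left_half_plane_def
    by (metis cancel_comm_monoid_add_class.diff_cancel linorder_not_less mem_Collect_eq norm_zero)
qed

lemma resolvent_bound_real:
  assumes "resolvent_bound c N A1" "symmetric X"
  shows "c * norm X \<le> norm (lyap N A1 X)"
proof -
  have "c * norm (complexify X) \<le>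
      norm (lyap (complexify N) (complexify A1) (complexify X) - map_matrix ((*) 0) (complexify X))"
    using assms symmetric_complexify[OF assms(2)] unfolding resolvent_bound_def by auto
  moreover have "map_matrix ((*) 0) (complexify X) = 0" by (simp add: vec_eq_iff)
  ultimately show ?thesis by (simp add: norm_complexify complexify_lyap[symmetric])
qed

text \<open>The bound at \<open>l = 0\<close> makes the operator injective on symmetric matrices, a finite dimensional space
  that it maps to itself.\<close>

lemma ex1_lyap_equation:
  fixes N A1 Y :: "real^'n^'n"
  assumes "resolvent_bound c N A1" "0 < c" "symmetric Y"
  shows "\<exists>!X. symmetric X \<and> lyap N A1 X = Y"
proof -
  have inj: "X = 0" if "symmetric X" "lyap N A1 X = 0" for X
    using resolvent_bound_real[OF assms(1) that(1)] that(2) assms(2)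
    by (simp add: mult_le_0_iff)
  \<comment> \<open>Extend the operator by the identity on antisymmetric matrices, to get an injective, hence surjective, map on the whole space.\<close>
  define sm :: "real^'n^'n \<Rightarrow> real^'n^'n" where "sm X = (1/2) *\<^sub>R (X + transpose X)" for X
  define an :: "real^'n^'n \<Rightarrow> real^'n^'n" where "an X = (1/2) *\<^sub>R (X - transpose X)" for X
  define g where "g X = lyap N A1 (sm X) + an X" for X
  have sm: "symmetric (sm X)" and an: "transpose (an X) = - an X" and sum: "X = sm X + an X" for X
    by (simp_all add: sm_def an_def symmetric_def transpose_def vec_eq_iff field_simps)
  have "linear sm" "linear an"
    by (auto intro!: linearI simp: sm_def an_def transpose_add transpose_scaleR algebra_simps)
  then have lin: "linear g"
    unfolding g_def using linear_compose_add[OF linear_compose[OF _ linear_lyap]] by (auto simp: comp_def)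
  have parts: "lyap N A1 (sm X) = Z" "an X = 0" if "g X = Z" "symmetric Z" for X Z
  proof -
    have "transpose (g X) = lyap N A1 (sm X) - an X"
      using symmetric_lyap[OF sm[of X], of N A1] by (simp add: g_def transpose_add an symmetric_def)
    then have "lyap N A1 (sm X) - an X = lyap N A1 (sm X) + an X"
      using that by (simp add: symmetric_def g_def)
    then have "2 *\<^sub>R an X = 0" by (simp add: scaleR_2)
    then show "an X = 0" by simp
    then show "lyap N A1 (sm X) = Z" using that by (simp add: g_def)
  qed
  have "inj g"
  proof (subst linear_injective_0[OF lin], intro allI impI)
    fix X assume "g X = 0"
    then have "lyap N A1 (sm X) = 0" "an X = 0" using parts[of X 0] by (auto simp: symmetric_def transpose_def vec_eq_iff)
    then have "sm X + an X = 0" using inj[OF sm] by simp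
    then show "X = 0" unfolding sum[of X, symmetric] .
  qed
  then have "surj g" using linear_injective_imp_surjective[OF lin] by simp
  then obtain X where "g X = Y" by (metis surjD)
  then have "lyap N A1 (sm X) = Y" using parts assms(3) by blast
  moreover have "X = X'" if "symmetric X" "lyap N A1 X = Y" "symmetric X'" "lyap N A1 X' = Y" for X X'
    using inj[of "X - X'"] that by (simp add: symmetric_diff lyap_diff)
  ultimately show ?thesis using sm by blast
qed

section \<open>The Newton step with perturbed gains\<close>

text \<open>Substitute the Riccati equation and the identities \<open>B\<^sup>T P = R Ls\<close>, \<open>E\<^sup>T P = - \<gamma>\<^sup>2 Ks\<close>; the terms in \<open>L\<close> and \<open>K\<close>
  then form complete squares. The first summand on the right is what the solution of the evaluation
  equation with gains \<open>L\<close>, \<open>K\<close> is mapped to, so the second one is minus the image of its error.\<close>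

lemma lyap_completed_square:
  fixes A A1 Q P :: "real^'n^'n" and B :: "real^'m^'n" and E :: "real^'p^'n" and R :: "real^'m^'m"
  assumes P: "symmetric P" and R: "invertible R" "symmetric R" and \<gamma>: "\<gamma> \<noteq> 0"
    and gare: "gare A A1 B E Q R \<gamma> P"
    and Ls: "Ls = matrix_inv R ** (transpose B ** P)"
    and Ks: "Ks = - ((1 / \<gamma>\<^sup>2) *\<^sub>R (transpose E ** P))"
  shows "lyap (A - B ** L - E ** K) A1 P = - (Q + transpose L ** R ** L - \<gamma>\<^sup>2 *\<^sub>R (transpose K ** K))
    + (transpose (L - Ls) ** R ** (L - Ls) - \<gamma>\<^sup>2 *\<^sub>R (transpose (K - Ks) ** (K - Ks)))"
proof -
  have tP: "transpose P = P" and tR: "transpose R = R" using P R by (auto simp: symmetric_def)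
  have BP: "transpose B ** P = R ** Ls"
    by (simp add: Ls matrix_mul_assoc matrix_inv_right[OF R(1)])
  have "P ** B = transpose (transpose B ** P)" by (simp add: matrix_transpose_mul tP)
  then have PB: "P ** B = transpose Ls ** R" unfolding BP by (simp add: matrix_transpose_mul tR)
  have EP: "transpose E ** P = - (\<gamma>\<^sup>2 *\<^sub>R Ks)" using \<gamma> by (simp add: Ks)
  have "P ** E = transpose (transpose E ** P)" by (simp add: matrix_transpose_mul tP)
  then have PE: "P ** E = - (\<gamma>\<^sup>2 *\<^sub>R transpose Ks)"
    unfolding EP by (simp add: transpose_minus transpose_scaleR)
  have sqB: "P ** B ** matrix_inv R ** transpose B ** P = transpose Ls ** R ** Ls"
  proof -
    have "P ** B ** matrix_inv R ** transpose B ** P = (P ** B) ** Ls"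
      by (simp add: Ls matrix_mul_assoc)
    then show ?thesis by (simp add: PB)
  qed
  have sqE: "(1 / \<gamma>\<^sup>2) *\<^sub>R (P ** E ** transpose E ** P) = \<gamma>\<^sup>2 *\<^sub>R (transpose Ks ** Ks)"
  proof -
    have "P ** E ** transpose E ** P = (P ** E) ** (transpose E ** P)" by (simp add: matrix_mul_assoc)
    then show ?thesis using \<gamma> by (simp add: PE EP matrix_distribs power2_eq_square)
  qed
  have ric: "P ** A + transpose A ** P + transpose A1 ** P ** A1 =
      - Q + transpose Ls ** R ** Ls - \<gamma>\<^sup>2 *\<^sub>R (transpose Ks ** Ks)"
    using gare unfolding gare_def sqB sqE by (simp add: algebra_simps add_eq_0_iff)
  have "lyap (A - B ** L - E ** K) A1 P = (P ** A + transpose A ** P + transpose A1 ** P ** A1)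
      - (P ** B) ** L - (P ** E) ** K - transpose L ** (transpose B ** P) - transpose K ** (transpose E ** P)"
    by (simp add: lyap_def matrix_distribs matrix_transpose_mul matrix_mul_assoc algebra_simps)
  also have "\<dots> = - (Q + transpose L ** R ** L - \<gamma>\<^sup>2 *\<^sub>R (transpose K ** K))
    + (transpose (L - Ls) ** R ** (L - Ls) - \<gamma>\<^sup>2 *\<^sub>R (transpose (K - Ks) ** (K - Ks)))"
    unfolding ric PB PE BP EP
    by (simp add: matrix_distribs matrix_mul_assoc algebra_simps)
  finally show ?thesis .
qed

text \<open>The Newton step at \<open>P\<close> is the evaluation step with the exact gains of \<open>P\<close>.\<close>

lemma newton_step_iff_spu_eval:
  fixes A A1 Q P :: "real^'n^'n" and B :: "real^'m^'n" and E :: "real^'p^'n" and R :: "real^'m^'m"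
  assumes P: "symmetric P" and R: "invertible R" "symmetric R" and \<gamma>: "\<gamma> \<noteq> 0"
    and L: "L = matrix_inv R ** (transpose B ** P)"
    and K: "K = - ((1 / \<gamma>\<^sup>2) *\<^sub>R (transpose E ** P))"
  shows "closed_loop A B E R \<gamma> P = A - B ** L - E ** K"
    and "newton_step A A1 B E Q R \<gamma> P X \<longleftrightarrow> spu_eval A A1 B E Q R \<gamma> L K X"
proof -
  have tP: "transpose P = P" and tR: "transpose R = R" using P R by (auto simp: symmetric_def)
  show cl: "closed_loop A B E R \<gamma> P = A - B ** L - E ** K"
    by (simp add: closed_loop_def L K matrix_distribs matrix_mul_assoc)
  have RL: "R ** L = transpose B ** P" by (simp add: L matrix_mul_assoc matrix_inv_right[OF R(1)])
  have "P ** B = transpose (transpose B ** P)" by (simp add: matrix_transpose_mul tP)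
  then have "P ** B = transpose L ** R" unfolding RL[symmetric] by (simp add: matrix_transpose_mul tR)
  then have sqB: "P ** B ** matrix_inv R ** transpose B ** P = transpose L ** R ** L"
    by (simp add: L matrix_mul_assoc)
  have sqE: "(1 / \<gamma>\<^sup>2) *\<^sub>R (P ** E ** transpose E ** P) = \<gamma>\<^sup>2 *\<^sub>R (transpose K ** K)"
    using \<gamma> by (simp add: K matrix_distribs matrix_transpose_mul tP matrix_mul_assoc power2_eq_square)
  show "newton_step A A1 B E Q R \<gamma> P X \<longleftrightarrow> spu_eval A A1 B E Q R \<gamma> L K X"
    unfolding newton_step_def spu_eval_iff cl sqB sqE ..
qed

text \<open>Linear equations depend Lipschitz continuously on their data: subtracting \<open>S L = Y P\<close> from
  \<open>(S + \<Delta>2) L' = Y P + \<Delta>1\<close> gives \<open>S (L' - L) = \<Delta>1 - \<Delta>2 L - \<Delta>2 (L' - L)\<close>, whose last term is absorbed on the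
  left when \<open>\<parallel>\<Delta>2\<parallel>\<close> is small.\<close>

lemma perturbed_gain:
  fixes S :: "real^'m^'m" and Y :: "real^'n^'m" and Z :: "real^'n^'n"
  assumes S: "invertible S"
  shows "\<exists>\<kappa>>0. \<exists>\<eta>>0. \<forall>P \<Delta>2 \<Delta>1 d. norm (P - Z) \<le> \<eta> \<longrightarrow> norm \<Delta>2 \<le> d \<longrightarrow> norm \<Delta>1 \<le> d \<longrightarrow> d \<le> \<eta> \<longrightarrow>
    invertible (S + \<Delta>2) \<and>
    norm (matrix_inv (S + \<Delta>2) ** (Y ** P + \<Delta>1) - matrix_inv S ** (Y ** Z)) \<le> \<kappa> * (norm (P - Z) + d)"
proof -
  define \<rho> where "\<rho> = norm (matrix_inv S)"
  define b where "b = \<rho> * norm Y * (norm Z + 1)"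
  define \<kappa> where "\<kappa> = 2 * \<rho> * (1 + b) + \<rho> * norm Y + 1"
  define \<eta> where "\<eta> = min 1 (1 / (2 * \<rho> + 1))"
  have nn: "0 \<le> \<rho>" "0 \<le> b" "0 < \<kappa>" "0 < \<eta>" "\<eta> \<le> 1"
    by (auto simp: \<rho>_def b_def \<kappa>_def \<eta>_def intro!: add_nonneg_pos add_nonneg_nonneg)
  have \<rho>\<eta>: "\<rho> * \<eta> \<le> 1 / 2"
  proof -
    have "\<rho> * \<eta> \<le> \<rho> * (1 / (2 * \<rho> + 1))" using nn by (intro mult_left_mono) (auto simp: \<eta>_def)
    also have "\<dots> \<le> 1 / 2" using nn by (simp add: field_simps)
    finally show ?thesis .
  qed
  have "invertible (S + \<Delta>2) \<and>
    norm (matrix_inv (S + \<Delta>2) ** (Y ** P + \<Delta>1) - matrix_inv S ** (Y ** Z)) \<le> \<kappa> * (norm (P - Z) + d)"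
    if P: "norm (P - Z) \<le> \<eta>" and \<Delta>2: "norm \<Delta>2 \<le> d" and \<Delta>1: "norm \<Delta>1 \<le> d" and d: "d \<le> \<eta>"
    for P \<Delta>1 d and \<Delta>2 :: "real^'m^'m"
  proof
    have d0: "0 \<le> d" using \<Delta>2 norm_ge_zero[of \<Delta>2] by linarith
    have half: "\<rho> * norm \<Delta>2 \<le> 1 / 2"
      using mult_left_mono[of "norm \<Delta>2" \<eta> \<rho>] \<Delta>2 d \<rho>\<eta> nn by linarith
    have "x = 0" if "(S + \<Delta>2) *v x = 0" for x
    proof -
      have "S *v x = - (\<Delta>2 *v x)"
        using that by (simp add: matrix_vector_mult_add_rdistrib add_eq_0_iff)
      then have "matrix_inv S *v (S *v x) = - (matrix_inv S *v (\<Delta>2 *v x))"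
        by (simp add: linear_neg[OF matrix_vector_mul_linear])
      then have "x = - (matrix_inv S *v (\<Delta>2 *v x))"
        by (simp add: matrix_vector_mul_assoc matrix_inv_left[OF S])
      then have "norm x = norm (- (matrix_inv S *v (\<Delta>2 *v x)))" by (rule arg_cong)
      also have "\<dots> = norm (matrix_inv S *v (\<Delta>2 *v x))" by (rule norm_minus_cancel)
      also have "\<dots> \<le> \<rho> * norm (\<Delta>2 *v x)" unfolding \<rho>_def by (rule norm_matrix_vector_mult_le)
      also have "\<dots> \<le> \<rho> * (norm \<Delta>2 * norm x)"
        using nn by (intro mult_left_mono norm_matrix_vector_mult_le)
      also have "\<dots> \<le> 1 / 2 * norm x"
        using mult_right_mono[OF half norm_ge_zero[of x]] by (simp add: mult.assoc)
      finally show ?thesis by simp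
    qed
    then show inv: "invertible (S + \<Delta>2)"
      unfolding invertible_left_inverse matrix_left_invertible_ker by blast
    define L where "L = matrix_inv S ** (Y ** P)"
    define L' where "L' = matrix_inv (S + \<Delta>2) ** (Y ** P + \<Delta>1)"
    have "S ** L = Y ** P" by (simp add: L_def matrix_mul_assoc matrix_inv_right[OF S])
    moreover have "(S + \<Delta>2) ** L' = Y ** P + \<Delta>1" by (simp add: L'_def matrix_mul_assoc matrix_inv_right[OF inv])
    ultimately have "S ** (L' - L) = \<Delta>1 - \<Delta>2 ** L - \<Delta>2 ** (L' - L)"
      by (simp add: matrix_distribs algebra_simps)
    then have "matrix_inv S ** (S ** (L' - L)) = matrix_inv S ** (\<Delta>1 - \<Delta>2 ** L - \<Delta>2 ** (L' - L))" by simp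
    then have eq: "L' - L = matrix_inv S ** (\<Delta>1 - \<Delta>2 ** L - \<Delta>2 ** (L' - L))"
      by (simp only: matrix_mul_assoc matrix_inv_left[OF S] matrix_mul_lid)
    have nL: "norm L \<le> b"
    proof -
      have "norm P \<le> norm Z + 1" using P nn norm_triangle_ineq[of "P - Z" Z] by simp
      then have "norm Y * norm P \<le> norm Y * (norm Z + 1)" by (intro mult_left_mono) auto
      then have "\<rho> * norm (Y ** P) \<le> \<rho> * (norm Y * (norm Z + 1))"
        using norm_matrix_mult_le[of Y P] nn by (intro mult_left_mono) auto
      then show ?thesis
        using norm_matrix_mult_le[of "matrix_inv S" "Y ** P"] by (simp add: L_def b_def \<rho>_def mult.assoc)
    qed
    have "norm (L' - L) \<le> \<rho> * norm (\<Delta>1 - \<Delta>2 ** L - \<Delta>2 ** (L' - L))"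
      using norm_matrix_mult_le[of "matrix_inv S" "\<Delta>1 - \<Delta>2 ** L - \<Delta>2 ** (L' - L)"]
      by (simp add: eq[symmetric] \<rho>_def)
    also have "\<dots> \<le> \<rho> * (d + d * b + norm \<Delta>2 * norm (L' - L))"
    proof (rule mult_left_mono[OF _ nn(1)])
      have "norm (\<Delta>2 ** L) \<le> d * b"
        using norm_matrix_mult_le[of \<Delta>2 L] mult_mono[OF \<Delta>2 nL d0 norm_ge_zero] by linarith
      moreover have "norm (\<Delta>2 ** (L' - L)) \<le> norm \<Delta>2 * norm (L' - L)" by (rule norm_matrix_mult_le)
      moreover have "norm (\<Delta>1 - \<Delta>2 ** L - \<Delta>2 ** (L' - L)) \<le>
          norm \<Delta>1 + norm (\<Delta>2 ** L) + norm (\<Delta>2 ** (L' - L))"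
        using norm_triangle_ineq4[of "\<Delta>1 - \<Delta>2 ** L" "\<Delta>2 ** (L' - L)"] norm_triangle_ineq4[of \<Delta>1 "\<Delta>2 ** L"]
        by linarith
      ultimately show "norm (\<Delta>1 - \<Delta>2 ** L - \<Delta>2 ** (L' - L)) \<le> d + d * b + norm \<Delta>2 * norm (L' - L)"
        using \<Delta>1 by linarith
    qed
    also have "\<dots> = \<rho> * (1 + b) * d + (\<rho> * norm \<Delta>2) * norm (L' - L)" by (simp add: algebra_simps)
    also have "\<dots> \<le> \<rho> * (1 + b) * d + 1 / 2 * norm (L' - L)"
      by (intro add_left_mono mult_right_mono half) simp
    finally have 1: "norm (L' - L) \<le> 2 * \<rho> * (1 + b) * d" by simp
    have 2: "norm (L - matrix_inv S ** (Y ** Z)) \<le> \<rho> * norm Y * norm (P - Z)"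
    proof -
      have "L - matrix_inv S ** (Y ** Z) = matrix_inv S ** (Y ** (P - Z))"
        by (simp add: L_def matrix_distribs)
      then have "norm (L - matrix_inv S ** (Y ** Z)) \<le> \<rho> * norm (Y ** (P - Z))"
        using norm_matrix_mult_le[of "matrix_inv S" "Y ** (P - Z)"] by (simp add: \<rho>_def)
      also have "\<dots> \<le> \<rho> * (norm Y * norm (P - Z))" using nn by (intro mult_left_mono norm_matrix_mult_le)
      finally show ?thesis by (simp add: mult.assoc)
    qed
    have "norm (L' - matrix_inv S ** (Y ** Z)) \<le> 2 * \<rho> * (1 + b) * d + \<rho> * norm Y * norm (P - Z)"
      using norm_triangle_ineq[of "L' - L" "L - matrix_inv S ** (Y ** Z)"] 1 2 by simp
    also have "\<dots> \<le> \<kappa> * d + \<kappa> * norm (P - Z)"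
      using nn d0 by (intro add_mono mult_right_mono) (auto simp: \<kappa>_def)
    finally show "norm (matrix_inv (S + \<Delta>2) ** (Y ** P + \<Delta>1) - matrix_inv S ** (Y ** Z))
        \<le> \<kappa> * (norm (P - Z) + d)"
      by (simp add: L'_def algebra_simps)
  qed
  then show ?thesis using nn(3,4)
    by (intro exI[of _ \<kappa>] exI[of _ \<eta>] conjI allI impI; simp)
qed

definition spu_gain_L :: "real^('n::finite + 'm::finite + 'p::finite)^('n + 'm + 'p) \<Rightarrow> real^'n^'m" where
  "spu_gain_L Z = matrix_inv (block22 Z) ** block21 Z"

definition spu_gain_K :: "real^('n::finite + 'm::finite + 'p::finite)^('n + 'm + 'p) \<Rightarrow> real^'n^'p" where
  "spu_gain_K Z = matrix_inv (block33 Z) ** block31 Z"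

lemma scaled_identity_inverse:
  assumes "\<gamma> \<noteq> 0"
  shows "invertible (- (\<gamma>\<^sup>2 *\<^sub>R mat 1) :: real^'p^'p)"
    and "matrix_inv (- (\<gamma>\<^sup>2 *\<^sub>R mat 1) :: real^'p^'p) = - ((1 / \<gamma>\<^sup>2) *\<^sub>R mat 1)"
proof -
  let ?S = "- (\<gamma>\<^sup>2 *\<^sub>R mat 1) :: real^'p^'p" and ?T = "- ((1 / \<gamma>\<^sup>2) *\<^sub>R mat 1) :: real^'p^'p"
  have *: "?S ** ?T = mat 1" "?T ** ?S = mat 1" using assms by (simp_all add: matrix_distribs)
  then show inv: "invertible ?S" unfolding invertible_def by blast
  have "matrix_inv ?S = (?T ** ?S) ** matrix_inv ?S" unfolding *(2) by simp
  also have "\<dots> = ?T" by (simp only: matrix_mul_assoc[symmetric] matrix_inv_right[OF inv] matrix_mul_rid)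
  finally show "matrix_inv ?S = ?T" .
qed

lemma spu_gains_unperturbed:
  assumes "\<gamma> \<noteq> 0"
  shows "spu_gain_L (spu_matrix A A1 B E Q R \<gamma> P) = matrix_inv R ** (transpose B ** P)"
    and "spu_gain_K (spu_matrix A A1 B E Q R \<gamma> P) = - ((1 / \<gamma>\<^sup>2) *\<^sub>R (transpose E ** P))"
proof -
  have z: "block21 (0 :: real^('n::finite + 'm::finite + 'p::finite)^('n + 'm + 'p)) = 0"
    "block22 (0 :: real^('n::finite + 'm::finite + 'p::finite)^('n + 'm + 'p)) = 0"
    "block31 (0 :: real^('n::finite + 'm::finite + 'p::finite)^('n + 'm + 'p)) = 0"
    "block33 (0 :: real^('n::finite + 'm::finite + 'p::finite)^('n + 'm + 'p)) = 0"
    by (simp_all add: block21_def block22_def block31_def block33_def vec_eq_iff)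
  note b = blocks_perturbed_spu_matrix[where \<Delta> = 0, unfolded z add_0_right]
  show "spu_gain_L (spu_matrix A A1 B E Q R \<gamma> P) = matrix_inv R ** (transpose B ** P)"
    by (simp add: spu_gain_L_def b)
  show "spu_gain_K (spu_matrix A A1 B E Q R \<gamma> P) = - ((1 / \<gamma>\<^sup>2) *\<^sub>R (transpose E ** P))"
    by (simp add: spu_gain_K_def b scaled_identity_inverse[OF assms] matrix_distribs)
qed

text \<open>The gains are within a constant times \<open>\<parallel>P - Ps\<parallel> + \<parallel>\<Delta>\<parallel>\<close> of the gains at \<open>Ps\<close>. So the closed loop keeps half of
  the resolvent bound, and the completed squares bound the error quadratically.\<close>

lemma perturbed_newton_step:
  fixes A A1 Q Ps :: "real^'n^'n" and B :: "real^'m^'n" and E :: "real^'p^'n" and R :: "real^'m^'m"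
  assumes Ps: "symmetric Ps" and Q: "symmetric Q" and R: "invertible R" "symmetric R" and \<gamma>: "\<gamma> \<noteq> 0"
    and gare: "gare A A1 B E Q R \<gamma> Ps"
    and spec: "lyap_spectrum (closed_loop A B E R \<gamma> Ps) A1 \<subseteq> open_left_half_plane"
  shows "\<exists>c>0. \<exists>\<eta>>0. \<forall>P (\<Delta> :: real^('n + 'm + 'p)^('n + 'm + 'p)) Z. norm (P - Ps) \<le> \<eta> \<longrightarrow> norm \<Delta> \<le> \<eta> \<longrightarrow>
    Z = spu_matrix A A1 B E Q R \<gamma> P + \<Delta> \<longrightarrow>
    lyap_spectrum (A - B ** spu_gain_L Z - E ** spu_gain_K Z) A1 \<subseteq> open_left_half_plane \<and>
    invertible (block22 Z) \<and> invertible (block33 Z) \<and>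
    (\<exists>!X. spu_eval A A1 B E Q R \<gamma> (spu_gain_L Z) (spu_gain_K Z) X) \<and>
    (\<forall>X. spu_eval A A1 B E Q R \<gamma> (spu_gain_L Z) (spu_gain_K Z) X \<longrightarrow>
      norm (X - Ps) \<le> c * (norm (P - Ps) + norm \<Delta>)\<^sup>2)"
    (is "\<exists>c>0. \<exists>\<eta>>0. \<forall>P \<Delta> Z. _ \<longrightarrow> _ \<longrightarrow> _ \<longrightarrow> ?claim c P \<Delta> Z")
proof -
  define Ls where "Ls = matrix_inv R ** (transpose B ** Ps)"
  define Ks where "Ks = - ((1 / \<gamma>\<^sup>2) *\<^sub>R (transpose E ** Ps))"
  have Ks': "Ks = matrix_inv (- (\<gamma>\<^sup>2 *\<^sub>R mat 1)) ** (transpose E ** Ps)"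
    by (simp add: Ks_def scaled_identity_inverse[OF \<gamma>] matrix_distribs)
  define N where "N = closed_loop A B E R \<gamma> Ps"
  have N: "N = A - B ** Ls - E ** Ks"
    unfolding N_def by (rule newton_step_iff_spu_eval(1)[OF Ps R \<gamma> Ls_def Ks_def])
  obtain r where r: "0 < r" "resolvent_bound r N A1" using ex_resolvent_bound[OF spec] by (auto simp: N_def)
  obtain \<kappa>1 \<eta>1 where k1': "\<forall>P \<Delta>2 \<Delta>1 d. norm (P - Ps) \<le> \<eta>1 \<longrightarrow> norm \<Delta>2 \<le> d \<longrightarrow>
      norm \<Delta>1 \<le> d \<longrightarrow> d \<le> \<eta>1 \<longrightarrow> invertible (R + \<Delta>2) \<and>
      norm (matrix_inv (R + \<Delta>2) ** (transpose B ** P + \<Delta>1) - Ls) \<le> \<kappa>1 * (norm (P - Ps) + d)"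
    and k1: "0 < \<kappa>1" "0 < \<eta>1"
    using perturbed_gain[OF R(1), of Ps "transpose B", folded Ls_def] by (elim exE conjE) (rule that; assumption)
  obtain \<kappa>2 \<eta>2 where k2': "\<forall>P \<Delta>2 \<Delta>1 d. norm (P - Ps) \<le> \<eta>2 \<longrightarrow> norm \<Delta>2 \<le> d \<longrightarrow>
      norm \<Delta>1 \<le> d \<longrightarrow> d \<le> \<eta>2 \<longrightarrow> invertible (- (\<gamma>\<^sup>2 *\<^sub>R mat 1) + \<Delta>2) \<and>
      norm (matrix_inv (- (\<gamma>\<^sup>2 *\<^sub>R mat 1) + \<Delta>2) ** (transpose E ** P + \<Delta>1) - Ks) \<le> \<kappa>2 * (norm (P - Ps) + d)"
    and k2: "0 < \<kappa>2" "0 < \<eta>2"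
    using perturbed_gain[OF scaled_identity_inverse(1)[OF \<gamma>], of Ps "transpose E", folded Ks'] by (elim exE conjE) (rule that; assumption)
  define k where "k = norm B * \<kappa>1 + norm E * \<kappa>2 + 1"
  have k: "0 < k" using k1 k2 by (simp add: k_def add_nonneg_pos)
  \<comment> \<open>The closed loop matrix moves by at most \<open>2 k \<eta> \<le> r / 4\<close>, which costs at most half of the resolvent bound \<open>r\<close>.\<close>
  define \<eta> where "\<eta> = min (min \<eta>1 \<eta>2) (r / (8 * k))"
  have \<eta>: "0 < \<eta>" "\<eta> \<le> \<eta>1" "\<eta> \<le> \<eta>2" "k * \<eta> \<le> r / 8"
  proof -
    show "0 < \<eta>" using k1 k2 k r by (simp add: \<eta>_def)
    have "k * \<eta> \<le> k * (r / (8 * k))" using k by (intro mult_left_mono) (auto simp: \<eta>_def)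
    then show "k * \<eta> \<le> r / 8" using k by simp
  qed (auto simp: \<eta>_def)
  define q where "q = norm R * \<kappa>1\<^sup>2 + \<gamma>\<^sup>2 * \<kappa>2\<^sup>2"
  define c where "c = 2 * q / r + 1"
  have c: "0 < c" using r by (auto simp: c_def q_def intro!: add_nonneg_pos)
  have "?claim c P \<Delta> Z"
    if P: "norm (P - Ps) \<le> \<eta>" and \<Delta>: "norm \<Delta> \<le> \<eta>" and Z: "Z = spu_matrix A A1 B E Q R \<gamma> P + \<Delta>"
    for P and \<Delta> Z :: "real^('n + 'm + 'p)^('n + 'm + 'p)"
  proof -
    define s where "s = norm (P - Ps) + norm \<Delta>"
    have s: "0 \<le> s" "s \<le> 2 * \<eta>" using P \<Delta> by (auto simp: s_def)
    define L where "L = spu_gain_L Z"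
    define K where "K = spu_gain_K Z"
    note blocks = blocks_perturbed_spu_matrix[of A A1 B E Q R \<gamma> P \<Delta>, folded Z]
    have L: "invertible (block22 Z)" "norm (L - Ls) \<le> \<kappa>1 * s"
      using k1'[rule_format, of P "block22 \<Delta>" "norm \<Delta>" "block21 \<Delta>"] P \<Delta> \<eta> norm_block_le[of \<Delta>]
      by (auto simp: L_def spu_gain_L_def blocks s_def)
    have K: "invertible (block33 Z)" "norm (K - Ks) \<le> \<kappa>2 * s"
      using k2'[rule_format, of P "block33 \<Delta>" "norm \<Delta>" "block31 \<Delta>"] P \<Delta> \<eta> norm_block_le[of \<Delta>]
      by (auto simp: K_def spu_gain_K_def blocks s_def)
    define N' where "N' = A - B ** L - E ** K"
    have "norm (N' - N) \<le> k * s"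
    proof -
      have "N' - N = - (B ** (L - Ls)) - E ** (K - Ks)" by (simp add: N'_def N matrix_distribs)
      then have "norm (N' - N) \<le> norm (B ** (L - Ls)) + norm (E ** (K - Ks))"
        using norm_triangle_ineq4[of "- (B ** (L - Ls))" "E ** (K - Ks)"] by simp
      also have "\<dots> \<le> norm B * (\<kappa>1 * s) + norm E * (\<kappa>2 * s)"
        using L(2) K(2) by (intro add_mono order_trans[OF norm_matrix_mult_le] mult_left_mono) auto
      also have "\<dots> \<le> k * s" using s(1) by (simp add: k_def algebra_simps)
      finally show ?thesis .
    qed
    also have "k * s \<le> k * (2 * \<eta>)" by (rule mult_left_mono[OF s(2)]) (use k in simp)
    also have "\<dots> \<le> r / 4" using \<eta>(4) by linarith
    finally have half: "r / 2 \<le> r - 2 * norm (N' - N)" by simp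
    note rb = resolvent_bound_perturb[OF r(2), of N']
    have pos: "0 < r - 2 * norm (N' - N)" using half r(1) by linarith
    have sym: "symmetric (- (Q + transpose L ** R ** L - \<gamma>\<^sup>2 *\<^sub>R (transpose K ** K)))"
      using Q R(2) by (simp add: symmetric_def matrix_distribs matrix_transpose_mul matrix_mul_assoc)
    have ex1: "\<exists>!X. spu_eval A A1 B E Q R \<gamma> L K X"
      unfolding spu_eval_iff N'_def[symmetric] by (rule ex1_lyap_equation[OF rb pos sym])
    have "norm (X - Ps) \<le> c * s\<^sup>2" if X: "spu_eval A A1 B E Q R \<gamma> L K X" for X
    proof -
      have X': "symmetric X" "lyap N' A1 X = - (Q + transpose L ** R ** L - \<gamma>\<^sup>2 *\<^sub>R (transpose K ** K))"
        using X by (auto simp: spu_eval_iff N'_def)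
      have "lyap N' A1 (X - Ps) =
          - (transpose (L - Ls) ** R ** (L - Ls) - \<gamma>\<^sup>2 *\<^sub>R (transpose (K - Ks) ** (K - Ks)))"
        unfolding lyap_diff X'(2)
        using lyap_completed_square[OF Ps R \<gamma> gare Ls_def Ks_def, of L K] by (simp add: N'_def)
      then have "norm (lyap N' A1 (X - Ps)) =
          norm (transpose (L - Ls) ** R ** (L - Ls) - \<gamma>\<^sup>2 *\<^sub>R (transpose (K - Ks) ** (K - Ks)))"
        by (simp only: norm_minus_cancel)
      then have "norm (lyap N' A1 (X - Ps)) \<le> norm (transpose (L - Ls) ** R ** (L - Ls))
          + \<gamma>\<^sup>2 * norm (transpose (K - Ks) ** (K - Ks))"
        using norm_triangle_ineq4[of "transpose (L - Ls) ** R ** (L - Ls)"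
            "\<gamma>\<^sup>2 *\<^sub>R (transpose (K - Ks) ** (K - Ks))"] by simp
      moreover have "norm (transpose (L - Ls) ** R ** (L - Ls)) \<le> norm R * (norm (L - Ls))\<^sup>2"
        using norm_matrix_mult_le[of "transpose (L - Ls) ** R" "L - Ls"]
          mult_right_mono[OF norm_matrix_mult_le[of "transpose (L - Ls)" R] norm_ge_zero[of "L - Ls"]]
        by (simp add: norm_transpose power2_eq_square mult_ac)
      moreover have "\<gamma>\<^sup>2 * norm (transpose (K - Ks) ** (K - Ks)) \<le> \<gamma>\<^sup>2 * (norm (K - Ks))\<^sup>2"
        using norm_matrix_mult_le[of "transpose (K - Ks)" "K - Ks"]
        by (intro mult_left_mono) (simp_all add: norm_transpose power2_eq_square)
      moreover have "norm R * (norm (L - Ls))\<^sup>2 + \<gamma>\<^sup>2 * (norm (K - Ks))\<^sup>2 \<le>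
          norm R * (\<kappa>1 * s)\<^sup>2 + \<gamma>\<^sup>2 * (\<kappa>2 * s)\<^sup>2"
        using L(2) K(2) by (intro add_mono mult_left_mono power_mono) auto
      moreover have "norm R * (\<kappa>1 * s)\<^sup>2 + \<gamma>\<^sup>2 * (\<kappa>2 * s)\<^sup>2 = q * s\<^sup>2"
        by (simp add: q_def power_mult_distrib algebra_simps)
      ultimately have le: "norm (lyap N' A1 (X - Ps)) \<le> q * s\<^sup>2" by linarith
      have "r / 2 * norm (X - Ps) \<le> (r - 2 * norm (N' - N)) * norm (X - Ps)"
        by (intro mult_right_mono half) simp
      also have "\<dots> \<le> norm (lyap N' A1 (X - Ps))"
        by (rule resolvent_bound_real[OF rb symmetric_diff[OF X'(1) Ps]])
      also note le
      finally have "norm (X - Ps) \<le> 2 * q / r * s\<^sup>2" using r(1) by (simp add: field_simps)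
      also have "\<dots> \<le> c * s\<^sup>2" by (intro mult_right_mono) (auto simp: c_def)
      finally show ?thesis .
    qed
    then show ?thesis
      using L(1) K(1) ex1 resolvent_bound_spectrum[OF rb pos]
      unfolding N'_def L_def K_def s_def by (intro conjI allI impI)
  qed
  then show ?thesis using c \<eta>(1)
    by (intro exI[of _ c] conjI exI[of _ \<eta>] allI impI; simp only:)
qed

lemma geometric_input_bound:
  fixes e d :: "nat \<Rightarrow> real"
  assumes q: "0 \<le> q" "q < 1" and k: "0 \<le> k" and s: "0 \<le> s"
    and step: "\<And>i. e (Suc i) \<le> q * e i + k * d i" and d: "\<And>i. d i \<le> s"
  shows "e i \<le> q ^ i * e 0 + k / (1 - q) * s"
proof (induction i)
  case 0
  then show ?case using q k s by simp
next
  case (Suc i)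
  have "e (Suc i) \<le> q * (q ^ i * e 0 + k / (1 - q) * s) + k * s"
    using step[of i] mult_left_mono[OF Suc q(1)] mult_left_mono[OF d[of i] k] by linarith
  also have "\<dots> = q ^ Suc i * e 0 + (q * (k / (1 - q)) + k) * s" by (simp add: algebra_simps)
  also have "q * (k / (1 - q)) + k = k / (1 - q)" using q by (simp add: field_simps)
  finally show ?case .
qed

text \<open>Apply the geometric bound from a time after which the input is small.\<close>

lemma geometric_input_tendsto_0:
  fixes e d :: "nat \<Rightarrow> real"
  assumes q: "0 \<le> q" "q < 1" and k: "0 \<le> k" and e: "\<And>i. 0 \<le> e i"
    and step: "\<And>i. e (Suc i) \<le> q * e i + k * d i" and d: "d \<longlonglongrightarrow> 0"
  shows "e \<longlonglongrightarrow> 0"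
proof (rule LIMSEQ_I)
  fix r :: real assume r: "0 < r"
  define s where "s = r * (1 - q) / (2 * (k + 1))"
  have s: "0 < s" using r q k by (simp add: s_def)
  have ks: "k / (1 - q) * s \<le> r / 2"
  proof -
    have "k / w * (r * w / (2 * (k + 1))) = r / 2 * (k / (k + 1))" if "0 < w" for w
      using that k by (simp add: field_simps)
    from this[of "1 - q"] have "k / (1 - q) * s = r / 2 * (k / (k + 1))" using q by (simp add: s_def)
    also have "\<dots> \<le> r / 2 * 1" using r k by (intro mult_left_mono) (auto simp: field_simps)
    finally show ?thesis by simp
  qed
  obtain n where n: "\<And>i. n \<le> i \<Longrightarrow> d i \<le> s"
    using order_tendstoD(2)[OF d s] unfolding eventually_sequentially using less_imp_le by blast
  have tail: "e (i + n) \<le> q ^ i * e n + r / 2" for i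
  proof -
    have "e (i + n) \<le> q ^ i * e (0 + n) + k / (1 - q) * s"
      by (rule geometric_input_bound[where d = "\<lambda>i. d (i + n)"]) (use q k s n step in auto)
    then show ?thesis using ks unfolding add_0 by linarith
  qed
  have "(\<lambda>i. q ^ i * e n) \<longlonglongrightarrow> 0 * e n"
    using q by (intro tendsto_mult tendsto_const LIMSEQ_realpow_zero) auto
  then have "\<forall>\<^sub>F i in sequentially. q ^ i * e n < r / 2" using r by (intro order_tendstoD(2)) auto
  then obtain m where m: "\<And>i. m \<le> i \<Longrightarrow> q ^ i * e n < r / 2" unfolding eventually_sequentially by blast
  have "e i < r" if "m + n \<le> i" for i
  proof -
    have i: "i - n + n = i" "m \<le> i - n" using that by auto
    show ?thesis using tail[of "i - n"] m[OF i(2)] unfolding i(1) by linarith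
  qed
  then show "\<exists>no. \<forall>n\<ge>no. norm (e n - 0) < r" using e by (intro exI[of _ "m + n"]) simp
qed

lemma gram_invertible:
  fixes D :: "real^'m^'r"
  assumes "rank D = CARD('m)"
  shows "invertible (transpose D ** D)"
proof -
  have "x = 0" if "(transpose D ** D) *v x = 0" for x
  proof -
    have "(D *v x) \<bullet> (D *v x) = x \<bullet> ((transpose D ** D) *v x)"
      using dot_lmul_matrix[of "D *v x" D x] by (simp add: matrix_vector_mul_assoc[symmetric] inner_commute)
    then have "D *v x = 0" using that by simp
    moreover have "inj ((*v) D)" using assms by (simp add: full_rank_injective)
    ultimately show "x = 0" using injD[of "(*v) D" x 0] by simp
  qed
  then show ?thesis unfolding invertible_left_inverse matrix_left_invertible_ker by blast
qed

section \<open>The perturbed iteration\<close>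

text \<open>As \<open>\<Delta> 0 = 0\<close>, the initial gains are computed from the initial matrix by the same formula as all later
  ones, and all steps of the iteration have the same form.\<close>

lemma robust_spu_gains:
  assumes \<gamma>: "\<gamma> \<noteq> 0" and \<Delta>0: "\<Delta> 0 = 0"
  shows "robust_spu A A1 B E Q R \<gamma> P0 \<Delta> P L K Mh \<longleftrightarrow>
    P 0 = P0 \<and> (\<forall>i. Mh i = spu_matrix A A1 B E Q R \<gamma> (P i) + \<Delta> i \<and>
      L i = spu_gain_L (Mh i) \<and> K i = spu_gain_K (Mh i) \<and>
      spu_eval A A1 B E Q R \<gamma> (L i) (K i) (P (Suc i)))"
    (is "?lhs \<longleftrightarrow> ?rhs")
proof
  note g0 = spu_gains_unperturbed[OF \<gamma>]
  assume H: ?lhs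
  have "Mh i = spu_matrix A A1 B E Q R \<gamma> (P i) + \<Delta> i \<and>
      L i = spu_gain_L (Mh i) \<and> K i = spu_gain_K (Mh i)" for i
    using H \<Delta>0 by (cases i) (simp_all add: robust_spu_def g0 matrix_mul_assoc spu_gain_L_def[symmetric]
        spu_gain_K_def[symmetric])
  then show ?rhs using H by (simp add: robust_spu_def)
next
  note g0 = spu_gains_unperturbed[OF \<gamma>]
  assume H: ?rhs
  then have P: "P 0 = P0" and Mh: "\<And>i. Mh i = spu_matrix A A1 B E Q R \<gamma> (P i) + \<Delta> i"
    and L: "\<And>i. L i = spu_gain_L (Mh i)" and K: "\<And>i. K i = spu_gain_K (Mh i)"
    and ev: "\<And>i. spu_eval A A1 B E Q R \<gamma> (L i) (K i) (P (Suc i))" by blast+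
  have Mh0: "Mh 0 = spu_matrix A A1 B E Q R \<gamma> P0" using Mh[of 0] P \<Delta>0 by simp
  have "L 0 = matrix_inv R ** transpose B ** P0" "K 0 = - ((1 / \<gamma>\<^sup>2) *\<^sub>R (transpose E ** P0))"
    using L[of 0] K[of 0] by (simp_all add: Mh0 g0 matrix_mul_assoc)
  with P Mh0 show ?lhs
    unfolding robust_spu_def
    using ev Mh L[unfolded spu_gain_L_def] K[unfolded spu_gain_K_def] by (intro conjI allI)
qed

text \<open>The deterministic half of the theorem, with the spectral condition in place of mean square stability.
  The radius is chosen such that the quadratic error bound, after \<open>(e + d)\<^sup>2 \<le> 2 e\<^sup>2 + 2 d\<^sup>2\<close>, becomes
  \<open>\<epsilon>0 e + k3 d\<close>; the bound on the perturbations is chosen such that this is again at most the radius.\<close>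

theorem robust_spu_convergence:
  fixes A A1 Q Ps :: "real^'n^'n" and B :: "real^'m^'n" and E :: "real^'p^'n" and R :: "real^'m^'m"
  assumes Ps: "symmetric Ps" and Q: "symmetric Q" and R: "invertible R" "symmetric R" and \<gamma>: "\<gamma> \<noteq> 0"
    and gare: "gare A A1 B E Q R \<gamma> Ps"
    and spec: "lyap_spectrum (closed_loop A B E R \<gamma> Ps) A1 \<subseteq> open_left_half_plane"
    and \<epsilon>: "0 < \<epsilon>0" "\<epsilon>0 < 1"
  shows "\<exists>\<delta>0>0.
      (\<exists>k0>0. \<forall>P \<in> psd_ball Ps \<delta>0.
        lyap_spectrum (closed_loop A B E R \<gamma> P) A1 \<subseteq> open_left_half_plane \<and>
        (\<exists>!X. newton_step A A1 B E Q R \<gamma> P X) \<and>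
        (\<forall>X. newton_step A A1 B E Q R \<gamma> P X \<longrightarrow>
          norm (X - Ps) \<le> k0 * (norm (P - Ps))\<^sup>2 \<and>
          norm (X - Ps) \<le> \<epsilon>0 * norm (P - Ps))) \<and>
      (\<exists>\<delta>1>0. \<exists>k3>0. \<forall>P0 (\<Delta> :: nat \<Rightarrow> real^('n + 'm + 'p)^('n + 'm + 'p)).
        P0 \<in> psd_ball Ps \<delta>0 \<and>
        (\<forall>i. symmetric (\<Delta> i)) \<and> \<Delta> 0 = 0 \<and>
        bdd_above (range (\<lambda>i. norm (\<Delta> i))) \<and> (SUP i. norm (\<Delta> i)) < \<delta>1 \<longrightarrow>
        (\<exists>P L K Mh. robust_spu A A1 B E Q R \<gamma> P0 \<Delta> P L K Mh) \<and>
        (\<forall>P L K Mh. robust_spu A A1 B E Q R \<gamma> P0 \<Delta> P L K Mh \<longrightarrow>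
          (\<forall>i. lyap_spectrum (A - B ** L i - E ** K i) A1 \<subseteq> open_left_half_plane \<and>
            invertible (block22 (Mh i)) \<and> invertible (block33 (Mh i)) \<and>
            (\<exists>!X. spu_eval A A1 B E Q R \<gamma> (L i) (K i) X)) \<and>
          (\<forall>i. norm (P i - Ps) \<le>
            \<epsilon>0 ^ i * norm (P0 - Ps) + k3 / (1 - \<epsilon>0) * (SUP j. norm (\<Delta> j))) \<and>
          ((\<lambda>i. norm (\<Delta> i)) \<longlonglongrightarrow> 0 \<longrightarrow> (\<lambda>i. norm (P i - Ps)) \<longlonglongrightarrow> 0)))"
proof -
  let ?M = "spu_matrix A A1 B E Q R \<gamma> :: _ \<Rightarrow> real^('n + 'm + 'p)^('n + 'm + 'p)"
  let ?eval = "spu_eval A A1 B E Q R \<gamma>"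
  obtain c \<eta> where step': "\<forall>P (\<Delta> :: real^('n + 'm + 'p)^('n + 'm + 'p)) Z. norm (P - Ps) \<le> \<eta> \<longrightarrow>
    norm \<Delta> \<le> \<eta> \<longrightarrow> Z = spu_matrix A A1 B E Q R \<gamma> P + \<Delta> \<longrightarrow>
    lyap_spectrum (A - B ** spu_gain_L Z - E ** spu_gain_K Z) A1 \<subseteq> open_left_half_plane \<and>
    invertible (block22 Z) \<and> invertible (block33 Z) \<and>
    (\<exists>!X. spu_eval A A1 B E Q R \<gamma> (spu_gain_L Z) (spu_gain_K Z) X) \<and>
    (\<forall>X. spu_eval A A1 B E Q R \<gamma> (spu_gain_L Z) (spu_gain_K Z) X \<longrightarrow>
      norm (X - Ps) \<le> c * (norm (P - Ps) + norm \<Delta>)\<^sup>2)"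
    and c: "0 < c" and \<eta>: "0 < \<eta>"
    using perturbed_newton_step[OF Ps Q R \<gamma> gare spec] by (elim exE conjE) (rule that; assumption)
  define \<delta>0 where "\<delta>0 = min \<eta> (\<epsilon>0 / (2 * c))"
  define k3 where "k3 = 2 * c"
  define \<delta>1 where "\<delta>1 = min (min \<eta> 1) ((1 - \<epsilon>0) * \<delta>0 / k3)"
  have \<delta>0: "0 < \<delta>0" "\<delta>0 \<le> \<eta>" "2 * c * \<delta>0 \<le> \<epsilon>0"
  proof -
    show "0 < \<delta>0" using \<eta> c \<epsilon> by (simp add: \<delta>0_def)
    have "2 * c * \<delta>0 \<le> 2 * c * (\<epsilon>0 / (2 * c))"
      by (rule mult_left_mono) (use c in \<open>simp_all add: \<delta>0_def\<close>)
    then show "2 * c * \<delta>0 \<le> \<epsilon>0" using c by simp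
  qed (simp add: \<delta>0_def)
  have k3: "0 < k3" using c by (simp add: k3_def)
  have \<delta>1: "0 < \<delta>1" "\<delta>1 \<le> \<eta>" "\<delta>1 \<le> 1" "k3 * \<delta>1 \<le> (1 - \<epsilon>0) * \<delta>0"
  proof -
    show "0 < \<delta>1" using \<eta> \<epsilon> \<delta>0(1) k3 by (simp add: \<delta>1_def)
    have "k3 * \<delta>1 \<le> k3 * ((1 - \<epsilon>0) * \<delta>0 / k3)"
      by (rule mult_left_mono) (use k3 in \<open>simp_all add: \<delta>1_def\<close>)
    then show "k3 * \<delta>1 \<le> (1 - \<epsilon>0) * \<delta>0" using k3 by simp
  qed (simp_all add: \<delta>1_def)
  have quad: "c * e\<^sup>2 \<le> \<epsilon>0 / 2 * e" if "0 \<le> e" "e \<le> \<delta>0" for e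
  proof -
    have "c * e \<le> c * \<delta>0" using that c by (intro mult_left_mono) auto
    then have "c * e \<le> \<epsilon>0 / 2" using \<delta>0(3) by linarith
    then have "c * e * e \<le> \<epsilon>0 / 2 * e" using that(1) by (rule mult_right_mono)
    then show ?thesis by (simp add: power2_eq_square mult.assoc)
  qed

  have newton: "lyap_spectrum (closed_loop A B E R \<gamma> P) A1 \<subseteq> open_left_half_plane \<and>
        (\<exists>!X. newton_step A A1 B E Q R \<gamma> P X) \<and>
        (\<forall>X. newton_step A A1 B E Q R \<gamma> P X \<longrightarrow>
          norm (X - Ps) \<le> c * (norm (P - Ps))\<^sup>2 \<and> norm (X - Ps) \<le> \<epsilon>0 * norm (P - Ps))"
    if "P \<in> psd_ball Ps \<delta>0" for P
  proof -
    have P: "symmetric P" "norm (P - Ps) \<le> \<delta>0" using that by (auto simp: psd_ball_def psd_def)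
    note g = spu_gains_unperturbed[OF \<gamma>, where A = A and ?A1.0 = A1 and B = B and E = E and Q = Q and R = R and P = P]
    note n = newton_step_iff_spu_eval(1)[OF P(1) R \<gamma> g, of A] newton_step_iff_spu_eval(2)[OF P(1) R \<gamma> g, of A A1 Q]
    have "norm (P - Ps) \<le> \<eta>" "norm (0 :: real^('n + 'm + 'p)^('n + 'm + 'p)) \<le> \<eta>"
      using P(2) \<delta>0(2) \<eta> by auto
    note s = step'[rule_format, OF this refl, unfolded add_0_right norm_zero]
    have "c * (norm (P - Ps))\<^sup>2 \<le> \<epsilon>0 * norm (P - Ps)"
      using quad[OF norm_ge_zero P(2)] mult_nonneg_nonneg[OF less_imp_le[OF \<epsilon>(1)] norm_ge_zero[of "P - Ps"]]
      by linarith
    then show ?thesis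
      using s unfolding n[symmetric] by (auto intro: order_trans)
  qed

  have iter: "(\<exists>P L K Mh. robust_spu A A1 B E Q R \<gamma> P0 \<Delta> P L K Mh) \<and>
        (\<forall>P L K Mh. robust_spu A A1 B E Q R \<gamma> P0 \<Delta> P L K Mh \<longrightarrow>
          (\<forall>i. lyap_spectrum (A - B ** L i - E ** K i) A1 \<subseteq> open_left_half_plane \<and>
            invertible (block22 (Mh i)) \<and> invertible (block33 (Mh i)) \<and>
            (\<exists>!X. spu_eval A A1 B E Q R \<gamma> (L i) (K i) X)) \<and>
          (\<forall>i. norm (P i - Ps) \<le>
            \<epsilon>0 ^ i * norm (P0 - Ps) + k3 / (1 - \<epsilon>0) * (SUP j. norm (\<Delta> j))) \<and>
          ((\<lambda>i. norm (\<Delta> i)) \<longlonglongrightarrow> 0 \<longrightarrow> (\<lambda>i. norm (P i - Ps)) \<longlonglongrightarrow> 0))"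
    (is "_ \<and> (\<forall>P L K Mh. _ \<longrightarrow> ?good P L K Mh)")
    if P0: "P0 \<in> psd_ball Ps \<delta>0" and \<Delta>0: "\<Delta> 0 = 0"
      and bdd: "bdd_above (range (\<lambda>i. norm (\<Delta> i)))" and sup: "(SUP i. norm (\<Delta> i)) < \<delta>1"
    for P0 and \<Delta> :: "nat \<Rightarrow> real^('n + 'm + 'p)^('n + 'm + 'p)"
  proof -
    have \<Delta>_sup: "norm (\<Delta> i) \<le> (SUP i. norm (\<Delta> i))" for i by (rule cSUP_upper[OF UNIV_I bdd])
    then have \<Delta>_le: "norm (\<Delta> i) \<le> \<delta>1" for i using sup by (meson less_imp_le order_trans)
    \<comment> \<open>One step from a point of the ball is well defined and leads back into the ball.\<close>
    have one: "lyap_spectrum (A - B ** spu_gain_L Z - E ** spu_gain_K Z) A1 \<subseteq> open_left_half_plane"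
      "invertible (block22 Z)" "invertible (block33 Z)"
      "\<exists>!X. ?eval (spu_gain_L Z) (spu_gain_K Z) X"
      "\<And>X. ?eval (spu_gain_L Z) (spu_gain_K Z) X \<Longrightarrow>
        norm (X - Ps) \<le> \<epsilon>0 * norm (P - Ps) + k3 * norm (\<Delta> i) \<and> norm (X - Ps) \<le> \<delta>0"
      if P: "norm (P - Ps) \<le> \<delta>0" and Z: "Z = ?M P + \<Delta> i" for P Z i
    proof -
      have "norm (P - Ps) \<le> \<eta>" "norm (\<Delta> i) \<le> \<eta>"
        using P \<delta>0(2) \<delta>1(2) \<Delta>_le[of i] by auto
      note s = step'[rule_format, OF this Z]
      show "lyap_spectrum (A - B ** spu_gain_L Z - E ** spu_gain_K Z) A1 \<subseteq> open_left_half_plane"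
        "invertible (block22 Z)" "invertible (block33 Z)"
        "\<exists>!X. ?eval (spu_gain_L Z) (spu_gain_K Z) X"
        using s by (simp_all only:)
      fix X assume "?eval (spu_gain_L Z) (spu_gain_K Z) X"
      then have "norm (X - Ps) \<le> c * (norm (P - Ps) + norm (\<Delta> i))\<^sup>2" using s by simp
      also have "\<dots> \<le> c * (2 * (norm (P - Ps))\<^sup>2 + 2 * (norm (\<Delta> i))\<^sup>2)"
        using c sum_squares_bound[of "norm (P - Ps)" "norm (\<Delta> i)"]
        by (intro mult_left_mono) (auto simp: power2_sum)
      also have "\<dots> = 2 * (c * (norm (P - Ps))\<^sup>2) + k3 * (norm (\<Delta> i))\<^sup>2" by (simp add: k3_def algebra_simps)
      also have "2 * (c * (norm (P - Ps))\<^sup>2) \<le> \<epsilon>0 * norm (P - Ps)"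
        using quad[OF norm_ge_zero P] by simp
      also have "k3 * (norm (\<Delta> i))\<^sup>2 \<le> k3 * norm (\<Delta> i)"
        using k3 mult_left_mono[of "norm (\<Delta> i)" 1 "norm (\<Delta> i)"] \<Delta>_le[of i] \<delta>1(3)
        by (intro mult_left_mono) (auto simp: power2_eq_square)
      finally have 1: "norm (X - Ps) \<le> \<epsilon>0 * norm (P - Ps) + k3 * norm (\<Delta> i)" by simp
      have "\<epsilon>0 * norm (P - Ps) \<le> \<epsilon>0 * \<delta>0" by (rule mult_left_mono[OF P]) (use \<epsilon> in simp)
      moreover have "k3 * norm (\<Delta> i) \<le> (1 - \<epsilon>0) * \<delta>0"
        using mult_left_mono[OF \<Delta>_le[of i], of k3] k3 \<delta>1(4) by linarith
      ultimately have "norm (X - Ps) \<le> \<delta>0" using 1 by (simp add: algebra_simps)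
      with 1 show "norm (X - Ps) \<le> \<epsilon>0 * norm (P - Ps) + k3 * norm (\<Delta> i) \<and> norm (X - Ps) \<le> \<delta>0" ..
    qed
    have P0b: "norm (P0 - Ps) \<le> \<delta>0" using P0 by (simp add: psd_ball_def)
    note rs = robust_spu_gains[where \<gamma> = \<gamma> and \<Delta> = \<Delta>, OF \<gamma> \<Delta>0, of A A1 B E Q R P0]
    define G where "G i p = ?M p + \<Delta> i" for i p
    \<comment> \<open>The choice is a solution as long as the iterates stay in the ball, which the induction shows along the way.\<close>
    define P where "P = rec_nat P0 (\<lambda>i p. SOME X. ?eval (spu_gain_L (G i p)) (spu_gain_K (G i p)) X)"
    have P_0: "P 0 = P0" and P_Suc: "P (Suc i) = (SOME X. ?eval (spu_gain_L (G i (P i))) (spu_gain_K (G i (P i))) X)" for i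
      by (simp_all add: P_def)
    have P_inv: "norm (P i - Ps) \<le> \<delta>0 \<and> ?eval (spu_gain_L (G i (P i))) (spu_gain_K (G i (P i))) (P (Suc i))" for i
    proof (induction i)
      case 0
      have "norm (P 0 - Ps) \<le> \<delta>0" using P0b by (simp add: P_0)
      then show ?case unfolding P_Suc using someI_ex[OF ex1_implies_ex[OF one(4)[OF _ G_def]]] by blast
    next
      case (Suc i)
      then have "norm (P (Suc i) - Ps) \<le> \<delta>0" using one(5)[OF _ G_def, of "P i" i "P (Suc i)"] by blast
      then show ?case
        unfolding P_Suc[of "Suc i"] using someI_ex[OF ex1_implies_ex[OF one(4)[OF _ G_def]]] by blast
    qed
    have ex: "robust_spu A A1 B E Q R \<gamma> P0 \<Delta> P (\<lambda>i. spu_gain_L (G i (P i))) (\<lambda>i. spu_gain_K (G i (P i)))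
        (\<lambda>i. G i (P i))"
      unfolding rs using P_0 P_inv by (auto simp: G_def)
    have all: "?good P L K Mh"
      if H: "robust_spu A A1 B E Q R \<gamma> P0 \<Delta> P L K Mh" for P L K Mh
    proof -
      have H0: "P 0 = P0" and Z: "\<And>i. Mh i = ?M (P i) + \<Delta> i" and LK: "\<And>i. L i = spu_gain_L (Mh i)"
        "\<And>i. K i = spu_gain_K (Mh i)" and ev: "\<And>i. ?eval (L i) (K i) (P (Suc i))"
        using H unfolding rs by blast+
      have ball: "norm (P i - Ps) \<le> \<delta>0" for i
      proof (induction i)
        case (Suc i)
        show ?case using one(5)[OF Suc Z] ev[of i] unfolding LK by simp
      qed (simp add: H0 P0b)
      have rec: "norm (P (Suc i) - Ps) \<le> \<epsilon>0 * norm (P i - Ps) + k3 * norm (\<Delta> i)" for i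
        using one(5)[OF ball Z, of i "P (Suc i)"] ev[of i] unfolding LK by simp
      have \<epsilon>': "0 \<le> \<epsilon>0" "0 \<le> k3" using \<epsilon> k3 by auto
      have s0: "0 \<le> (SUP j. norm (\<Delta> j))" using \<Delta>_sup[of 0] by (rule order_trans[OF norm_ge_zero])
      have "norm (P i - Ps) \<le> \<epsilon>0 ^ i * norm (P0 - Ps) + k3 / (1 - \<epsilon>0) * (SUP j. norm (\<Delta> j))" for i
        using geometric_input_bound[OF \<epsilon>'(1) \<epsilon>(2) \<epsilon>'(2) s0, of "\<lambda>i. norm (P i - Ps)", OF rec \<Delta>_sup, of i]
        by (simp only: H0)
      moreover have "(\<lambda>i. norm (P i - Ps)) \<longlonglongrightarrow> 0" if "(\<lambda>i. norm (\<Delta> i)) \<longlonglongrightarrow> 0"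
        by (rule geometric_input_tendsto_0[OF \<epsilon>'(1) \<epsilon>(2) \<epsilon>'(2) norm_ge_zero rec that])
      ultimately show ?thesis
        using one(1-4)[OF ball Z] unfolding LK by simp
    qed
    show ?thesis using ex all by blast
  qed
  show ?thesis
    by (rule exI[of _ \<delta>0], rule conjI[OF \<delta>0(1)], rule conjI,
        rule exI[of _ c], rule conjI[OF c], rule ballI, erule newton,
        rule exI[of _ \<delta>1], rule conjI[OF \<delta>1(1)], rule exI[of _ k3], rule conjI[OF k3],
        intro allI impI, elim conjE, rule iter, assumption+)
qed

theorem theorem4:
  fixes M :: "'w measure" and \<F> :: "real \<Rightarrow> 'w measure" and W :: "real \<Rightarrow> 'w \<Rightarrow> real"
    and A A1 Q Ps :: "real^'n^'n" and B :: "real^'m^'n" and E :: "real^'p^'n"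
    and C :: "real^'n^'q" and D :: "real^'m^'r" and R :: "real^'m^'m" and \<gamma> :: real
  assumes BM: "brownian_motion M \<F> W"
    and D_rank: "rank D = CARD('m)"
    and Q: "Q = transpose C ** C"
    and R: "R = transpose D ** D"
    and \<gamma>: "\<gamma> > 0"
    and Ps: "stabilizing_solution M \<F> W A A1 B E Q R \<gamma> Ps"
  shows "\<forall>\<epsilon>0. 0 < \<epsilon>0 \<and> \<epsilon>0 < 1 \<longrightarrow>
    (\<exists>\<delta>0>0.
      (\<exists>k0>0. \<forall>P \<in> psd_ball Ps \<delta>0.
        lyap_spectrum (closed_loop A B E R \<gamma> P) A1 \<subseteq> open_left_half_plane \<and>
        (\<exists>!X. newton_step A A1 B E Q R \<gamma> P X) \<and>
        (\<forall>X. newton_step A A1 B E Q R \<gamma> P X \<longrightarrow>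
          norm (X - Ps) \<le> k0 * (norm (P - Ps))\<^sup>2 \<and>
          norm (X - Ps) \<le> \<epsilon>0 * norm (P - Ps))) \<and>
      (\<exists>\<delta>1>0. \<exists>k3>0. \<forall>P0 (\<Delta> :: nat \<Rightarrow> real^('n + 'm + 'p)^('n + 'm + 'p)).
        P0 \<in> psd_ball Ps \<delta>0 \<and>
        (\<forall>i. symmetric (\<Delta> i)) \<and> \<Delta> 0 = 0 \<and>
        bdd_above (range (\<lambda>i. norm (\<Delta> i))) \<and> (SUP i. norm (\<Delta> i)) < \<delta>1 \<longrightarrow>
        (\<exists>P L K Mh. robust_spu A A1 B E Q R \<gamma> P0 \<Delta> P L K Mh) \<and>
        (\<forall>P L K Mh. robust_spu A A1 B E Q R \<gamma> P0 \<Delta> P L K Mh \<longrightarrow>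
          (\<forall>i. lyap_spectrum (A - B ** L i - E ** K i) A1 \<subseteq> open_left_half_plane \<and>
            invertible (block22 (Mh i)) \<and> invertible (block33 (Mh i)) \<and>
            (\<exists>!X. spu_eval A A1 B E Q R \<gamma> (L i) (K i) X)) \<and>
          (\<forall>i. norm (P i - Ps) \<le>
            \<epsilon>0 ^ i * norm (P0 - Ps) + k3 / (1 - \<epsilon>0) * (SUP j. norm (\<Delta> j))) \<and>
          ((\<lambda>i. norm (\<Delta> i)) \<longlonglongrightarrow> 0 \<longrightarrow> (\<lambda>i. norm (P i - Ps)) \<longlonglongrightarrow> 0))))"
proof -
  interpret brownian_filtration M \<F> W by unfold_locales (rule BM)
  have Ps': "symmetric Ps" "gare A A1 B E Q R \<gamma> Ps"
    "lyap_spectrum (closed_loop A B E R \<gamma> Ps) A1 \<subseteq> open_left_half_plane"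
    using Ps ams_stable_spectrum by (auto simp: stabilizing_solution_def psd_def)
  have QR: "symmetric Q" "invertible R" "symmetric R"
    unfolding Q R by (simp_all add: symmetric_def matrix_transpose_mul gram_invertible[OF D_rank])
  from \<gamma> have \<gamma>': "\<gamma> \<noteq> 0" by simp
  show ?thesis
    by (intro allI impI, elim conjE)
      (rule robust_spu_convergence[OF Ps'(1) QR \<gamma>' Ps'(2,3)]; assumption)
qed

end
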